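(* Let $k$ be a field, let $S$ be a finite Koszul set of distinct $k$-points in $\mathbb{P}^n$ and let $S'\subset S$ be a subset. Assume that $S\setminus S'$ imposes independent conditions on quadrics passing through $S'$. Then $S'$ is also Koszul.
   Context: Fix a ground field $k$; points of $\mathbb{P}^n$ are $k$-points. For a finite set $S\subset\mathbb{P}^n$, its homogeneous coordinate ring is $A_S=k[x_0,\dots,x_n]/I_S$, where $I_S$ is the homogeneous ideal generated by the homogeneous polynomials vanishing on $S$ (with the convention $A_\emptyset=k$). A graded $k$-algebra $A=\bigoplus_{m\ge 0}A_m$ with $A_0=k$ is Koszul if $\operatorname{Tor}^A_{i,j}(k,k)=0$ whenever $i\ne j$, where $j$ denotes the internal degree. The set $S$ is called Koszul if $A_S$ is Koszul. For a subspace $V\subset H^0(\mathbb{P}^n,\mathcal{O}(d))$ and a finite set of points $U\subset\mathbb{P}^n$, $U$ imposes independent conditions on $V$ if the evaluation map $V\to H^0(U,\mathcal{O}(d)|_U)$ is surjective. "$U$ imposes independent conditions on quadrics passing through $S'$" means that this holds with $d=2$ and $V$ the space of all sections of $\mathcal{O}(2)$ (i.e. quadratic forms) vanishing on $S'$. *)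

theory Defs
  imports
    "HOL-Analysis.Cartesian_Space"
    "HOL-Library.Poly_Mapping"
    "HOL-Algebra.QuotRing"
    "HOL-Algebra.Elementary_Groups"
    "HOL-Algebra.Algebraic_Closure_Type"
begin

section \<open>Graded free resolutions, Tor and Koszul algebras\<close>

text \<open>
  A graded ring is given by a ring record \<open>R\<close> together with the sequence \<open>A\<close> of its homogeneous
  components \<open>A m \<subseteq> carrier R\<close>.  The definitions are meant for graded \<open>k\<close>-algebras with \<open>A 0 = k\<close>;
  then the residue field \<open>k\<close>, as a graded module concentrated in degree 0, is the quotient of \<open>R\<close>
  by the ideal generated by the elements of positive degree.
\<close>

definition irrelevant_ideal :: "('a, 'm) ring_scheme \<Rightarrow> (nat \<Rightarrow> 'a set) \<Rightarrow> 'a set" where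
  "irrelevant_ideal R A = Idl\<^bsub>R\<^esub> (\<Union>m\<in>{0<..}. A m)"

definition residue_ring :: "('a, 'm) ring_scheme \<Rightarrow> (nat \<Rightarrow> 'a set) \<Rightarrow> 'a set ring" where
  "residue_ring R A = R Quot irrelevant_ideal R A"

definition free_module :: "('a, 'm) ring_scheme \<Rightarrow> 'b set \<Rightarrow> ('b \<Rightarrow> 'a) set" where
  "free_module R B =
     {x. (\<forall>b\<in>B. x b \<in> carrier R) \<and> (\<forall>b. b \<notin> B \<longrightarrow> x b = \<zero>\<^bsub>R\<^esub>) \<and> finite {b. x b \<noteq> \<zero>\<^bsub>R\<^esub>}}"

definition vadd :: "('a, 'm) ring_scheme \<Rightarrow> ('b \<Rightarrow> 'a) \<Rightarrow> ('b \<Rightarrow> 'a) \<Rightarrow> 'b \<Rightarrow> 'a" where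
  "vadd R x y = (\<lambda>b. x b \<oplus>\<^bsub>R\<^esub> y b)"

definition vscale :: "('a, 'm) ring_scheme \<Rightarrow> 'a \<Rightarrow> ('b \<Rightarrow> 'a) \<Rightarrow> 'b \<Rightarrow> 'a" where
  "vscale R r x = (\<lambda>b. r \<otimes>\<^bsub>R\<^esub> x b)"

definition vzero :: "('a, 'm) ring_scheme \<Rightarrow> 'b \<Rightarrow> 'a" where
  "vzero R = (\<lambda>b. \<zero>\<^bsub>R\<^esub>)"

text \<open>
  The degree \<open>j\<close> component of the graded free module \<open>\<Oplus>b\<in>B. R(- w b)\<close>, whose basis element with
  index \<open>b\<close> has degree \<open>w b\<close>.
\<close>

definition free_component ::
  "('a, 'm) ring_scheme \<Rightarrow> (nat \<Rightarrow> 'a set) \<Rightarrow> 'b set \<Rightarrow> ('b \<Rightarrow> nat) \<Rightarrow> nat \<Rightarrow> ('b \<Rightarrow> 'a) set" where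
  "free_component R A B w j =
     {x \<in> free_module R B. \<forall>b\<in>B. if w b \<le> j then x b \<in> A (j - w b) else x b = \<zero>\<^bsub>R\<^esub>}"

text \<open>
  An augmented complex \<open>\<dots> \<rightarrow> F\<^sub>2 \<rightarrow> F\<^sub>1 \<rightarrow> F\<^sub>0 \<rightarrow> k\<close> of graded free modules: \<open>F\<^sub>i\<close> has the basis
  \<open>gens F i\<close> with degrees \<open>gdeg F i\<close>, the map \<open>bd F i\<close> goes from \<open>F\<^sub>i\<^sub>+\<^sub>1\<close> to \<open>F\<^sub>i\<close>, and \<open>aug F\<close> goes from
  \<open>F\<^sub>0\<close> to \<open>k\<close>.
\<close>

record ('a, 'b) free_complex =
  gens :: "nat \<Rightarrow> 'b set"
  gdeg :: "nat \<Rightarrow> 'b \<Rightarrow> nat"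
  bd :: "nat \<Rightarrow> ('b \<Rightarrow> 'a) \<Rightarrow> 'b \<Rightarrow> 'a"
  aug :: "('b \<Rightarrow> 'a) \<Rightarrow> 'a set"

abbreviation chain_module ::
  "('a, 'm) ring_scheme \<Rightarrow> ('a, 'b) free_complex \<Rightarrow> nat \<Rightarrow> ('b \<Rightarrow> 'a) set" where
  "chain_module R F i \<equiv> free_module R (gens F i)"

abbreviation chain_component ::
  "('a, 'm) ring_scheme \<Rightarrow> (nat \<Rightarrow> 'a set) \<Rightarrow> ('a, 'b) free_complex \<Rightarrow> nat \<Rightarrow> nat \<Rightarrow> ('b \<Rightarrow> 'a) set"
where
  "chain_component R A F i j \<equiv> free_component R A (gens F i) (gdeg F i) j"

definition graded_free_resolution ::
  "('a, 'm) ring_scheme \<Rightarrow> (nat \<Rightarrow> 'a set) \<Rightarrow> ('a, 'b) free_complex \<Rightarrow> bool" where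
  "graded_free_resolution R A F \<longleftrightarrow>
     \<comment> \<open>the differentials are homomorphisms of graded modules\<close>
     (\<forall>i. bd F i \<in> chain_module R F (Suc i) \<rightarrow> chain_module R F i) \<and>
     (\<forall>i. \<forall>x\<in>chain_module R F (Suc i). \<forall>y\<in>chain_module R F (Suc i).
        bd F i (vadd R x y) = vadd R (bd F i x) (bd F i y)) \<and>
     (\<forall>i. \<forall>r\<in>carrier R. \<forall>x\<in>chain_module R F (Suc i).
        bd F i (vscale R r x) = vscale R r (bd F i x)) \<and>
     (\<forall>i j. bd F i \<in> chain_component R A F (Suc i) j \<rightarrow> chain_component R A F i j) \<and>
     \<comment> \<open>so is the augmentation, the target being concentrated in degree 0\<close>
     (\<forall>x\<in>chain_module R F 0. \<forall>y\<in>chain_module R F 0.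
        aug F (vadd R x y) = aug F x \<oplus>\<^bsub>residue_ring R A\<^esub> aug F y) \<and>
     (\<forall>r\<in>carrier R. \<forall>x\<in>chain_module R F 0.
        aug F (vscale R r x) = (irrelevant_ideal R A +>\<^bsub>R\<^esub> r) \<otimes>\<^bsub>residue_ring R A\<^esub> aug F x) \<and>
     (\<forall>j>0. \<forall>x\<in>chain_component R A F 0 j. aug F x = \<zero>\<^bsub>residue_ring R A\<^esub>) \<and>
     \<comment> \<open>exactness\<close>
     aug F ` chain_module R F 0 = carrier (residue_ring R A) \<and>
     {x \<in> chain_module R F 0. aug F x = \<zero>\<^bsub>residue_ring R A\<^esub>} = bd F 0 ` chain_module R F 1 \<and>
     (\<forall>i. {x \<in> chain_module R F (Suc i). bd F i x = vzero R} =
          bd F (Suc i) ` chain_module R F (Suc (Suc i)))"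

text \<open>
  \<open>Tor\<^sub>i\<^sub>,\<^sub>j(k, k)\<close> computed from the resolution \<open>F\<close>: the degree \<open>j\<close> part of the \<open>i\<close>-th homology group of
  \<open>F \<otimes> k = F / R\<^sub>+F\<close>, where \<open>R\<^sub>+\<close> is the irrelevant ideal.  For a free module \<open>R\<^sub>+F\<^sub>i\<close> consists of the
  vectors with entries in \<open>R\<^sub>+\<close>.  Cycles and boundaries of the quotient complex are represented by
  their full preimages in the degree \<open>j\<close> part of \<open>F\<^sub>i\<close>.
\<close>

definition reduces_to_zero ::
  "('a, 'm) ring_scheme \<Rightarrow> (nat \<Rightarrow> 'a set) \<Rightarrow> ('b \<Rightarrow> 'a) \<Rightarrow> bool" where
  "reduces_to_zero R A x \<longleftrightarrow> (\<forall>b. x b \<in> irrelevant_ideal R A)"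

definition tor_cycles ::
  "('a, 'm) ring_scheme \<Rightarrow> (nat \<Rightarrow> 'a set) \<Rightarrow> ('a, 'b) free_complex \<Rightarrow> nat \<Rightarrow> nat \<Rightarrow> ('b \<Rightarrow> 'a) set"
where
  "tor_cycles R A F i j =
     {x \<in> chain_component R A F i j.
        case i of 0 \<Rightarrow> True | Suc i' \<Rightarrow> reduces_to_zero R A (bd F i' x)}"

definition tor_boundaries ::
  "('a, 'm) ring_scheme \<Rightarrow> (nat \<Rightarrow> 'a set) \<Rightarrow> ('a, 'b) free_complex \<Rightarrow> nat \<Rightarrow> nat \<Rightarrow> ('b \<Rightarrow> 'a) set"
where
  "tor_boundaries R A F i j =
     {vadd R (bd F i y) z | y z.
        y \<in> chain_component R A F (Suc i) j \<and>
        z \<in> chain_component R A F i j \<and> reduces_to_zero R A z}"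

definition Tor ::
  "('a, 'm) ring_scheme \<Rightarrow> (nat \<Rightarrow> 'a set) \<Rightarrow> ('a, 'b) free_complex \<Rightarrow> nat \<Rightarrow> nat \<Rightarrow>
   ('b \<Rightarrow> 'a) set monoid" where
  "Tor R A F i j =
     \<lparr>carrier = tor_cycles R A F i j, monoid.mult = vadd R, one = vzero R\<rparr> Mod
     tor_boundaries R A F i j"

text \<open>
  Up to isomorphism \<open>Tor\<close> does not depend on the resolution, so one may quantify existentially over
  it.  The index type \<^typ>\<open>'a list\<close> for the bases is no restriction: if \<open>A 0 = k\<close> is a field, the
  bar resolution has as \<open>i\<close>-th basis the lists of length \<open>i\<close> of elements of a homogeneous
  \<open>k\<close>-basis of the irrelevant ideal.  Its generators have nonnegative degrees, so \<^typ>\<open>nat\<close>-valued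
  degrees are no restriction either.
\<close>

definition koszul_algebra :: "('a, 'm) ring_scheme \<Rightarrow> (nat \<Rightarrow> 'a set) \<Rightarrow> bool" where
  "koszul_algebra R A \<longleftrightarrow>
     (\<exists>F :: ('a, 'a list) free_complex. graded_free_resolution R A F \<and>
        (\<forall>i j. i \<noteq> j \<longrightarrow> trivial_group (Tor R A F i j)))"


section \<open>Polynomials and projective points\<close>

text \<open>
  The homogeneous coordinates of \<open>\<P>\<^sup>n\<close> are indexed by a finite type \<open>'n\<close> with \<open>n + 1\<close> elements, and
  \<open>k\<close>-points are the lines through the origin in \<open>k\<^sup>n\<^sup>+\<^sup>1\<close>.  A polynomial maps exponent vectors to
  coefficients.
\<close>

type_synonym ('k, 'n) mpoly = "('n \<Rightarrow>\<^sub>0 nat) \<Rightarrow>\<^sub>0 'k"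

definition projective_points :: "('k::field ^ 'n::finite) set set" where
  "projective_points = {vec.span {v} | v. v \<noteq> 0}"

definition eval_poly :: "('k::field, 'n::finite) mpoly \<Rightarrow> 'k ^ 'n \<Rightarrow> 'k" where
  "eval_poly f v =
     (\<Sum>m\<in>Poly_Mapping.keys f. Poly_Mapping.lookup f m * (\<Prod>i\<in>UNIV. (v $ i) ^ Poly_Mapping.lookup m i))"

definition forms :: "nat \<Rightarrow> ('k::field, 'n::finite) mpoly set" where
  "forms d = {f. \<forall>m\<in>Poly_Mapping.keys f. (\<Sum>i\<in>UNIV. Poly_Mapping.lookup m i) = d}"

definition vanishes_on :: "('k::field, 'n::finite) mpoly \<Rightarrow> ('k ^ 'n) set set \<Rightarrow> bool" where
  "vanishes_on f S \<longleftrightarrow> (\<forall>L\<in>S. \<forall>v\<in>L. eval_poly f v = 0)"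

definition forms_through :: "nat \<Rightarrow> ('k::field ^ 'n::finite) set set \<Rightarrow> ('k, 'n) mpoly set" where
  "forms_through d S = {f \<in> forms d. vanishes_on f S}"


section \<open>Homogeneous coordinate rings\<close>

abbreviation poly_ring :: "('k::field, 'n::finite) mpoly ring" where
  "poly_ring \<equiv> ring_of_type_algebra"

text \<open>
  The forms vanishing on the empty set generate the unit ideal; the ideal generated by all forms of
  positive degree is used instead, so that the coordinate ring of the empty set is \<open>k\<close>.
\<close>

definition coord_ideal :: "('k::field ^ 'n::finite) set set \<Rightarrow> ('k, 'n) mpoly set" where
  "coord_ideal S =
     (if S = {} then Idl\<^bsub>poly_ring\<^esub> (\<Union>d\<in>{0<..}. forms d)
      else Idl\<^bsub>poly_ring\<^esub> (\<Union>d. forms_through d S))"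

definition coord_ring :: "('k::field ^ 'n::finite) set set \<Rightarrow> ('k, 'n) mpoly set ring" where
  "coord_ring S = poly_ring Quot coord_ideal S"

definition coord_grading ::
  "('k::field ^ 'n::finite) set set \<Rightarrow> nat \<Rightarrow> ('k, 'n) mpoly set set" where
  "coord_grading S d = (\<lambda>f. coord_ideal S +>\<^bsub>poly_ring\<^esub> f) ` forms d"

definition koszul_set :: "('k::field ^ 'n::finite) set set \<Rightarrow> bool" where
  "koszul_set S \<longleftrightarrow> koszul_algebra (coord_ring S) (coord_grading S)"


section \<open>Independent conditions\<close>

text \<open>
  The fibre of \<open>\<O>(d)\<close> at the point given by the line \<open>L\<close> is the one-dimensional space of
  homogeneous functions of degree \<open>d\<close> on \<open>L\<close>, so a section over a finite set \<open>U\<close> of points is a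
  family \<open>s\<close> of such functions; only the values \<open>s L v\<close> with \<open>L \<in> U\<close> and \<open>v \<in> L\<close> matter.
\<close>

definition sections :: "nat \<Rightarrow> ('k::field ^ 'n::finite) set set \<Rightarrow> (('k ^ 'n) set \<Rightarrow> 'k ^ 'n \<Rightarrow> 'k) set"
where
  "sections d U = {s. \<forall>L\<in>U. \<forall>v\<in>L. \<forall>c. s L (c *s v) = c ^ d * s L v}"

definition imposes_independent_conditions ::
  "nat \<Rightarrow> ('k::field ^ 'n::finite) set set \<Rightarrow> ('k, 'n) mpoly set \<Rightarrow> bool" where
  "imposes_independent_conditions d U V \<longleftrightarrow>
     (\<forall>s\<in>sections d U. \<exists>f\<in>V. \<forall>L\<in>U. \<forall>v\<in>L. eval_poly f v = s L v)"

end

theory Submission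
  imports Defs "HOL-Library.Function_Algebras"
begin

text \<open>
  Let \<open>P\<close> be the polynomial ring, \<open>I\<^sub>T\<close> the ideal of a set \<open>T\<close> of points, \<open>A = P / I\<^sub>S\<close> and \<open>B = P / I\<^sub>S\<^sub>'\<close>.
  Say that a graded \<open>A\<close>-module \<open>M\<close> has regularity at most \<open>r\<close> if \<open>Tor\<^sup>A\<^sub>i\<^sub>,\<^sub>j(M, k) = 0\<close> for all \<open>j > i + r\<close>.  That
  \<open>A\<close> is Koszul means that \<open>k\<close> has regularity zero.  The theorem combines two facts.

  First, \<open>B\<close> has regularity at most one over \<open>A\<close> (\<open>reg_le_subset\<close>).  Remove the points of \<open>S - S'\<close> one by
  one.  If \<open>p\<close> is removed and \<open>T\<close> is left, the kernel of \<open>P / I\<^sub>T\<^sub>+\<^sub>p \<rightarrow> P / I\<^sub>T\<close> is identified by evaluation at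
  \<open>p\<close> with an ideal \<open>(t ^ a)\<close> in the coordinate ring \<open>k[t]\<close> of \<open>p\<close>, and \<open>a \<le> 2\<close> because some quadric contains \<open>T\<close> but
  not \<open>p\<close>.  A linear form \<open>t\<close> acts as zero on \<open>Tor(M, k)\<close>, so the sequence
  \<open>0 \<rightarrow> k[t](-1) \<rightarrow> k[t] \<rightarrow> k \<rightarrow> 0\<close> embeds \<open>Tor(k[t], k)\<close> into \<open>Tor(k, k)\<close>: over a Koszul algebra \<open>k[t]\<close> has
  regularity zero, and \<open>k[t](-a)\<close> has regularity \<open>a\<close> (\<open>reg_le_point\<close>).  So the kernel has regularity at
  most two, and the long exact sequence passes the bound one from \<open>P / I\<^sub>T\<^sub>+\<^sub>p\<close> to \<open>P / I\<^sub>T\<close>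
  (\<open>reg_le_quotient\<close>).

  Second, a quotient \<open>B\<close> of regularity at most one of a Koszul algebra \<open>A\<close> is Koszul
  (\<open>linear_resolution\<close>).  Build the minimal resolution of \<open>k\<close> over \<open>B\<close> and watch the regularity over \<open>A\<close>.
  If a syzygy module has generators of degree \<open>n\<close> and regularity at most \<open>n\<close>, the free \<open>B\<close>-module that
  covers it has regularity at most \<open>n + 1\<close>, hence so does the next syzygy module
  (\<open>reg_le_kernel\<close>).  The latter has no elements of degree \<open>n\<close>, and modules of regularity at most \<open>n + 1\<close> are
  generated in degrees up to \<open>n + 1\<close> (\<open>generated_in_lower_degrees\<close>), so its generators have degree \<open>n + 1\<close>
  (\<open>linear_cover\<close>).

  Only \<open>Tor\<^sup>A(M, k)\<close> with a fixed resolution of \<open>k\<close> over \<open>A\<close> and varying \<open>M\<close> is used.  The resolution is lifted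
  to matrices over \<open>P\<close>, and \<open>M\<close> is a subquotient of a module over \<open>P\<close>, so that all computations take place
  with representatives over \<open>P\<close> and separately in each degree.  The lemmas \<open>koszul_algebra_lifts\<close> and
  \<open>koszul_algebra_from_lifts\<close> translate between such lifts and resolutions over quotient rings.
\<close>

section \<open>Chains and homogeneous matrices\<close>

text \<open>
  The row \<open>N b\<close> is the image of the basis element \<open>b\<close> under a map of free modules, and \<open>mat_app s N\<close>
  is this map tensored with the module on which scalars act through \<open>s\<close>.  The sum runs over the
  support of \<open>z\<close>, so that bases may be infinite.
\<close>

definition mat_app ::
  "('p \<Rightarrow> 'm::ab_group_add \<Rightarrow> 'm) \<Rightarrow> ('b \<Rightarrow> 'c \<Rightarrow> 'p) \<Rightarrow> ('b \<Rightarrow> 'm) \<Rightarrow> 'c \<Rightarrow> 'm" where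
  "mat_app s N z = (\<lambda>c. \<Sum>b | z b \<noteq> 0. s (N b c) (z b))"

text \<open>
  The part of degree \<open>j\<close> of \<open>F \<otimes> U\<close>, where \<open>F\<close> is free with a basis \<open>B\<close> of degrees \<open>w\<close> and \<open>U\<close> is a
  graded module.  A graded module is given by its homogeneous pieces \<open>U j\<close>; their direct sum never
  occurs.
\<close>

definition chains ::
  "'b set \<Rightarrow> ('b \<Rightarrow> nat) \<Rightarrow> (nat \<Rightarrow> 'm::zero set) \<Rightarrow> nat \<Rightarrow> ('b \<Rightarrow> 'm) set" where
  "chains B w U j =
     {z. finite {b. z b \<noteq> 0} \<and> (\<forall>b. if b \<in> B \<and> w b \<le> j then z b \<in> U (j - w b) else z b = 0)}"

definition additive_pieces :: "(nat \<Rightarrow> 'm::ab_group_add set) \<Rightarrow> bool" where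
  "additive_pieces U \<longleftrightarrow>
     (\<forall>j. 0 \<in> U j \<and> (\<forall>x\<in>U j. \<forall>y\<in>U j. x + y \<in> U j) \<and> (\<forall>x\<in>U j. - x \<in> U j))"

lemma additive_pieces_zero: "additive_pieces U \<Longrightarrow> 0 \<in> U j"
  and additive_pieces_add: "additive_pieces U \<Longrightarrow> x \<in> U j \<Longrightarrow> y \<in> U j \<Longrightarrow> x + y \<in> U j"
  and additive_pieces_uminus: "additive_pieces U \<Longrightarrow> x \<in> U j \<Longrightarrow> - x \<in> U j"
  by (auto simp: additive_pieces_def)

lemma additive_pieces_diff: "additive_pieces U \<Longrightarrow> x \<in> U j \<Longrightarrow> y \<in> U j \<Longrightarrow> x - y \<in> U j"
  by (metis additive_pieces_add additive_pieces_uminus diff_conv_add_uminus)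

lemma additive_pieces_sum:
  "additive_pieces U \<Longrightarrow> (\<And>b. b \<in> K \<Longrightarrow> f b \<in> U j) \<Longrightarrow> sum f K \<in> U j"
  by (induction K rule: infinite_finite_induct)
    (auto simp: additive_pieces_zero additive_pieces_add)

lemma chains_fin: "z \<in> chains B w U j \<Longrightarrow> finite {b. z b \<noteq> 0}"
  and chains_in: "z \<in> chains B w U j \<Longrightarrow> b \<in> B \<Longrightarrow> w b \<le> j \<Longrightarrow> z b \<in> U (j - w b)"
  and chains_out: "z \<in> chains B w U j \<Longrightarrow> b \<notin> B \<Longrightarrow> z b = 0"
  and chains_out': "z \<in> chains B w U j \<Longrightarrow> j < w b \<Longrightarrow> z b = 0"
  unfolding chains_def by (auto split: if_splits)

lemma chains_support:
  assumes "z \<in> chains B w U j" "z b \<noteq> 0"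
  shows "b \<in> B" "w b \<le> j" "z b \<in> U (j - w b)"
  using assms unfolding chains_def by (auto split: if_splits)

lemma chainsI:
  assumes "finite {b. z b \<noteq> 0}"
    and "\<And>b. b \<in> B \<Longrightarrow> w b \<le> j \<Longrightarrow> z b \<in> U (j - w b)"
    and "\<And>b. \<not> (b \<in> B \<and> w b \<le> j) \<Longrightarrow> z b = 0"
  shows "z \<in> chains B w U j"
  using assms unfolding chains_def by auto

lemma chainsI_support:
  assumes "additive_pieces U" "finite {b. z b \<noteq> 0}"
    and "\<And>b. z b \<noteq> 0 \<Longrightarrow> b \<in> B \<and> w b \<le> j \<and> z b \<in> U (j - w b)"
  shows "z \<in> chains B w U j"
  by (rule chainsI) (use assms additive_pieces_zero in metis)+

lemma chains_mono:
  assumes "z \<in> chains B w U j" "\<And>k. U k \<subseteq> W k"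
  shows "z \<in> chains B w W j"
  using assms unfolding chains_def by (auto split: if_splits)

lemma finite_support_add:
  "finite {b. x b \<noteq> 0} \<Longrightarrow> finite {b. y b \<noteq> 0} \<Longrightarrow> finite {b. x b + y b \<noteq> (0::'m::ab_group_add)}"
  by (rule finite_subset[of _ "{b. x b \<noteq> 0} \<union> {b. y b \<noteq> 0}"]) auto

lemma finite_support_diff:
  "finite {b. x b \<noteq> 0} \<Longrightarrow> finite {b. y b \<noteq> 0} \<Longrightarrow> finite {b. x b - y b \<noteq> (0::'m::ab_group_add)}"
  by (rule finite_subset[of _ "{b. x b \<noteq> 0} \<union> {b. y b \<noteq> 0}"]) auto

lemma chains_add:
  assumes "additive_pieces U" "x \<in> chains B w U j" "y \<in> chains B w U j"
  shows "(\<lambda>b. x b + y b) \<in> chains B w U j"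
  using assms unfolding chains_def by (auto simp: finite_support_add additive_pieces_add split: if_splits)

lemma chains_diff:
  assumes "additive_pieces U" "x \<in> chains B w U j" "y \<in> chains B w U j"
  shows "(\<lambda>b. x b - y b) \<in> chains B w U j"
  using assms unfolding chains_def by (auto simp: additive_pieces_diff simp del: right_minus_eq intro!: finite_support_diff split: if_splits)

lemma chains_uminus:
  assumes "additive_pieces U" "x \<in> chains B w U j"
  shows "(\<lambda>b. - x b) \<in> chains B w U j"
  using assms unfolding chains_def by (auto simp: additive_pieces_uminus split: if_splits)

lemma chains_zero: "additive_pieces U \<Longrightarrow> (\<lambda>b. 0) \<in> chains B w U j"
  unfolding chains_def by (auto simp: additive_pieces_zero)

lemma chains_single:
  assumes "additive_pieces U" "b \<in> B" "x \<in> U d"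
  shows "(\<lambda>c. if c = b then x else 0) \<in> chains B w U (w b + d)"
  using additive_pieces_zero[OF assms(1)] by (intro chainsI) (use assms(2,3) in auto)

context Modules.module
begin

lemma mat_app_eq_sum:
  assumes "finite K" "{b. z b \<noteq> 0} \<subseteq> K"
  shows "mat_app scale N z c = (\<Sum>b\<in>K. scale (N b c) (z b))"
  unfolding mat_app_def using assms by (intro sum.mono_neutral_left) auto

lemma mat_app_zero: "mat_app scale N (\<lambda>b. 0) = (\<lambda>c. 0)"
  unfolding mat_app_def by simp

lemma mat_app_add:
  assumes "finite {b. x b \<noteq> 0}" "finite {b. y b \<noteq> 0}"
  shows "mat_app scale N (\<lambda>b. x b + y b) = (\<lambda>c. mat_app scale N x c + mat_app scale N y c)"
proof
  fix c
  let ?K = "{b. x b \<noteq> 0} \<union> {b. y b \<noteq> 0}"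
  have K: "finite ?K" "{b. x b + y b \<noteq> 0} \<subseteq> ?K" using assms by auto
  show "mat_app scale N (\<lambda>b. x b + y b) c = mat_app scale N x c + mat_app scale N y c"
    using K by (simp add: mat_app_eq_sum[of ?K] scale_right_distrib sum.distrib)
qed

lemma mat_app_uminus: "mat_app scale N (\<lambda>b. - x b) = (\<lambda>c. - mat_app scale N x c)"
  unfolding mat_app_def by (simp add: sum_negf)

lemma mat_app_diff:
  assumes "finite {b. x b \<noteq> 0}" "finite {b. y b \<noteq> 0}"
  shows "mat_app scale N (\<lambda>b. x b - y b) = (\<lambda>c. mat_app scale N x c - mat_app scale N y c)"
  using mat_app_add[of x "\<lambda>b. - y b" N] assms by (simp add: mat_app_uminus)

lemma mat_app_scale:
  assumes "finite {b. x b \<noteq> 0}"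
  shows "mat_app scale N (\<lambda>b. scale t (x b)) = (\<lambda>c. scale t (mat_app scale N x c))"
proof
  fix c
  have "{b. scale t (x b) \<noteq> 0} \<subseteq> {b. x b \<noteq> 0}" by auto
  then show "mat_app scale N (\<lambda>b. scale t (x b)) c = scale t (mat_app scale N x c)"
    using assms by (simp add: mat_app_eq_sum[of "{b. x b \<noteq> 0}"] scale_sum_right mult.commute)
qed

lemma mat_app_add_left:
  "mat_app scale (\<lambda>b c. N b c + N' b c) z = (\<lambda>c. mat_app scale N z c + mat_app scale N' z c)"
  unfolding mat_app_def by (simp add: scale_left_distrib sum.distrib)

lemma mat_app_diff_left:
  "mat_app scale (\<lambda>b c. N b c - N' b c) z = (\<lambda>c. mat_app scale N z c - mat_app scale N' z c)"
  unfolding mat_app_def by (simp add: scale_left_diff_distrib sum_subtractf)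

lemma mat_app_single_scale:
  "mat_app scale (\<lambda>b c. if c = b then t else 0) z = (\<lambda>c. scale t (z c))"
  if "finite {b. z b \<noteq> 0}"
proof
  fix c
  have "(\<Sum>b | z b \<noteq> 0. scale (if c = b then t else 0) (z b)) =
      (\<Sum>b | z b \<noteq> 0. if c = b then scale t (z b) else 0)"
    by (rule sum.cong) auto
  also have "\<dots> = scale t (z c)" using that by (auto simp: sum.delta)
  finally show "mat_app scale (\<lambda>b c. if c = b then t else 0) z c = scale t (z c)"
    by (simp add: mat_app_def)
qed

lemma finite_support_mat_app:
  assumes "finite {b. z b \<noteq> 0}" "\<And>b. z b \<noteq> 0 \<Longrightarrow> finite {c. N b c \<noteq> 0}"
  shows "finite {c. mat_app scale N z c \<noteq> 0}"
proof (rule finite_subset)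
  show "{c. mat_app scale N z c \<noteq> 0} \<subseteq> (\<Union>b\<in>{b. z b \<noteq> 0}. {c. N b c \<noteq> 0})"
  proof
    fix c assume "c \<in> {c. mat_app scale N z c \<noteq> 0}"
    then have "(\<Sum>b | z b \<noteq> 0. scale (N b c) (z b)) \<noteq> 0" by (simp add: mat_app_def)
    then obtain b where "z b \<noteq> 0" "scale (N b c) (z b) \<noteq> 0"
      by (metis (mono_tags, lifting) mem_Collect_eq sum.neutral)
    then show "c \<in> (\<Union>b\<in>{b. z b \<noteq> 0}. {c. N b c \<noteq> 0})" by auto
  qed
  show "finite (\<Union>b\<in>{b. z b \<noteq> 0}. {c. N b c \<noteq> 0})" using assms by auto
qed

text \<open>
  Every summand of the entry at \<open>c\<close> has degree \<open>j + d - w' c\<close>.  With \<open>Y\<close> the whole ring this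
  says that homogeneous matrices act on every graded module; with \<open>Y\<close> an ideal that multiplies \<open>U\<close>
  into \<open>V\<close> it says that matrices with entries in this ideal act as zero on \<open>U / V\<close>.
\<close>

lemma mat_app_chains:
  assumes N: "\<And>b. b \<in> B \<Longrightarrow> N b \<in> chains B' w' Y (w b + d)"
    and z: "z \<in> chains B w U j" and V: "additive_pieces V"
    and YU: "\<And>d k a x. a \<in> Y d \<Longrightarrow> x \<in> U k \<Longrightarrow> scale a x \<in> V (d + k)"
  shows "mat_app scale N z \<in> chains B' w' V (j + d)"
proof (rule chainsI_support[OF V])
  show "finite {c. mat_app scale N z c \<noteq> 0}"
    by (rule finite_support_mat_app)
      (use chains_fin[OF z] N chains_fin chains_support(1)[OF z] in \<open>blast+\<close>)
  fix c assume nz: "mat_app scale N z c \<noteq> 0"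
  have summand: "c \<in> B' \<and> w' c \<le> j + d \<and> scale (N b c) (z b) \<in> V (j + d - w' c)"
    if b: "z b \<noteq> 0" and N0: "N b c \<noteq> 0" for b
  proof -
    have zb: "b \<in> B" "w b \<le> j" "z b \<in> U (j - w b)" using chains_support[OF z b] by auto
    have Nb: "c \<in> B'" "w' c \<le> w b + d" "N b c \<in> Y (w b + d - w' c)"
      using chains_support[OF N[OF zb(1)] N0] by auto
    have "w b + d - w' c + (j - w b) = j + d - w' c" using zb Nb by simp
    then show ?thesis using YU[OF Nb(3) zb(3)] zb(2) Nb(1,2) by auto
  qed
  obtain b where "z b \<noteq> 0" "N b c \<noteq> 0"
  proof -
    from nz have "(\<Sum>b | z b \<noteq> 0. scale (N b c) (z b)) \<noteq> 0" by (simp add: mat_app_def)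
    then obtain b where "z b \<noteq> 0" "scale (N b c) (z b) \<noteq> 0"
      by (metis (mono_tags, lifting) mem_Collect_eq sum.neutral)
    then have "N b c \<noteq> 0" by auto
    with \<open>z b \<noteq> 0\<close> that show ?thesis by blast
  qed
  then have c: "c \<in> B'" "w' c \<le> j + d" using summand by auto
  moreover have "mat_app scale N z c \<in> V (j + d - w' c)"
    unfolding mat_app_def
  proof (rule additive_pieces_sum[OF V])
    fix b assume "b \<in> {b. z b \<noteq> 0}"
    then show "scale (N b c) (z b) \<in> V (j + d - w' c)"
      using summand[of b] additive_pieces_zero[OF V] by (cases "N b c = 0") auto
  qed
  ultimately show "c \<in> B' \<and> w' c \<le> j + d \<and> mat_app scale N z c \<in> V (j + d - w' c)" by simp
qed

lemma mat_app_mat_app: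
  assumes z: "finite {b. z b \<noteq> 0}" and N': "\<And>b. z b \<noteq> 0 \<Longrightarrow> finite {c. N' b c \<noteq> 0}"
  shows "mat_app scale N (mat_app scale N' z) = mat_app scale (\<lambda>b. mat_app (*) N (N' b)) z"
proof
  fix e
  let ?K = "\<Union>b\<in>{b. z b \<noteq> 0}. {c. N' b c \<noteq> 0}"
  have K: "finite ?K" using assms by auto
  have sub: "{c. mat_app scale N' z c \<noteq> 0} \<subseteq> ?K"
  proof
    fix c assume "c \<in> {c. mat_app scale N' z c \<noteq> 0}"
    then have "(\<Sum>b | z b \<noteq> 0. scale (N' b c) (z b)) \<noteq> 0" by (simp add: mat_app_def)
    then obtain b where "z b \<noteq> 0" "scale (N' b c) (z b) \<noteq> 0"
      by (metis (mono_tags, lifting) mem_Collect_eq sum.neutral)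
    then show "c \<in> ?K" by auto
  qed
  have "mat_app scale N (mat_app scale N' z) e = (\<Sum>c\<in>?K. scale (N c e) (mat_app scale N' z c))"
    by (rule mat_app_eq_sum[OF K sub])
  also have "\<dots> = (\<Sum>c\<in>?K. \<Sum>b | z b \<noteq> 0. scale (N c e * N' b c) (z b))"
    by (simp add: mat_app_def scale_sum_right)
  also have "\<dots> = (\<Sum>b | z b \<noteq> 0. \<Sum>c\<in>?K. scale (N c e * N' b c) (z b))"
    by (rule sum.swap)
  also have "\<dots> = (\<Sum>b | z b \<noteq> 0. scale (mat_app (*) N (N' b) e) (z b))"
  proof (rule sum.cong[OF refl])
    fix b assume b: "b \<in> {b. z b \<noteq> 0}"
    have "mat_app (*) N (N' b) e = (\<Sum>c\<in>?K. N c e * N' b c)"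
      unfolding mat_app_def using b K by (intro sum.mono_neutral_left) auto
    then show "(\<Sum>c\<in>?K. scale (N c e * N' b c) (z b)) = scale (mat_app (*) N (N' b) e) (z b)"
      by (simp add: scale_sum_left)
  qed
  finally show "mat_app scale N (mat_app scale N' z) e =
      mat_app scale (\<lambda>b. mat_app (*) N (N' b)) z e"
    by (simp add: mat_app_def)
qed

end

lemma module_mult: "Modules.module ((*) :: 'p::comm_ring_1 \<Rightarrow> 'p \<Rightarrow> 'p)"
  by standard (auto simp: algebra_simps)

interpretation self: Modules.module "(*) :: 'p::comm_ring_1 \<Rightarrow> 'p \<Rightarrow> 'p"
  by (rule module_mult)

(* As a rewrite rule this is the reverse of mult.assoc, and the two together do not terminate. *)
declare self.scale_scale [simp del]

section \<open>Complexes over a graded ring\<close>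

locale graded_ring =
  fixes H :: "nat \<Rightarrow> 'p::comm_ring_1 set"
  assumes H_pieces: "additive_pieces H"
    and H_mult: "a \<in> H d \<Longrightarrow> b \<in> H e \<Longrightarrow> a * b \<in> H (d + e)"
    and H_one: "1 \<in> H 0"
begin

definition graded_submodule :: "('p \<Rightarrow> 'm::ab_group_add \<Rightarrow> 'm) \<Rightarrow> (nat \<Rightarrow> 'm set) \<Rightarrow> bool" where
  "graded_submodule s U \<longleftrightarrow>
     additive_pieces U \<and> (\<forall>d j. \<forall>a\<in>H d. \<forall>x\<in>U j. s a x \<in> U (d + j))"

lemma graded_submodule_pieces: "graded_submodule s U \<Longrightarrow> additive_pieces U"
  and graded_submodule_scale: "graded_submodule s U \<Longrightarrow> a \<in> H d \<Longrightarrow> x \<in> U j \<Longrightarrow> s a x \<in> U (d + j)"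
  by (auto simp: graded_submodule_def)

lemma graded_submodule_H: "graded_submodule (*) H"
  using H_pieces H_mult by (auto simp: graded_submodule_def)

definition positive_part :: "nat \<Rightarrow> 'p set" where
  "positive_part d = (if d = 0 then {0} else H d)"

lemma positive_part_subset: "positive_part d \<subseteq> H d"
  using additive_pieces_zero[OF H_pieces] by (auto simp: positive_part_def)

lemma positive_part_pieces: "additive_pieces positive_part"
  using H_pieces by (auto simp: additive_pieces_def positive_part_def)

lemma graded_submodule_positive_part: "graded_submodule (*) positive_part"
  unfolding graded_submodule_def
proof (intro conjI positive_part_pieces allI ballI)
  fix d j a x assume a: "a \<in> H d" and x: "x \<in> positive_part j"
  show "a * x \<in> positive_part (d + j)"
  proof (cases "j = 0")
    case True
    then show ?thesis using x additive_pieces_zero[OF positive_part_pieces] by (simp add: positive_part_def)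
  next
    case False
    then show ?thesis using H_mult[OF a, of x j] x by (simp add: positive_part_def)
  qed
qed

end

text \<open>
  A complex of graded free modules over \<open>H / I\<close>, given by homogeneous matrices over \<open>H\<close> itself.
  Their products vanish only modulo \<open>I\<close>, but this is enough: the modules with which the complex is
  tensored are annihilated by \<open>I\<close>.
\<close>

locale lifted_complex = graded_ring H for H :: "nat \<Rightarrow> 'p::comm_ring_1 set" +
  fixes I :: "nat \<Rightarrow> 'p set"
    and G :: "nat \<Rightarrow> 'b set" and w :: "nat \<Rightarrow> 'b \<Rightarrow> nat"
    and D :: "nat \<Rightarrow> 'b \<Rightarrow> 'b \<Rightarrow> 'p"
  assumes I_submodule: "graded_submodule (*) I"
    and I_subset: "I d \<subseteq> H d"
    and D_chains: "b \<in> G (Suc i) \<Longrightarrow> D i b \<in> chains (G i) (w i) H (w (Suc i) b)"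
    and D_D: "b \<in> G (Suc (Suc i)) \<Longrightarrow>
      mat_app (*) (D i) (D (Suc i) b) \<in> chains (G i) (w i) I (w (Suc (Suc i)) b)"
begin

text \<open>The degree \<open>j\<close> part of the \<open>i\<close>-th module of the complex, tensored with \<open>U\<close>, is \<open>tensor i U j\<close>.\<close>

abbreviation tensor :: "nat \<Rightarrow> (nat \<Rightarrow> 'm::zero set) \<Rightarrow> nat \<Rightarrow> ('b \<Rightarrow> 'm) set" where
  "tensor i \<equiv> chains (G i) (w i)"

text \<open>
  Every graded module over \<open>H / I\<close> that is needed is a subquotient \<open>U / V\<close> of some module over \<open>H\<close>.
  Its elements are represented by elements of \<open>U\<close>, and equality means that the difference lies in
  \<open>V\<close>; no quotient is ever formed.
\<close>

definition graded_quotient ::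
  "('p \<Rightarrow> 'm::ab_group_add \<Rightarrow> 'm) \<Rightarrow> (nat \<Rightarrow> 'm set) \<Rightarrow> (nat \<Rightarrow> 'm set) \<Rightarrow> bool" where
  "graded_quotient s U V \<longleftrightarrow> graded_submodule s U \<and> graded_submodule s V \<and> (\<forall>j. V j \<subseteq> U j) \<and>
     (\<forall>d j. \<forall>a\<in>I d. \<forall>x\<in>U j. s a x \<in> V (d + j))"

definition cycles ::
  "('p \<Rightarrow> 'm::ab_group_add \<Rightarrow> 'm) \<Rightarrow> (nat \<Rightarrow> 'm set) \<Rightarrow> (nat \<Rightarrow> 'm set) \<Rightarrow> nat \<Rightarrow> nat \<Rightarrow> ('b \<Rightarrow> 'm) set"
where
  "cycles s U V i j = {z \<in> tensor i U j.
     case i of 0 \<Rightarrow> True | Suc i' \<Rightarrow> mat_app s (D i') z \<in> chains (G i') (w i') V j}"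

text \<open>
  The homology of the complex tensored with \<open>U / V\<close> vanishes in homological degree \<open>i\<close> and internal
  degree \<open>j\<close>.
\<close>

definition acyclic ::
  "('p \<Rightarrow> 'm::ab_group_add \<Rightarrow> 'm) \<Rightarrow> (nat \<Rightarrow> 'm set) \<Rightarrow> (nat \<Rightarrow> 'm set) \<Rightarrow> nat \<Rightarrow> nat \<Rightarrow> bool" where
  "acyclic s U V i j \<longleftrightarrow> (\<forall>z\<in>cycles s U V i j. \<exists>y\<in>tensor (Suc i) U j.
     (\<lambda>b. z b - mat_app s (D i) y b) \<in> tensor i V j)"

text \<open>
  If the complex resolves the residue field \<open>k\<close>, its homology with coefficients in \<open>U / V\<close> is
  \<open>Tor(U / V, k)\<close>, and the condition says that the Castelnuovo-Mumford regularity of \<open>U / V\<close> over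
  \<open>H / I\<close> is at most \<open>r\<close>.
\<close>

definition reg_le ::
  "('p \<Rightarrow> 'm::ab_group_add \<Rightarrow> 'm) \<Rightarrow> (nat \<Rightarrow> 'm set) \<Rightarrow> (nat \<Rightarrow> 'm set) \<Rightarrow> nat \<Rightarrow> bool" where
  "reg_le s U V r \<longleftrightarrow> (\<forall>i j. i + r < j \<longrightarrow> acyclic s U V i j)"

lemma reg_le_mono: "reg_le s U V r \<Longrightarrow> r \<le> r' \<Longrightarrow> reg_le s U V r'"
  by (auto simp: reg_le_def)

lemma cycles_chains: "z \<in> cycles s U V i j \<Longrightarrow> z \<in> tensor i U j"
  by (simp add: cycles_def)

lemma cycles_0: "cycles s U V 0 j = tensor 0 U j"
  by (simp add: cycles_def)

lemma cycles_Suc: "z \<in> cycles s U V (Suc i) j \<longleftrightarrow>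
    z \<in> tensor (Suc i) U j \<and> mat_app s (D i) z \<in> tensor i V j"
  by (simp add: cycles_def)

lemma acyclicE:
  assumes "acyclic s U V i j" "z \<in> cycles s U V i j"
  obtains y where "y \<in> tensor (Suc i) U j"
    "(\<lambda>b. z b - mat_app s (D i) y b) \<in> tensor i V j"
  using assms unfolding acyclic_def by blast

lemma graded_quotientD:
  assumes "graded_quotient s U V"
  shows "graded_submodule s U" "graded_submodule s V" "V j \<subseteq> U j" "additive_pieces U" "additive_pieces V"
    "a \<in> I d \<Longrightarrow> x \<in> U j \<Longrightarrow> s a x \<in> V (d + j)"
  using assms unfolding graded_quotient_def by (auto simp: graded_submodule_def)

lemma I_pieces: "additive_pieces I"
  using I_submodule by (rule graded_submodule_pieces)

lemma I_mult: "a \<in> H d \<Longrightarrow> x \<in> I e \<Longrightarrow> a * x \<in> I (d + e)"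
  using I_submodule by (rule graded_submodule_scale)

lemma I_mult': "x \<in> I e \<Longrightarrow> a \<in> H d \<Longrightarrow> x * a \<in> I (e + d)"
  using I_mult[of a d x e] by (simp add: ac_simps)

end

locale lifted_complex_module = lifted_complex H I G w D + Modules.module s
  for H :: "nat \<Rightarrow> 'p::comm_ring_1 set" and I :: "nat \<Rightarrow> 'p set"
    and G :: "nat \<Rightarrow> 'b set" and w :: "nat \<Rightarrow> 'b \<Rightarrow> nat"
    and D :: "nat \<Rightarrow> 'b \<Rightarrow> 'b \<Rightarrow> 'p"
    and s :: "'p \<Rightarrow> 'm::ab_group_add \<Rightarrow> 'm"
begin

lemma boundary_chains:
  assumes "graded_submodule s U" "z \<in> tensor (Suc i) U j"
  shows "mat_app s (D i) z \<in> tensor i U j"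
  using mat_app_chains[of "G (Suc i)" "D i" "G i" "w i" H "w (Suc i)" 0 z U j U] assms D_chains
  by (auto simp: graded_submodule_def)

lemma boundary_boundary:
  assumes UV: "graded_quotient s U V" and z: "z \<in> tensor (Suc (Suc i)) U j"
  shows "mat_app s (D i) (mat_app s (D (Suc i)) z) \<in> tensor i V j"
proof -
  have "mat_app s (D i) (mat_app s (D (Suc i)) z) = mat_app s (\<lambda>b. mat_app (*) (D i) (D (Suc i) b)) z"
    by (rule mat_app_mat_app[OF chains_fin[OF z] chains_fin[OF D_chains[OF chains_support(1)[OF z]]]])
  also have "\<dots> \<in> tensor i V (j + 0)"
    by (rule mat_app_chains[of _ _ _ _ I _ _ _ U]) (use D_D z graded_quotientD[OF UV] in auto)
  finally show ?thesis by simp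
qed

lemma boundary_cycles:
  assumes UV: "graded_quotient s U V" and z: "z \<in> tensor (Suc i) U j"
  shows "mat_app s (D i) z \<in> cycles s U V i j"
  using boundary_chains[OF graded_quotientD(1)[OF UV] z] boundary_boundary[OF UV] z
  by (cases i) (auto simp: cycles_def)

lemma boundary_diff:
  assumes "x \<in> chains B u U j" "y \<in> chains B u W j"
  shows "mat_app s N (\<lambda>b. x b - y b) = (\<lambda>c. mat_app s N x c - mat_app s N y c)"
  by (rule mat_app_diff[OF chains_fin[OF assms(1)] chains_fin[OF assms(2)]])

text \<open>
  In the long exact sequence of \<open>0 \<rightarrow> U / V \<rightarrow> W / V \<rightarrow> W / U \<rightarrow> 0\<close> the group \<open>Tor i (W / U)\<close> lies between
  \<open>Tor i (W / V)\<close> and \<open>Tor (i - 1) (U / V)\<close>.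
\<close>

lemma reg_le_quotient:
  assumes UV: "graded_quotient s U V" and WV: "graded_quotient s W V" and sub: "\<And>j. U j \<subseteq> W j"
    and rU: "reg_le s U V (Suc r)" and rW: "reg_le s W V r"
  shows "reg_le s W U r"
  unfolding reg_le_def acyclic_def
proof (intro allI impI ballI)
  fix i j z assume ij: "i + r < j" and z: "z \<in> cycles s W U i j"
  note zW = cycles_chains[OF z]
  \<comment> \<open>The boundary of a cycle of \<open>W / U\<close> is a cycle of \<open>U / V\<close>; correct \<open>z\<close> by a chain that bounds it.\<close>
  have "\<exists>y\<in>tensor i U j. (\<lambda>b. z b - y b) \<in> cycles s W V i j"
  proof (cases i)
    case 0
    then show ?thesis using zW chains_zero[OF graded_quotientD(4)[OF UV]]
      by (intro bexI[of _ "\<lambda>b. 0"]) (auto simp: cycles_0)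
  next
    case (Suc i')
    have dz: "mat_app s (D i') z \<in> chains (G i') (w i') U j"
      using z unfolding Suc cycles_Suc by simp
    have "mat_app s (D i') z \<in> cycles s W V i' j"
      using boundary_cycles[OF WV] zW Suc by blast
    then have "mat_app s (D i') z \<in> cycles s U V i' j"
      using dz by (auto simp: cycles_def split: nat.splits)
    moreover have "acyclic s U V i' j" using rU ij Suc by (auto simp: reg_le_def)
    ultimately obtain y where y: "y \<in> tensor i U j"
        "(\<lambda>b. mat_app s (D i') z b - mat_app s (D i') y b) \<in> chains (G i') (w i') V j"
      unfolding Suc by (elim acyclicE)
    have "(\<lambda>b. z b - y b) \<in> tensor i W j"
      by (rule chains_diff[OF graded_quotientD(4)[OF WV] zW chains_mono[OF y(1) sub]])
    with y boundary_diff[OF zW y(1), of "D i'"] show ?thesis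
      unfolding Suc cycles_Suc by auto
  qed
  then obtain y where y: "y \<in> tensor i U j" "(\<lambda>b. z b - y b) \<in> cycles s W V i j" by blast
  have "acyclic s W V i j" using rW ij by (auto simp: reg_le_def)
  then obtain x where x: "x \<in> tensor (Suc i) W j"
      "(\<lambda>b. z b - y b - mat_app s (D i) x b) \<in> tensor i V j"
    using y(2) by (rule acyclicE)
  have "(\<lambda>b. (z b - y b - mat_app s (D i) x b) + y b) \<in> tensor i U j"
    by (rule chains_add[OF graded_quotientD(4)[OF UV] chains_mono[OF x(2) graded_quotientD(3)[OF UV]] y(1)])
  moreover have "(\<lambda>b. (z b - y b - mat_app s (D i) x b) + y b) = (\<lambda>b. z b - mat_app s (D i) x b)"
    by (simp add: algebra_simps)
  ultimately show "\<exists>y\<in>tensor (Suc i) W j.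
      (\<lambda>b. z b - mat_app s (D i) y b) \<in> tensor i U j"
    using x(1) by auto
qed

end

lemma mat_app_commute:
  fixes z :: "'b \<Rightarrow> 'm::ab_group_add"
  assumes s2: "Modules.module s2"
    and add: "\<And>x y. \<delta> (x + y) = \<delta> x + \<delta> y" and scale: "\<And>a x. \<delta> (s1 a x) = s2 a (\<delta> x)"
    and fin: "finite {b. z b \<noteq> 0}"
  shows "mat_app s2 N (\<lambda>b. \<delta> (z b)) = (\<lambda>c. \<delta> (mat_app s1 N z c))"
proof
  fix c
  have zero: "\<delta> 0 = 0" using add[of 0 0] by simp
  have sum: "\<delta> (sum f K) = (\<Sum>b\<in>K. \<delta> (f b))" if "finite K" for f and K :: "'b set"
    using that by (induction K rule: finite_induct) (auto simp: add zero)
  have "mat_app s2 N (\<lambda>b. \<delta> (z b)) c = (\<Sum>b | z b \<noteq> 0. s2 (N b c) (\<delta> (z b)))"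
    by (rule module.mat_app_eq_sum[OF s2 fin]) (auto simp: zero)
  also have "\<dots> = \<delta> (mat_app s1 N z c)"
    unfolding mat_app_def using fin by (simp add: sum scale)
  finally show "mat_app s2 N (\<lambda>b. \<delta> (z b)) c = \<delta> (mat_app s1 N z c)" .
qed

context lifted_complex
begin

text \<open>
  The same argument at another place of the long exact sequence: \<open>Tor i\<close> of the kernel of a
  surjection \<open>\<delta>\<close> lies between \<open>Tor (i + 1)\<close> of its target and \<open>Tor i\<close> of its source.
\<close>

lemma reg_le_kernel:
  fixes s1 :: "'p \<Rightarrow> 'm1::ab_group_add \<Rightarrow> 'm1" and s2 :: "'p \<Rightarrow> 'm2::ab_group_add \<Rightarrow> 'm2"
  assumes s1: "Modules.module s1" and s2: "Modules.module s2"
    and add: "\<And>x y. \<delta> (x + y) = \<delta> x + \<delta> y" and scale: "\<And>a x. \<delta> (s1 a x) = s2 a (\<delta> x)"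
    and W: "graded_quotient s1 W V1" and U: "graded_quotient s2 U V2"
    and \<delta>W: "\<And>j x. x \<in> W j \<Longrightarrow> \<delta> x \<in> U j" and \<delta>V: "\<And>j x. x \<in> V1 j \<Longrightarrow> \<delta> x \<in> V2 j"
    and surj: "\<And>j u. u \<in> U j \<Longrightarrow> \<exists>x\<in>W j. u - \<delta> x \<in> V2 j"
    and rW: "reg_le s1 W V1 (Suc r)" and rU: "reg_le s2 U V2 r"
  shows "reg_le s1 (\<lambda>j. {x \<in> W j. \<delta> x \<in> V2 j}) V1 (Suc r)"
  unfolding reg_le_def acyclic_def
proof (intro allI impI ballI)
  interpret M1: lifted_complex_module H I G w D s1
    by (intro lifted_complex_module.intro lifted_complex_axioms s1)
  interpret M2: lifted_complex_module H I G w D s2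
    by (intro lifted_complex_module.intro lifted_complex_axioms s2)
  let ?K = "\<lambda>j. {x \<in> W j. \<delta> x \<in> V2 j}"
  note W' = graded_quotientD[OF W] and U' = graded_quotientD[OF U]
  have \<delta>0: "\<delta> 0 = 0" using add[of 0 0] by simp
  have \<delta>diff: "\<delta> (x - y) = \<delta> x - \<delta> y" for x y using add[of "x - y" y] by simp
  have \<delta>app: "mat_app s2 N (\<lambda>b. \<delta> (z b)) = (\<lambda>c. \<delta> (mat_app s1 N z c))"
    if "z \<in> chains B u Y j" for N z B u Y j
    using mat_app_commute[where \<delta>=\<delta> and ?s1.0=s1 and ?s2.0=s2 and z=z] s2 add scale chains_fin[OF that] by simp
  have \<delta>chains: "(\<lambda>b. \<delta> (z b)) \<in> chains B u Y' j"
    if "z \<in> chains B u Y j" "\<And>j x. x \<in> Y j \<Longrightarrow> \<delta> x \<in> Y' j" for z B u Y Y' j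
  proof (rule chainsI)
    show "finite {b. \<delta> (z b) \<noteq> 0}"
      by (rule finite_subset[OF _ chains_fin[OF that(1)]]) (auto simp: \<delta>0)
  qed (use that \<delta>0 in \<open>auto simp: chains_def split: if_splits\<close>)
  fix i j z assume ij: "i + Suc r < j" and z: "z \<in> cycles s1 ?K V1 i j"
  have zK: "z \<in> tensor i ?K j" using z by (rule cycles_chains)
  have zW: "z \<in> tensor i W j" by (rule chains_mono[OF zK]) auto
  have "z \<in> cycles s1 W V1 i j" using z zW by (auto simp: cycles_def split: nat.splits)
  moreover have "acyclic s1 W V1 i j" using rW ij by (auto simp: reg_le_def)
  ultimately obtain y where y: "y \<in> tensor (Suc i) W j"
      "(\<lambda>b. z b - mat_app s1 (D i) y b) \<in> tensor i V1 j" by (elim acyclicE)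
  let ?y = "\<lambda>b. \<delta> (y b)"
  have dy: "?y \<in> tensor (Suc i) U j"
    using \<delta>chains[OF y(1)] \<delta>W by blast
  have "(\<lambda>b. \<delta> (z b) - \<delta> (z b - mat_app s1 (D i) y b)) \<in> tensor i V2 j"
    by (rule chains_diff[OF U'(5) \<delta>chains[OF zK] \<delta>chains[OF y(2)]]) (use \<delta>V in auto)
  then have "mat_app s2 (D i) ?y \<in> tensor i V2 j"
    by (simp add: \<delta>app[OF y(1)] \<delta>diff)
  then have "?y \<in> cycles s2 U V2 (Suc i) j" using dy by (simp add: cycles_Suc)
  moreover have "acyclic s2 U V2 (Suc i) j" using rU ij by (auto simp: reg_le_def)
  ultimately obtain u where u: "u \<in> tensor (Suc (Suc i)) U j"
      "(\<lambda>b. \<delta> (y b) - mat_app s2 (D (Suc i)) u b) \<in> tensor (Suc i) V2 j"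
    by (elim acyclicE)
  \<comment> \<open>Lift \<open>u\<close> along \<open>\<delta>\<close>, and use its boundary to move \<open>y\<close> into the kernel of \<open>\<delta>\<close>.\<close>
  have "\<forall>j v. \<exists>x. v \<in> U j \<longrightarrow> x \<in> W j \<and> v - \<delta> x \<in> V2 j" using surj by blast
  then obtain f where f: "\<And>j v. v \<in> U j \<Longrightarrow> f j v \<in> W j \<and> v - \<delta> (f j v) \<in> V2 j"
    by metis
  define x where "x = (\<lambda>b. if u b = 0 then 0 else f (j - w (Suc (Suc i)) b) (u b))"
  have x_fin: "finite {b. x b \<noteq> 0}"
    by (rule finite_subset[OF _ chains_fin[OF u(1)]]) (auto simp: x_def)
  have x: "x \<in> tensor (Suc (Suc i)) W j"
    by (rule chainsI_support[OF W'(4) x_fin])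
      (use chains_support[OF u(1)] f in \<open>auto simp: x_def split: if_splits\<close>)
  have ux_fin: "finite {b. u b - \<delta> (x b) \<noteq> 0}"
    by (rule finite_subset[OF _ chains_fin[OF u(1)]]) (auto simp: x_def \<delta>0)
  have ux: "(\<lambda>b. u b - \<delta> (x b)) \<in> tensor (Suc (Suc i)) V2 j"
    by (rule chainsI_support[OF U'(5) ux_fin])
      (use chains_support[OF u(1)] f in \<open>auto simp: x_def \<delta>0 split: if_splits\<close>)
  define y' where "y' = (\<lambda>b. y b - mat_app s1 (D (Suc i)) x b)"
  have dx: "mat_app s1 (D (Suc i)) x \<in> tensor (Suc i) W j"
    by (rule M1.boundary_chains[OF W'(1) x])
  have y'W: "y' \<in> tensor (Suc i) W j"
    unfolding y'_def by (rule chains_diff[OF W'(4) y(1) dx])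
  have "(\<lambda>b. \<delta> (y b) - mat_app s2 (D (Suc i)) u b + mat_app s2 (D (Suc i)) (\<lambda>b. u b - \<delta> (x b)) b)
      \<in> tensor (Suc i) V2 j"
    by (rule chains_add[OF U'(5) u(2) M2.boundary_chains[OF U'(2) ux]])
  moreover have "mat_app s2 (D (Suc i)) (\<lambda>b. u b - \<delta> (x b)) =
      (\<lambda>b. mat_app s2 (D (Suc i)) u b - \<delta> (mat_app s1 (D (Suc i)) x b))"
  proof -
    have "(\<lambda>b. \<delta> (x b)) \<in> tensor (Suc (Suc i)) U j"
      by (rule \<delta>chains[OF x]) (rule \<delta>W)
    from M2.boundary_diff[OF u(1) this, of "D (Suc i)"] show ?thesis
      unfolding \<delta>app[OF x, of "D (Suc i)"] .
  qed
  ultimately have y'V: "(\<lambda>b. \<delta> (y' b)) \<in> tensor (Suc i) V2 j"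
    by (simp add: y'_def \<delta>diff algebra_simps)
  have "y' \<in> tensor (Suc i) ?K j"
    using y'W y'V unfolding chains_def by (auto split: if_splits)
  moreover have "(\<lambda>b. z b - mat_app s1 (D i) y' b) \<in> tensor i V1 j"
  proof -
    have "(\<lambda>b. (z b - mat_app s1 (D i) y b) + mat_app s1 (D i) (mat_app s1 (D (Suc i)) x) b)
        \<in> tensor i V1 j"
      by (rule chains_add[OF W'(5) y(2) M1.boundary_boundary[OF W x]])
    then show ?thesis
      unfolding y'_def M1.boundary_diff[OF y(1) dx] by (simp add: algebra_simps)
  qed
  ultimately show "\<exists>y\<in>tensor (Suc i) ?K j.
      (\<lambda>b. z b - mat_app s1 (D i) y b) \<in> tensor i V1 j" by blast
qed

end

text \<open>
  The complex resolves the residue field \<open>k = H 0\<close>, and by assumption \<open>tor\<close> its ring \<open>H / I\<close> is Koszul: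
  \<open>H / positive_part\<close> is \<open>k\<close>.  The augmentation to \<open>k\<close> is given by the images \<open>eps\<close> of the basis
  elements, and \<open>e0\<close> is a chain with augmentation \<open>1\<close>.
\<close>

locale lifted_resolution = lifted_complex H I G w D
  for H :: "nat \<Rightarrow> 'p::comm_ring_1 set" and I :: "nat \<Rightarrow> 'p set"
    and G :: "nat \<Rightarrow> 'b set" and w :: "nat \<Rightarrow> 'b \<Rightarrow> nat"
    and D :: "nat \<Rightarrow> 'b \<Rightarrow> 'b \<Rightarrow> 'p" +
  fixes eps :: "'b \<Rightarrow> 'p" and e0 :: "'b \<Rightarrow> 'p"
  assumes exact: "0 < i \<or> 0 < j \<Longrightarrow> acyclic (*) H I i j"
    and tor: "i \<noteq> j \<Longrightarrow> acyclic (*) H positive_part i j"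
    and eps_in: "eps b \<in> H 0"
    and eps_degree: "0 < w 0 b \<Longrightarrow> eps b = 0"
    and eps_D: "b \<in> G 1 \<Longrightarrow> w 1 b = 0 \<Longrightarrow> mat_app (*) (\<lambda>b (_::unit). eps b) (D 0 b) () = 0"
    and e0_chains: "e0 \<in> tensor 0 H 0"
    and eps_e0: "mat_app (*) (\<lambda>b (_::unit). eps b) e0 () = 1"
begin

lemma reg_le_H: "reg_le (*) H I 0"
  unfolding reg_le_def by (auto intro: exact)

text \<open>
  A linear form \<open>t\<close> acts as zero on \<open>k\<close>, so multiplication by \<open>t\<close> on the resolution of \<open>k\<close> is null
  homotopic.  A homotopy \<open>h\<close> with \<open>D h + h D = t\<close> modulo \<open>I\<close> is built by recursion.  The part
  \<open>r = h D\<close> comes from the previous step and is zero at the start; then \<open>t - r\<close> maps basis elements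
  to cycles, which are the boundaries of the values of the next \<open>h\<close>.
\<close>

lemma contracting_homotopy_step:
  assumes t: "t \<in> H 1"
    and r: "\<And>b. b \<in> G k \<Longrightarrow> r b \<in> tensor k H (w k b + 1)"
    and x: "\<And>b. b \<in> G k \<Longrightarrow> (\<lambda>c. (if c = b then t else 0) - r b c) \<in> cycles (*) H I k (w k b + 1)"
    and rD: "\<And>b. b \<in> G (Suc k) \<Longrightarrow> mat_app (*) r (D k b) \<in> tensor k I (w (Suc k) b + 1)"
  obtains h where
    "\<And>b. b \<in> G k \<Longrightarrow> h b \<in> tensor (Suc k) H (w k b + 1)"
    "\<And>b. b \<in> G k \<Longrightarrow> (\<lambda>c. (if c = b then t else 0) - r b c - mat_app (*) (D k) (h b) c)
        \<in> tensor k I (w k b + 1)"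
    "\<And>b. b \<in> G (Suc k) \<Longrightarrow>
      mat_app (*) h (D k b) \<in> tensor (Suc k) H (w (Suc k) b + 1)"
    "\<And>b. b \<in> G (Suc k) \<Longrightarrow> (\<lambda>c. (if c = b then t else 0) - mat_app (*) h (D k b) c)
        \<in> cycles (*) H I (Suc k) (w (Suc k) b + 1)"
    "\<And>b. b \<in> G (Suc (Suc k)) \<Longrightarrow> mat_app (*) (\<lambda>e. mat_app (*) h (D k e)) (D (Suc k) b)
        \<in> tensor (Suc k) I (w (Suc (Suc k)) b + 1)"
proof -
  interpret P: lifted_complex_module H I G w D "(*)"
    by (intro lifted_complex_module.intro lifted_complex_axioms module_mult)
  let ?x = "\<lambda>b c. (if c = b then t else 0) - r b c"
  have *: "\<forall>b. \<exists>y. b \<in> G k \<longrightarrow> y \<in> tensor (Suc k) H (w k b + 1) \<and>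
      (\<lambda>c. ?x b c - mat_app (*) (D k) y c) \<in> tensor k I (w k b + 1)"
  proof (intro allI, goal_cases)
    case (1 b)
    show ?case
    proof (cases "b \<in> G k")
      case True
    have "acyclic (*) H I k (w k b + 1)" by (rule exact) simp
    then show ?thesis by (rule acyclicE[OF _ x[OF True]]) blast
    qed auto
  qed
  obtain h where h: "\<And>b. b \<in> G k \<Longrightarrow> h b \<in> tensor (Suc k) H (w k b + 1)"
    and rel: "\<And>b. b \<in> G k \<Longrightarrow> (\<lambda>c. ?x b c - mat_app (*) (D k) (h b) c)
        \<in> tensor k I (w k b + 1)"
    using choice[OF *] by blast
  have hD: "mat_app (*) h (D k b) \<in> tensor (Suc k) H (w (Suc k) b + 1)"
    if "b \<in> G (Suc k)" for b
    by (rule self.mat_app_chains[of _ _ _ _ H _ _ _ H]) (use h D_chains[OF that] H_pieces H_mult in auto)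
  have cyc: "(\<lambda>c. (if c = b then t else 0) - mat_app (*) h (D k b) c)
        \<in> cycles (*) H I (Suc k) (w (Suc k) b + 1)" if b: "b \<in> G (Suc k)" for b
  proof -
    let ?Db = "D k b"
    have Db: "?Db \<in> tensor k H (w (Suc k) b)" by (rule D_chains[OF b])
    note Db_fin = chains_fin[OF Db] and Db_G = chains_support(1)[OF Db]
    have tb: "(\<lambda>c. if c = b then t else 0) \<in> tensor (Suc k) H (w (Suc k) b + 1)"
      by (rule chains_single[OF H_pieces b t])
    have tD: "mat_app (*) (D k) (\<lambda>c. if c = b then t else 0) = mat_app (*) (\<lambda>e c. if c = e then t else 0) ?Db"
    proof
      fix c
      have "mat_app (*) (D k) (\<lambda>c. if c = b then t else 0) c = (\<Sum>e\<in>{b}. D k e c * (if e = b then t else 0))"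
        by (rule self.mat_app_eq_sum) auto
      also have "\<dots> = t * ?Db c" by simp
      also have "\<dots> = mat_app (*) (\<lambda>e c. if c = e then t else 0) ?Db c"
        by (simp add: self.mat_app_single_scale[OF Db_fin])
      finally show "mat_app (*) (D k) (\<lambda>c. if c = b then t else 0) c = \<dots>" .
    qed
    have "mat_app (*) (D k) (\<lambda>c. (if c = b then t else 0) - mat_app (*) h ?Db c) =
        (\<lambda>c. mat_app (*) (\<lambda>e c. if c = e then t else 0) ?Db c - mat_app (*) (D k) (mat_app (*) h ?Db) c)"
      by (simp add: P.boundary_diff[OF tb hD[OF b]] tD)
    also have "mat_app (*) (D k) (mat_app (*) h ?Db) = mat_app (*) (\<lambda>e. mat_app (*) (D k) (h e)) ?Db"
      by (rule self.mat_app_mat_app[OF Db_fin chains_fin[OF h[OF Db_G]]])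
    also have "(\<lambda>c. mat_app (*) (\<lambda>e c. if c = e then t else 0) ?Db c - mat_app (*) (\<lambda>e. mat_app (*) (D k) (h e)) ?Db c)
       = mat_app (*) (\<lambda>e c. (?x e c - mat_app (*) (D k) (h e) c) + r e c) ?Db"
      unfolding self.mat_app_diff_left[symmetric] by simp
    also have "\<dots> = (\<lambda>c. mat_app (*) (\<lambda>e c. ?x e c - mat_app (*) (D k) (h e) c) ?Db c + mat_app (*) r ?Db c)"
      by (rule self.mat_app_add_left)
    finally have eq: "mat_app (*) (D k) (\<lambda>c. (if c = b then t else 0) - mat_app (*) h ?Db c) =
        (\<lambda>c. mat_app (*) (\<lambda>e c. ?x e c - mat_app (*) (D k) (h e) c) ?Db c + mat_app (*) r ?Db c)" .
    have "mat_app (*) (\<lambda>e c. ?x e c - mat_app (*) (D k) (h e) c) ?Db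
        \<in> tensor k I (w (Suc k) b + 1)"
      by (rule self.mat_app_chains[OF rel Db I_pieces]) (auto intro: I_mult')
    from chains_add[OF I_pieces this rD[OF b]]
    show ?thesis unfolding cycles_Suc eq
      by (intro conjI chains_diff[OF H_pieces tb hD[OF b]])
  qed
  have "mat_app (*) (\<lambda>e. mat_app (*) h (D k e)) (D (Suc k) b)
        \<in> tensor (Suc k) I (w (Suc (Suc k)) b + 1)" if b: "b \<in> G (Suc (Suc k))" for b
  proof -
    note Db = D_chains[OF b]
    have "mat_app (*) (\<lambda>e. mat_app (*) h (D k e)) (D (Suc k) b) = mat_app (*) h (mat_app (*) (D k) (D (Suc k) b))"
      by (rule self.mat_app_mat_app[OF chains_fin[OF Db] chains_fin[OF D_chains[OF chains_support(1)[OF Db]]], symmetric])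
    also have "\<dots> \<in> tensor (Suc k) I (w (Suc (Suc k)) b + 1)"
      by (rule self.mat_app_chains[OF h D_D[OF b] I_pieces]) (auto intro: I_mult)
    finally show ?thesis .
  qed
  with h rel hD cyc show thesis by (rule that)
qed

lemma contracting_homotopy:
  assumes t: "t \<in> H 1"
  obtains h r where
    "\<And>k b. b \<in> G k \<Longrightarrow> h k b \<in> tensor (Suc k) H (w k b + 1)"
    "\<And>k b. b \<in> G k \<Longrightarrow> (\<lambda>c. (if c = b then t else 0) - r k b c - mat_app (*) (D k) (h k b) c)
        \<in> tensor k I (w k b + 1)"
    "r 0 = (\<lambda>b c. 0)" "\<And>k. r (Suc k) = (\<lambda>b. mat_app (*) (h k) (D k b))"
proof -
  interpret P: lifted_complex_module H I G w D "(*)"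
    by (intro lifted_complex_module.intro lifted_complex_axioms module_mult)
  let ?P = "\<lambda>k r. (\<forall>b\<in>G k. r b \<in> tensor k H (w k b + 1)) \<and>
    (\<forall>b\<in>G k. (\<lambda>c. (if c = b then t else 0) - r b c) \<in> cycles (*) H I k (w k b + 1)) \<and>
    (\<forall>b\<in>G (Suc k). mat_app (*) r (D k b) \<in> tensor k I (w (Suc k) b + 1)) \<and>
    (k = 0 \<longrightarrow> r = (\<lambda>b c. 0))"
  let ?R = "\<lambda>k r r' h. (\<forall>b\<in>G k. h b \<in> tensor (Suc k) H (w k b + 1)) \<and>
    (\<forall>b\<in>G k. (\<lambda>c. (if c = b then t else 0) - r b c - mat_app (*) (D k) (h b) c)
        \<in> tensor k I (w k b + 1)) \<and> r' = (\<lambda>b. mat_app (*) h (D k b))"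
  have "\<exists>r. \<forall>k. ?P k (r k) \<and> (\<exists>h. ?R k (r k) (r (Suc k)) h)"
  proof (rule dependent_nat_choice)
    have "mat_app (*) (\<lambda>b c. 0) z = (\<lambda>c::'b. 0)" for z :: "'b \<Rightarrow> 'p" by (simp add: mat_app_def)
    then show "\<exists>r. ?P 0 r"
      by (intro exI[of _ "\<lambda>b c. 0"])
        (use chains_single[OF H_pieces _ t, where B = "G 0" and w = "w 0"] in
          \<open>simp add: cycles_0 chains_zero[OF H_pieces] chains_zero[OF I_pieces]\<close>)
  next
    fix r k assume P: "?P k r"
    show "\<exists>r'. ?P (Suc k) r' \<and> (\<exists>h. ?R k r r' h)"
    proof (rule contracting_homotopy_step[OF t, of k r], goal_cases)
      case (4 h)
      show ?case
        by (intro exI[of _ "\<lambda>b. mat_app (*) h (D k b)"] exI[of _ h] conjI ballI impI refl)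
          ((rule 4, assumption) | simp)+
    qed (use P in auto)
  qed
  then obtain r where r: "\<forall>k. ?P k (r k) \<and> (\<exists>h. ?R k (r k) (r (Suc k)) h)" ..
  have P: "?P k (r k)" for k by (rule conjunct1[OF spec[OF r]])
  have "\<forall>k. \<exists>h. ?R k (r k) (r (Suc k)) h" by (intro allI conjunct2[OF spec[OF r]])
  from choice[OF this] obtain h where R: "\<forall>k. ?R k (r k) (r (Suc k)) (h k)" ..
  show thesis
  proof (rule that[of h r])
    show "r 0 = (\<lambda>b c. 0)" using P[of 0] by simp
    show "r (Suc k) = (\<lambda>b. mat_app (*) (h k) (D k b))" for k using R by simp
  qed (use R in simp_all)
qed

end

section \<open>Modules with bounded regularity\<close>

locale lifted_resolution_module = lifted_resolution H I G w D eps e0 + Modules.module s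
  for H :: "nat \<Rightarrow> 'p::comm_ring_1 set" and I :: "nat \<Rightarrow> 'p set"
    and G :: "nat \<Rightarrow> 'b set" and w :: "nat \<Rightarrow> 'b \<Rightarrow> nat"
    and D :: "nat \<Rightarrow> 'b \<Rightarrow> 'b \<Rightarrow> 'p" and eps e0 :: "'b \<Rightarrow> 'p"
    and s :: "'p \<Rightarrow> 'm::ab_group_add \<Rightarrow> 'm"
begin

sublocale lifted_complex_module ..

text \<open>
  Linear forms act as zero on \<open>Tor(M, k)\<close> for every graded module \<open>M\<close>, by the homotopy above.
\<close>

lemma linear_form_kills_homology:
  assumes t: "t \<in> H 1" and UV: "graded_quotient s U V" and z: "z \<in> cycles s U V k j"
  obtains y where "y \<in> tensor (Suc k) U (j + 1)"
    "(\<lambda>b. s t (z b) - mat_app s (D k) y b) \<in> tensor k V (j + 1)"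
proof -
  note UV' = graded_quotientD[OF UV]
  obtain h r where
    h: "\<And>k b. b \<in> G k \<Longrightarrow> h k b \<in> tensor (Suc k) H (w k b + 1)" and
    rel: "\<And>k b. b \<in> G k \<Longrightarrow> (\<lambda>c. (if c = b then t else 0) - r k b c - mat_app (*) (D k) (h k b) c)
        \<in> tensor k I (w k b + 1)" and
    r0: "r 0 = (\<lambda>b c. 0)" and rSuc: "\<And>k. r (Suc k) = (\<lambda>b. mat_app (*) (h k) (D k b))"
    by (rule contracting_homotopy[OF t]) blast
  note zU = cycles_chains[OF z]
  note z_fin = chains_fin[OF zU] and z_G = chains_support(1)[OF zU]
  have hU: "mat_app s (h k) x \<in> tensor (Suc k) W (i + 1)"
    if "x \<in> tensor k W i" "graded_submodule s W" for k x W i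
    by (rule mat_app_chains[of _ _ _ _ H _ _ _ W])
      (use h that in \<open>auto simp: graded_submodule_def\<close>)
  have rV: "mat_app s (r k) z \<in> tensor k V (j + 1)"
  proof (cases k)
    case 0
    have "mat_app s (r k) z = (\<lambda>b. 0)" by (simp add: 0 r0 mat_app_def)
    then show ?thesis using chains_zero[OF UV'(5)] by simp
  next
    case (Suc i)
    have "mat_app s (r k) z = mat_app s (h i) (mat_app s (D i) z)"
      unfolding Suc rSuc
      by (rule mat_app_mat_app[OF z_fin chains_fin[OF D_chains], symmetric]) (use z_G Suc in auto)
    also have "\<dots> \<in> tensor k V (j + 1)"
      unfolding Suc by (rule hU) (use z UV' Suc in \<open>simp_all add: cycles_Suc\<close>)
    finally show ?thesis .
  qed
  have "mat_app s (\<lambda>b c. (if c = b then t else 0) - r k b c - mat_app (*) (D k) (h k b) c) z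
      \<in> tensor k V (j + 1)"
    by (rule mat_app_chains[OF rel zU UV'(5)]) (auto intro: UV'(6))
  from chains_add[OF UV'(5) this rV]
  have "(\<lambda>b. s t (z b) - mat_app s (\<lambda>b. mat_app (*) (D k) (h k b)) z b) \<in> tensor k V (j + 1)"
    by (simp add: mat_app_diff_left mat_app_single_scale[OF z_fin])
  moreover have "mat_app s (\<lambda>b. mat_app (*) (D k) (h k b)) z = mat_app s (D k) (mat_app s (h k) z)"
    by (rule mat_app_mat_app[OF z_fin chains_fin[OF h[OF z_G]], symmetric])
  ultimately show thesis using that[OF hU[OF zU UV'(1)]] by simp
qed

text \<open>
  If the bottom piece of a module, in degree \<open>a\<close>, is spanned by one element \<open>u\<close>, then the module
  modulo its pieces of higher degree is \<open>k(-a)\<close>.  As the ring is Koszul, the homology with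
  coefficients in \<open>k(-a)\<close> vanishes in internal degrees above \<open>i + a\<close>.  The entry of a chain at \<open>b\<close>
  lies in the bottom piece exactly if \<open>w i b = j - a\<close>.
\<close>

lemma cycle_bounds_in_bottom_degree:
  assumes UV: "graded_quotient s U V"
    and low: "\<And>j. j < a \<Longrightarrow> U j \<subseteq> V j"
    and u: "u \<in> U a" and unit: "\<And>c. c \<in> H 0 \<Longrightarrow> s c u \<in> V a \<Longrightarrow> c = 0"
    and span: "\<And>x. x \<in> U a \<Longrightarrow> \<exists>c\<in>H 0. x - s c u \<in> V a"
    and ij: "i + a < j" and z: "z \<in> cycles s U V i j"
  obtains y where "y \<in> tensor (Suc i) U j"
    "\<And>b. b \<in> G i \<Longrightarrow> w i b \<le> j \<Longrightarrow> j \<le> w i b + a \<Longrightarrow> z b - mat_app s (D i) y b \<in> V (j - w i b)"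
proof -
  note UV' = graded_quotientD[OF UV] and zU = cycles_chains[OF z]
  note UH = graded_submodule_scale[OF UV'(1)] and VH = graded_submodule_scale[OF UV'(2)]
  let ?d = "j - a"
  \<comment> \<open>The coefficients of \<open>u\<close> in the bottom entries of \<open>z\<close> form a cycle with coefficients in \<open>k\<close>.\<close>
  have "\<exists>c. c \<in> H 0 \<and> (b \<in> G i \<longrightarrow> w i b = ?d \<longrightarrow> z b - s c u \<in> V a) \<and>
      (\<not> (z b \<noteq> 0 \<and> b \<in> G i \<and> w i b = ?d) \<longrightarrow> c = 0)" for b
  proof (cases "z b \<noteq> 0 \<and> b \<in> G i \<and> w i b = ?d")
    case True
    then have "z b \<in> U a" using chains_support(3)[OF zU, of b] ij by auto
    then show ?thesis using span True by blast
  next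
    case False
    then show ?thesis
      using additive_pieces_zero[OF H_pieces] additive_pieces_zero[OF UV'(5)]
      by (intro exI[of _ 0]) auto
  qed
  then obtain l where l: "\<And>b. l b \<in> H 0" "\<And>b. b \<in> G i \<Longrightarrow> w i b = ?d \<Longrightarrow> z b - s (l b) u \<in> V a"
    "\<And>b. \<not> (z b \<noteq> 0 \<and> b \<in> G i \<and> w i b = ?d) \<Longrightarrow> l b = 0" by metis
  have l_fin: "finite {b. l b \<noteq> 0}"
    by (rule finite_subset[OF _ chains_fin[OF zU]]) (use l(3) in auto)
  have l_chains: "l \<in> tensor i H ?d"
  proof (rule chainsI_support[OF H_pieces l_fin])
    fix b assume "l b \<noteq> 0"
    then have "b \<in> G i" "w i b = ?d" using l(3) by blast+
    then show "b \<in> G i \<and> w i b \<le> ?d \<and> l b \<in> H (?d - w i b)" using l(1)[of b] by simp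
  qed
  have "l \<in> cycles (*) H positive_part i ?d"
  proof (cases i)
    case 0
    then show ?thesis using l_chains by (simp add: cycles_0)
  next
    case (Suc k)
    interpret P: lifted_complex_module H I G w D "(*)"
      by (intro lifted_complex_module.intro lifted_complex_axioms module_mult)
    have dl: "mat_app (*) (D k) l \<in> tensor k H ?d"
      using P.boundary_chains[OF graded_submodule_H] l_chains Suc by simp
    have dz: "mat_app s (D k) z \<in> tensor k V j" using z unfolding Suc by (simp add: cycles_Suc)
    have "mat_app (*) (D k) l c \<in> positive_part (?d - w k c)" if c: "c \<in> G k" "w k c \<le> ?d" for c
    proof (cases "w k c = ?d")
      case False
      then show ?thesis using chains_in[OF dl c] c by (simp add: positive_part_def)
    next
      case True
      have dlc: "mat_app (*) (D k) l c \<in> H 0" using chains_in[OF dl c] True by simp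
      have "mat_app s (D k) z c - mat_app s (D k) (\<lambda>b. s (l b) u) c \<in> V a"
      proof -
        have lu_fin: "finite {b. s (l b) u \<noteq> 0}" by (rule finite_subset[OF _ l_fin]) auto
        have "mat_app s (D k) z c - mat_app s (D k) (\<lambda>b. s (l b) u) c =
            mat_app s (D k) (\<lambda>b. z b - s (l b) u) c"
          by (simp add: mat_app_diff[OF chains_fin[OF zU] lu_fin])
        also have "\<dots> \<in> V a" unfolding mat_app_def
        proof (rule additive_pieces_sum[OF UV'(5)])
          fix b assume "b \<in> {b. z b - s (l b) u \<noteq> 0}"
          then have "z b \<noteq> 0" using l(3)[of b] by (cases "z b = 0") auto
          then have b: "b \<in> G (Suc k)" "w (Suc k) b \<le> j" "z b \<in> U (j - w (Suc k) b)"
            using chains_support[OF zU] Suc by auto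
          note Db = D_chains[OF b(1)]
          consider "w (Suc k) b < ?d" | "w (Suc k) b = ?d" | "?d < w (Suc k) b" by linarith
          then show "s (D k b c) (z b - s (l b) u) \<in> V a"
          proof cases
            case 1
            then have "D k b c = 0" using chains_out'[OF Db] True by simp
            then show ?thesis using additive_pieces_zero[OF UV'(5)] by simp
          next
            case 2
            then have "D k b c \<in> H 0" using chains_in[OF Db c(1)] True by simp
            from VH[OF this l(2)] show ?thesis using b(1) 2 Suc by simp
          next
            case 3
            then have "j - w (Suc k) b < a" using b(2) ij by arith
            then have "z b \<in> V (j - w (Suc k) b)" using b(3) low by blast
            moreover have "D k b c \<in> H (w (Suc k) b - ?d)" using chains_in[OF Db c(1)] True 3 by simp
            ultimately have "s (D k b c) (z b) \<in> V (w (Suc k) b - ?d + (j - w (Suc k) b))"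
              by (intro VH)
            moreover have "w (Suc k) b - ?d + (j - w (Suc k) b) = a" using 3 b(2) ij by simp
            moreover have "l b = 0" using l(3)[of b] 3 Suc by auto
            ultimately show ?thesis by simp
          qed
        qed
        finally show ?thesis .
      qed
      moreover have "mat_app s (D k) z c \<in> V a" using chains_in[OF dz c(1)] True c ij by simp
      ultimately have "mat_app s (D k) (\<lambda>b. s (l b) u) c \<in> V a"
        using additive_pieces_diff[OF UV'(5)] by fastforce
      moreover have "mat_app s (D k) (\<lambda>b. s (l b) u) c = s (mat_app (*) (D k) l c) u"
      proof -
        have "mat_app s (D k) (\<lambda>b. s (l b) u) c = (\<Sum>b | l b \<noteq> 0. s (D k b c) (s (l b) u))"
          by (rule mat_app_eq_sum[OF l_fin]) auto
        then show ?thesis by (simp add: mat_app_def scale_sum_left)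
      qed
      ultimately have "mat_app (*) (D k) l c = 0" using unit[OF dlc] by simp
      then show ?thesis using additive_pieces_zero[OF positive_part_pieces] by simp
    qed
    then have "mat_app (*) (D k) l \<in> tensor k positive_part ?d"
      using dl unfolding chains_def by auto
    then show ?thesis using l_chains unfolding Suc by (simp add: cycles_Suc)
  qed
  moreover have "acyclic (*) H positive_part i ?d" using ij by (intro tor) auto
  ultimately obtain y where y: "y \<in> tensor (Suc i) H ?d"
      "(\<lambda>b. l b - mat_app (*) (D i) y b) \<in> tensor i positive_part ?d" by (elim acyclicE)
  let ?y = "\<lambda>b. s (y b) u"
  have y_fin: "finite {b. ?y b \<noteq> 0}" by (rule finite_subset[OF _ chains_fin[OF y(1)]]) auto
  have yU: "?y \<in> tensor (Suc i) U j"
  proof (rule chainsI_support[OF UV'(4) y_fin])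
    fix b assume "?y b \<noteq> 0"
    then have "y b \<noteq> 0" by auto
    note b = chains_support[OF y(1) this]
    have "s (y b) u \<in> U (?d - w (Suc i) b + a)" by (rule UH[OF b(3) u])
    moreover have "?d - w (Suc i) b + a = j - w (Suc i) b" using b(2) ij by simp
    ultimately show "b \<in> G (Suc i) \<and> w (Suc i) b \<le> j \<and> ?y b \<in> U (j - w (Suc i) b)"
      using b by auto
  qed
  note dyU = boundary_chains[OF UV'(1) yU]
  show thesis
  proof (rule that[OF yU])
    fix b assume b: "b \<in> G i" "w i b \<le> j" "j \<le> w i b + a"
    show "z b - mat_app s (D i) ?y b \<in> V (j - w i b)"
    proof (cases "w i b = ?d")
      case True
      have "mat_app s (D i) ?y b = (\<Sum>e | y e \<noteq> 0. s (D i e b) (s (y e) u))"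
        by (rule mat_app_eq_sum[OF chains_fin[OF y(1)]]) auto
      also have "\<dots> = s (mat_app (*) (D i) y b) u" by (simp add: mat_app_def scale_sum_left)
      also have "mat_app (*) (D i) y b = l b"
        using chains_in[OF y(2) b(1)] True by (simp add: positive_part_def)
      finally show ?thesis using l(2)[OF b(1) True] True ij by simp
    next
      case False
      then have "U (j - w i b) \<subseteq> V (j - w i b)" using b by (intro low) auto
      then show ?thesis
        using chains_in[OF zU b(1,2)] chains_in[OF dyU b(1,2)] additive_pieces_diff[OF UV'(5)] by blast
    qed
  qed
qed

text \<open>
  Such a module is \<open>k(-a)\<close>, and the preceding lemma treats the only degree in which it is nonzero.
\<close>

lemma reg_le_simple:
  assumes UV: "graded_quotient s U V"
    and other: "\<And>j. j \<noteq> a \<Longrightarrow> U j \<subseteq> V j"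
    and u: "u \<in> U a" and unit: "\<And>c. c \<in> H 0 \<Longrightarrow> s c u \<in> V a \<Longrightarrow> c = 0"
    and span: "\<And>x. x \<in> U a \<Longrightarrow> \<exists>c\<in>H 0. x - s c u \<in> V a"
  shows "reg_le s U V a"
  unfolding reg_le_def acyclic_def
proof (intro allI impI ballI)
  note UV' = graded_quotientD[OF UV]
  fix i j z assume ij: "i + a < j" and z: "z \<in> cycles s U V i j"
  obtain y where y: "y \<in> tensor (Suc i) U j"
    "\<And>b. b \<in> G i \<Longrightarrow> w i b \<le> j \<Longrightarrow> j \<le> w i b + a \<Longrightarrow> z b - mat_app s (D i) y b \<in> V (j - w i b)"
    by (rule cycle_bounds_in_bottom_degree[OF UV _ u unit span ij z]) (use other in auto)
  have x: "(\<lambda>b. z b - mat_app s (D i) y b) \<in> tensor i U j"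
    by (rule chains_diff[OF UV'(4) cycles_chains[OF z] boundary_chains[OF UV'(1) y(1)]])
  have "z b - mat_app s (D i) y b \<in> V (j - w i b)" if b: "b \<in> G i" "w i b \<le> j" for b
  proof (cases "j - w i b = a")
    case True
    then show ?thesis using y(2)[OF b] by simp
  next
    case False
    then show ?thesis using other chains_in[OF x b] by blast
  qed
  then have "(\<lambda>b. z b - mat_app s (D i) y b) \<in> tensor i V j"
    using x unfolding chains_def by auto
  then show "\<exists>y\<in>tensor (Suc i) U j. (\<lambda>b. z b - mat_app s (D i) y b) \<in> tensor i V j"
    using y(1) by blast
qed

text \<open>
  The module \<open>M = U / V\<close> looks like \<open>k[t](-a)\<close>: multiplication by \<open>t\<close> is bijective from degree \<open>a\<close> on.
  The sequence \<open>0 \<rightarrow> M(-1) \<rightarrow> M \<rightarrow> M / t M \<rightarrow> 0\<close> is exact, its cokernel is \<open>k(-a)\<close>, and \<open>t\<close> acts as zero on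
  \<open>Tor(M, k)\<close>; hence \<open>Tor(M, k)\<close> embeds into \<open>Tor(k(-a), k)\<close>.
\<close>

lemma reg_le_point:
  assumes UV: "graded_quotient s U V" and t: "t \<in> H 1"
    and low: "\<And>j. j < a \<Longrightarrow> U j \<subseteq> V j"
    and u: "u \<in> U a" and unit: "\<And>c. c \<in> H 0 \<Longrightarrow> s c u \<in> V a \<Longrightarrow> c = 0"
    and span: "\<And>x. x \<in> U a \<Longrightarrow> \<exists>c\<in>H 0. x - s c u \<in> V a"
    and surj: "\<And>j x. a \<le> j \<Longrightarrow> x \<in> U (Suc j) \<Longrightarrow> \<exists>x'\<in>U j. x - s t x' \<in> V (Suc j)"
    and inj: "\<And>j x. x \<in> U j \<Longrightarrow> s t x \<in> V (Suc j) \<Longrightarrow> x \<in> V j"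
  shows "reg_le s U V a"
  unfolding reg_le_def acyclic_def
proof (intro allI impI ballI)
  note UV' = graded_quotientD[OF UV]
  fix i j z assume ij: "i + a < j" and z: "z \<in> cycles s U V i j"
  then obtain k where j: "j = k + 1" by (cases j) auto
  obtain y where y: "y \<in> tensor (Suc i) U j"
    "\<And>b. b \<in> G i \<Longrightarrow> w i b \<le> j \<Longrightarrow> j \<le> w i b + a \<Longrightarrow> z b - mat_app s (D i) y b \<in> V (j - w i b)"
    by (rule cycle_bounds_in_bottom_degree[OF UV low u unit span ij z]) auto
  let ?x = "\<lambda>b. z b - mat_app s (D i) y b"
  have x: "?x \<in> tensor i U j"
    by (rule chains_diff[OF UV'(4) cycles_chains[OF z] boundary_chains[OF UV'(1) y(1)]])
  \<comment> \<open>What remains of \<open>z\<close> lives above the bottom degree, so it is \<open>t\<close> times a chain \<open>q\<close>.  This \<open>q\<close> is a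
    cycle because \<open>t\<close> is injective, and then \<open>t\<close> times \<open>q\<close> is a boundary.\<close>
  have "\<exists>q. (b \<in> G i \<and> w i b \<le> k \<longrightarrow> q \<in> U (k - w i b)) \<and>
      (b \<in> G i \<and> w i b \<le> j \<longrightarrow> ?x b - s t q \<in> V (j - w i b)) \<and>
      (\<not> (?x b \<noteq> 0 \<and> b \<in> G i \<and> w i b \<le> k) \<longrightarrow> q = 0)" for b
  proof (cases "?x b \<noteq> 0 \<and> b \<in> G i \<and> w i b + a \<le> k")
    case True
    have jk: "j - w i b = Suc (k - w i b)" using True j by auto
    have "?x b \<in> U (Suc (k - w i b))" using chains_in[OF x, of b] True j unfolding jk[symmetric] by simp
    moreover have "a \<le> k - w i b" using True by auto
    ultimately obtain q where "q \<in> U (k - w i b)" "?x b - s t q \<in> V (Suc (k - w i b))"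
      using surj by blast
    then show ?thesis using True unfolding jk by (intro exI[of _ q]) auto
  next
    case False
    have "?x b \<in> V (j - w i b)" if "b \<in> G i" "w i b \<le> j"
      using y(2)[OF that] False that additive_pieces_zero[OF UV'(5)] j by (cases "?x b = 0") auto
    then show ?thesis using additive_pieces_zero[OF UV'(4)] by (intro exI[of _ 0]) auto
  qed
  then obtain q where q: "\<And>b. b \<in> G i \<Longrightarrow> w i b \<le> k \<Longrightarrow> q b \<in> U (k - w i b)"
    "\<And>b. b \<in> G i \<Longrightarrow> w i b \<le> j \<Longrightarrow> ?x b - s t (q b) \<in> V (j - w i b)"
    "\<And>b. \<not> (?x b \<noteq> 0 \<and> b \<in> G i \<and> w i b \<le> k) \<Longrightarrow> q b = 0" by metis
  have q_fin: "finite {b. q b \<noteq> 0}"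
    by (rule finite_subset[OF _ chains_fin[OF x]]) (use q(3) in auto)
  have qU: "q \<in> tensor i U k"
    by (rule chainsI_support[OF UV'(4) q_fin]) (use q(1) q(3) in blast)
  have xtq: "(\<lambda>b. ?x b - s t (q b)) \<in> tensor i V j"
  proof (rule chainsI)
    show "finite {b. ?x b - s t (q b) \<noteq> 0}"
      by (rule finite_support_diff[OF chains_fin[OF x]]) (rule finite_subset[OF _ q_fin], auto)
    show "?x b - s t (q b) = 0" if b: "\<not> (b \<in> G i \<and> w i b \<le> j)" for b
    proof -
      have "?x b = 0" using b chains_support(1,2)[OF x] by metis
      then show ?thesis using q(3) by simp
    qed
  qed (use q(2) in blast)
  have "q \<in> cycles s U V i k"
  proof (cases i)
    case 0
    then show ?thesis using qU by (simp add: cycles_0)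
  next
    case (Suc e)
    have dx: "mat_app s (D e) ?x \<in> tensor e V j"
    proof -
      have "mat_app s (D e) ?x = (\<lambda>c. mat_app s (D e) z c - mat_app s (D e) (mat_app s (D i) y) c)"
        by (rule boundary_diff[OF cycles_chains[OF z] boundary_chains[OF UV'(1) y(1)]])
      moreover have "mat_app s (D e) (mat_app s (D i) y) \<in> tensor e V j"
        using boundary_boundary[OF UV] y(1) unfolding Suc by blast
      moreover have "mat_app s (D e) z \<in> tensor e V j"
        using z unfolding Suc cycles_Suc by simp
      ultimately show ?thesis by (simp only: chains_diff[OF UV'(5)])
    qed
    have "mat_app s (D e) (\<lambda>b. ?x b - s t (q b)) \<in> tensor e V j"
      using boundary_chains[OF UV'(2)] xtq unfolding Suc by blast
    moreover have "finite {b. s t (q b) \<noteq> 0}" by (rule finite_subset[OF _ q_fin]) auto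
    ultimately have "(\<lambda>c. mat_app s (D e) ?x c - s t (mat_app s (D e) q c)) \<in> tensor e V j"
      by (simp add: mat_app_diff[OF chains_fin[OF x]] mat_app_scale[OF q_fin])
    from chains_diff[OF UV'(5) dx this]
    have tdq: "(\<lambda>c. s t (mat_app s (D e) q c)) \<in> tensor e V j" by simp
    have dq: "mat_app s (D e) q \<in> tensor e U k"
      using boundary_chains[OF UV'(1)] qU unfolding Suc by blast
    have "mat_app s (D e) q c \<in> V (k - w e c)" if c: "c \<in> G e" "w e c \<le> k" for c
    proof (rule inj[OF chains_in[OF dq c]])
      show "s t (mat_app s (D e) q c) \<in> V (Suc (k - w e c))"
        using chains_in[OF tdq c(1)] c(2) j by (simp add: Suc_diff_le)
    qed
    then have "mat_app s (D e) q \<in> tensor e V k"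
      using dq unfolding chains_def by auto
    then show ?thesis using qU unfolding Suc cycles_Suc by simp
  qed
  from linear_form_kills_homology[OF t UV this] obtain p where
    p: "p \<in> tensor (Suc i) U j" "(\<lambda>b. s t (q b) - mat_app s (D i) p b) \<in> tensor i V j"
    unfolding j .
  let ?y = "\<lambda>b. y b + p b"
  have "(\<lambda>b. (?x b - s t (q b)) + (s t (q b) - mat_app s (D i) p b)) \<in> tensor i V j"
    by (rule chains_add[OF UV'(5) xtq p(2)])
  then have "(\<lambda>b. z b - mat_app s (D i) ?y b) \<in> tensor i V j"
    unfolding mat_app_add[OF chains_fin[OF y(1)] chains_fin[OF p(1)]] by (simp add: algebra_simps)
  moreover have "?y \<in> tensor (Suc i) U j" by (rule chains_add[OF UV'(4) y(1) p(1)])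
  ultimately show "\<exists>y\<in>tensor (Suc i) U j. (\<lambda>b. z b - mat_app s (D i) y b) \<in> tensor i V j"
    by blast
qed

text \<open>
  The vanishing homology group is the degree \<open>j\<close> part of \<open>Tor\<^sub>0(M, k) = M / H\<^sub>+ M\<close>, so \<open>U j\<close> comes from
  lower degrees modulo \<open>V j\<close>.  In elements: \<open>m\<close> is the augmentation of the cycle \<open>m \<otimes> e0\<close>, and the
  augmentation of a boundary only involves multiples of elements of lower degree.
\<close>

lemma generated_in_lower_degrees:
  assumes UV: "graded_quotient s U V" and acyc: "acyclic s U V 0 j"
    and W: "graded_submodule s W" and V: "V j \<subseteq> W j" and lower: "\<And>k. k < j \<Longrightarrow> U k \<subseteq> W k"
  shows "U j \<subseteq> W j"
proof
  note UV' = graded_quotientD[OF UV]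
  note WH = graded_submodule_scale[OF W] and VH = graded_submodule_scale[OF UV'(2)]
  interpret P: lifted_complex_module H I G w D "(*)"
    by (intro lifted_complex_module.intro lifted_complex_axioms module_mult)
  let ?E = "\<lambda>b (_::unit). eps b"
  fix m assume m: "m \<in> U j"
  let ?z = "\<lambda>b. s (e0 b) m"
  have z_fin: "finite {b. ?z b \<noteq> 0}" by (rule finite_subset[OF _ chains_fin[OF e0_chains]]) auto
  have zU: "?z \<in> tensor 0 U j"
  proof (rule chainsI_support[OF UV'(4) z_fin])
    fix b assume "?z b \<noteq> 0"
    then have "e0 b \<noteq> 0" by auto
    from chains_support[OF e0_chains this]
    show "b \<in> G 0 \<and> w 0 b \<le> j \<and> ?z b \<in> U (j - w 0 b)"
      using graded_submodule_scale[OF UV'(1) _ m] by fastforce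
  qed
  then have "?z \<in> cycles s U V 0 j" by (simp add: cycles_0)
  with acyc obtain y where y: "y \<in> tensor (Suc 0) U j"
      "(\<lambda>b. ?z b - mat_app s (D 0) y b) \<in> tensor 0 V j" by (elim acyclicE)
  note dy = boundary_chains[OF UV'(1) y(1)]
  have "mat_app s ?E ?z () = (\<Sum>b | e0 b \<noteq> 0. s (eps b) (s (e0 b) m))"
    by (rule mat_app_eq_sum[OF chains_fin[OF e0_chains]]) auto
  also have "\<dots> = s (mat_app (*) ?E e0 ()) m" by (simp add: mat_app_def scale_sum_left)
  finally have "mat_app s ?E ?z () = m" by (simp add: eps_e0)
  then have "m = mat_app s ?E (\<lambda>b. ?z b - mat_app s (D 0) y b) () + mat_app s ?E (mat_app s (D 0) y) ()"
    by (simp add: boundary_diff[OF zU dy])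
  moreover have "mat_app s ?E (\<lambda>b. ?z b - mat_app s (D 0) y b) () \<in> V j"
    unfolding mat_app_def
  proof (rule additive_pieces_sum[OF UV'(5)])
    fix b assume "b \<in> {b. ?z b - (\<Sum>e | y e \<noteq> 0. s (D 0 e b) (y e)) \<noteq> 0}"
    then have "?z b - mat_app s (D 0) y b \<noteq> 0" by (simp add: mat_app_def)
    note b = chains_support[OF y(2) this]
    show "s (eps b) (?z b - (\<Sum>e | y e \<noteq> 0. s (D 0 e b) (y e))) \<in> V j"
    proof (cases "w 0 b = 0")
      case True
      then show ?thesis using VH[OF eps_in b(3)] by (simp add: mat_app_def)
    next
      case False
      then show ?thesis using eps_degree additive_pieces_zero[OF UV'(5)] by simp
    qed
  qed
  moreover have "mat_app s ?E (mat_app s (D 0) y) () \<in> W j"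
  proof -
    have "mat_app s ?E (mat_app s (D 0) y) = mat_app s (\<lambda>e. mat_app (*) ?E (D 0 e)) y"
      by (rule mat_app_mat_app[OF chains_fin[OF y(1)] chains_fin[OF D_chains[OF chains_support(1)[OF y(1)]]]])
    moreover have "mat_app s (\<lambda>e. mat_app (*) ?E (D 0 e)) y () \<in> W j"
      unfolding mat_app_def[of s]
    proof (rule additive_pieces_sum[OF graded_submodule_pieces[OF W]])
      fix e assume "e \<in> {e. y e \<noteq> 0}"
      then have e: "e \<in> G (Suc 0)" "w (Suc 0) e \<le> j" "y e \<in> U (j - w (Suc 0) e)"
        using chains_support[OF y(1)] by auto
      show "s (mat_app (*) ?E (D 0 e) ()) (y e) \<in> W j"
      proof (cases "w (Suc 0) e = 0")
        case True
        then show ?thesis using eps_D e(1) additive_pieces_zero[OF graded_submodule_pieces[OF W]] by simp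
      next
        case False
        have "mat_app (*) ?E (D 0 e) () \<in> H (w (Suc 0) e)"
          unfolding mat_app_def
        proof (rule additive_pieces_sum[OF H_pieces])
          fix b assume "b \<in> {b. D 0 e b \<noteq> 0}"
          then have "D 0 e b \<noteq> 0" by simp
          note b = chains_support[OF D_chains[OF e(1)] this]
          show "eps b * D 0 e b \<in> H (w (Suc 0) e)"
          proof (cases "w 0 b = 0")
            case True
            then show ?thesis using H_mult[OF eps_in b(3)] by simp
          next
            case False
            then show ?thesis using eps_degree additive_pieces_zero[OF H_pieces] by simp
          qed
        qed
        moreover have "y e \<in> W (j - w (Suc 0) e)" using lower[of "j - w (Suc 0) e"] e False by auto
        ultimately show ?thesis using WH e(2) by fastforce
      qed
    qed
    ultimately show ?thesis by simp
  qed
  ultimately show "m \<in> W j" using V additive_pieces_add[OF graded_submodule_pieces[OF W]] by fastforce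
qed

end

section \<open>Free modules\<close>

text \<open>
  The classes of the elements of \<open>Q\<close> form a basis of \<open>A / B\<close>.
\<close>

lemma (in vector_space) basis_modulo_subspace:
  assumes A: "subspace A" and B: "subspace B" "B \<subseteq> A" and F: "finite F" "A \<subseteq> span F"
  obtains Q where "finite Q" "Q \<subseteq> A" "\<And>a. a \<in> A \<Longrightarrow> \<exists>c. a - (\<Sum>x\<in>Q. scale (c x) x) \<in> B"
    "\<And>c x. (\<Sum>x\<in>Q. scale (c x) x) \<in> B \<Longrightarrow> x \<in> Q \<Longrightarrow> c x = 0"
proof -
  obtain V where V: "V \<subseteq> B" "independent V" "B \<subseteq> span V" by (rule maximal_independent_subset)
  have "V \<subseteq> A" using V(1) B(2) by blast
  then obtain U where U: "V \<subseteq> U" "U \<subseteq> A" "independent U" "A \<subseteq> span U"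
    using V(2) by (rule maximal_independent_subset_extend)
  have U_fin: "finite U" using independent_span_bound[OF F(1) U(3)] U(2) F(2) by blast
  have V_fin: "finite V" using finite_subset[OF U(1) U_fin] .
  show thesis
  proof (rule that[of "U - V"])
    show "finite (U - V)" "U - V \<subseteq> A" using U_fin U(2) by auto
    fix a assume "a \<in> A"
    then have "a \<in> span U" using U(4) by blast
    then obtain c where "a = (\<Sum>x\<in>U. scale (c x) x)" unfolding span_finite[OF U_fin] by blast
    also have "\<dots> = (\<Sum>x\<in>U - V. scale (c x) x) + (\<Sum>x\<in>V. scale (c x) x)"
      by (rule sum.subset_diff[OF U(1) U_fin])
    finally have "a - (\<Sum>x\<in>U - V. scale (c x) x) = (\<Sum>x\<in>V. scale (c x) x)" by simp
    moreover have "(\<Sum>x\<in>V. scale (c x) x) \<in> B"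
      by (rule subspace_sum[OF B(1)]) (use V(1) subspace_scale[OF B(1)] in blast)
    ultimately show "\<exists>c. a - (\<Sum>x\<in>U - V. scale (c x) x) \<in> B" by metis
  next
    fix c x assume c: "(\<Sum>x\<in>U - V. scale (c x) x) \<in> B" and x: "x \<in> U - V"
    then have "(\<Sum>x\<in>U - V. scale (c x) x) \<in> span V" using V(3) by blast
    then obtain d where d: "(\<Sum>x\<in>U - V. scale (c x) x) = (\<Sum>x\<in>V. scale (d x) x)"
      unfolding span_finite[OF V_fin] by blast
    have "(\<Sum>y\<in>U. scale (if y \<in> V then - d y else c y) y) =
        (\<Sum>y\<in>U - V. scale (if y \<in> V then - d y else c y) y) + (\<Sum>y\<in>V. scale (if y \<in> V then - d y else c y) y)"
      by (rule sum.subset_diff[OF U(1) U_fin])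
    also have "\<dots> = (\<Sum>y\<in>U - V. scale (c y) y) + (\<Sum>y\<in>V. scale (- d y) y)"
      by (intro arg_cong2[of _ _ _ _ "(+)"] sum.cong) auto
    also have "\<dots> = 0" by (simp add: d sum_negf)
    finally show "c x = 0" using independentD[OF U(3) U_fin subset_refl, of "\<lambda>y. if y \<in> V then - d y else c y" x] x
      by simp
  qed
qed

definition fun_scale :: "'p::times \<Rightarrow> ('c \<Rightarrow> 'p) \<Rightarrow> 'c \<Rightarrow> 'p" where
  "fun_scale a x = (\<lambda>c. a * x c)"

lemma module_fun_scale: "Modules.module (fun_scale :: 'p::comm_ring_1 \<Rightarrow> ('c \<Rightarrow> 'p) \<Rightarrow> _)"
proof (unfold_locales, goal_cases)
  case (1 a x y)
  show ?case by (rule ext) (simp add: fun_scale_def distrib_left)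
next
  case (2 a b x)
  show ?case by (rule ext) (simp add: fun_scale_def distrib_right)
next
  case (3 a b x)
  show ?case by (rule ext) (simp only: fun_scale_def mult.assoc)
next
  case (4 x)
  show ?case by (rule ext) (simp add: fun_scale_def)
qed

lemma fun_sum_apply: "(\<Sum>b\<in>K. f b) c = (\<Sum>b\<in>K. f b c)" for f :: "'b \<Rightarrow> 'c \<Rightarrow> 'p::comm_monoid_add"
  by (induction K rule: infinite_finite_induct) auto

lemma mat_app_fun_scale:
  fixes N :: "'b \<Rightarrow> 'c \<Rightarrow> 'p::comm_ring_1"
  assumes "finite {b. z b \<noteq> 0}"
  shows "mat_app fun_scale N z c \<tau> = mat_app (*) N (\<lambda>b. z b \<tau>) c"
proof -
  have "mat_app (*) N (\<lambda>b. z b \<tau>) c = (\<Sum>b | z b \<noteq> 0. N b c * z b \<tau>)"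
    by (rule self.mat_app_eq_sum[OF assms]) auto
  then show ?thesis by (simp add: mat_app_def fun_sum_apply fun_scale_def)
qed

lemma additive_pieces_chains: "additive_pieces U \<Longrightarrow> additive_pieces (chains T u U)"
  unfolding additive_pieces_def[of "chains T u U"]
  using chains_add[of U _ T u] chains_uminus[of U _ T u] chains_zero[of U T u]
  by (simp add: plus_fun_def fun_Compl_def zero_fun_def)

text \<open>
  The values of \<open>mat_app\<close> on vectors supported in the finite set \<open>T\<close>, extended so that additivity
  holds without conditions on the support.
\<close>

definition lincomb :: "'b set \<Rightarrow> ('b \<Rightarrow> 'c \<Rightarrow> 'p::comm_ring_1) \<Rightarrow> ('b \<Rightarrow> 'p) \<Rightarrow> 'c \<Rightarrow> 'p" where
  "lincomb T E x = (\<Sum>b\<in>T. fun_scale (x b) (E b))"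

lemma lincomb_apply: "lincomb T E x c = (\<Sum>b\<in>T. x b * E b c)"
  by (simp add: lincomb_def fun_sum_apply fun_scale_def)

lemma lincomb_add: "lincomb T E (x + y) = lincomb T E x + lincomb T E y"
  by (rule ext) (simp add: lincomb_apply distrib_right sum.distrib)

lemma lincomb_zero: "lincomb T E 0 = 0"
  by (rule ext) (simp add: lincomb_apply)

lemma lincomb_uminus: "lincomb T E (- x) = - lincomb T E x"
  by (rule ext) (simp add: lincomb_apply sum_negf)

lemma lincomb_scale: "lincomb T E (fun_scale a x) = fun_scale a (lincomb T E x)"
  by (rule ext) (simp only: lincomb_apply fun_scale_def sum_distrib_left mult.assoc)

context graded_ring
begin

lemma graded_submodule_chains:
  assumes "graded_submodule (*) U"
  shows "graded_submodule fun_scale (chains T u U)"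
  unfolding graded_submodule_def
proof (intro conjI allI ballI)
  show "additive_pieces (chains T u U)"
    using additive_pieces_chains graded_submodule_pieces[OF assms] .
  fix d j a x assume a: "a \<in> H d" and x: "x \<in> chains T u U j"
  show "fun_scale a x \<in> chains T u U (d + j)"
  proof (rule chainsI_support[OF graded_submodule_pieces[OF assms]])
    show "finite {c. fun_scale a x c \<noteq> 0}"
      by (rule finite_subset[OF _ chains_fin[OF x]]) (auto simp: fun_scale_def)
    fix c assume "fun_scale a x c \<noteq> 0"
    then have "x c \<noteq> 0" by (auto simp: fun_scale_def)
    note c = chains_support[OF x this]
    have "a * x c \<in> U (d + (j - u c))" by (rule graded_submodule_scale[OF assms a c(3)])
    then show "c \<in> T \<and> u c \<le> d + j \<and> fun_scale a x c \<in> U (d + j - u c)"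
      using c by (simp add: fun_scale_def)
  qed
qed

end

context lifted_complex
begin

text \<open>
  Homology commutes with finite direct sums, and \<open>chains T (\<lambda>_. n) U\<close> is the sum of copies of
  \<open>U(-n)\<close> indexed by \<open>T\<close>.
\<close>

lemma reg_le_free:
  assumes T: "finite T" and U: "additive_pieces U" and V: "additive_pieces V" and r: "reg_le (*) U V r"
  shows "reg_le fun_scale (chains T (\<lambda>_. n) U) (chains T (\<lambda>_. n) V) (r + n)"
  unfolding reg_le_def acyclic_def
proof (intro allI impI ballI)
  let ?U = "chains T (\<lambda>_. n) U" and ?V = "chains T (\<lambda>_. n) V"
  have entry: "(\<lambda>b. z b \<tau>) \<in> chains B u Y (j - n)"
    if z: "z \<in> chains B u (chains T (\<lambda>_. n) Y) j" and \<tau>: "\<tau> \<in> T" and n: "n \<le> j"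
      and Y: "additive_pieces Y"
    for z \<tau> B u Y and j :: nat
  proof (rule chainsI_support[OF Y])
    show "finite {b. z b \<tau> \<noteq> 0}" by (rule finite_subset[OF _ chains_fin[OF z]]) auto
    fix b assume b: "z b \<tau> \<noteq> 0"
    then have "z b \<noteq> 0" by auto
    note zb = chains_support[OF z this]
    have "n \<le> j - u b" "z b \<tau> \<in> Y (j - u b - n)" using chains_support[OF zb(3) b] by auto
    moreover have "j - u b - n = j - n - u b" by simp
    ultimately show "b \<in> B \<and> u b \<le> j - n \<and> z b \<tau> \<in> Y (j - n - u b)"
      using zb(1,2) n by (metis (no_types, lifting) add.commute le_diff_conv2)
  qed
  have assemble: "z \<in> chains B u (chains T (\<lambda>_. n) Y) j"
    if z: "\<And>\<tau>. \<tau> \<in> T \<Longrightarrow> (\<lambda>b. z b \<tau>) \<in> chains B u Y (j - n)" and out: "\<And>b \<tau>. \<tau> \<notin> T \<Longrightarrow> z b \<tau> = 0"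
      and n: "n \<le> j" and Y: "additive_pieces Y"
    for z B u Y and j :: nat
  proof (rule chainsI_support[OF additive_pieces_chains[OF Y]])
    have "{b. z b \<noteq> 0} \<subseteq> (\<Union>\<tau>\<in>T. {b. z b \<tau> \<noteq> 0})" using out by (force simp: fun_eq_iff)
    then show "finite {b. z b \<noteq> 0}"
      by (rule finite_subset) (use T chains_fin[OF z] in blast)
    fix b assume "z b \<noteq> 0"
    then obtain \<tau> where "z b \<tau> \<noteq> 0" by (auto simp: fun_eq_iff)
    moreover from this have "\<tau> \<in> T" using out by blast
    ultimately have b: "b \<in> B" "u b \<le> j - n" using chains_support[OF z] by blast+
    have "z b \<in> chains T (\<lambda>_. n) Y (j - u b)"
    proof (rule chainsI_support[OF Y])
      show "finite {\<tau>. z b \<tau> \<noteq> 0}" by (rule finite_subset[OF _ T]) (use out in blast)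
      fix \<tau> assume nz: "z b \<tau> \<noteq> 0"
      then have \<tau>: "\<tau> \<in> T" using out by blast
      have "z b \<tau> \<in> Y (j - n - u b)" using chains_support(3)[OF z[OF \<tau>] nz] .
      moreover have "j - n - u b = j - u b - n" "n \<le> j - u b" using b n by simp_all
      ultimately show "\<tau> \<in> T \<and> n \<le> j - u b \<and> z b \<tau> \<in> Y (j - u b - n)"
        using \<tau> by simp
    qed
    then show "b \<in> B \<and> u b \<le> j \<and> z b \<in> chains T (\<lambda>_. n) Y (j - u b)" using b n by simp
  qed
  fix i j z assume ij: "i + (r + n) < j" and z: "z \<in> cycles fun_scale ?U ?V i j"
  then have n: "n \<le> j" by simp
  note zU = cycles_chains[OF z]
  have "\<forall>\<tau>\<in>T. \<exists>y. y \<in> tensor (Suc i) U (j - n) \<and>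
      (\<lambda>b. z b \<tau> - mat_app (*) (D i) y b) \<in> tensor i V (j - n)"
  proof
    fix \<tau> assume True: "\<tau> \<in> T"
    have "(\<lambda>b. z b \<tau>) \<in> cycles (*) U V i (j - n)"
    proof (cases i)
      case 0
      then show ?thesis using entry[OF zU True n U] by (simp add: cycles_0)
    next
      case (Suc k)
      have "mat_app fun_scale (D k) z \<in> tensor k ?V j" using z unfolding Suc cycles_Suc by simp
      from entry[OF this True n V] show ?thesis
        using entry[OF zU True n U] unfolding mat_app_fun_scale[OF chains_fin[OF zU]] Suc cycles_Suc
        by simp
    qed
    moreover have "acyclic (*) U V i (j - n)" using r ij by (simp add: reg_le_def)
    ultimately have "\<exists>y\<in>tensor (Suc i) U (j - n).
      (\<lambda>b. z b \<tau> - mat_app (*) (D i) y b) \<in> tensor i V (j - n)"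
      unfolding acyclic_def by (rule bspec[rotated])
    then show "\<exists>y. y \<in> tensor (Suc i) U (j - n) \<and>
      (\<lambda>b. z b \<tau> - mat_app (*) (D i) y b) \<in> tensor i V (j - n)"
      unfolding Bex_def .
  qed
  from bchoice[OF this] obtain y where *: "\<forall>\<tau>\<in>T. y \<tau> \<in> tensor (Suc i) U (j - n) \<and>
    (\<lambda>b. z b \<tau> - mat_app (*) (D i) (y \<tau>) b) \<in> tensor i V (j - n)" ..
  have y: "y \<tau> \<in> tensor (Suc i) U (j - n)"
    "(\<lambda>b. z b \<tau> - mat_app (*) (D i) (y \<tau>) b) \<in> tensor i V (j - n)" if "\<tau> \<in> T" for \<tau>
    using bspec[OF * that] by simp_all
  let ?y = "\<lambda>b \<tau>. if \<tau> \<in> T then y \<tau> b else 0"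
  have yU: "?y \<in> tensor (Suc i) ?U j"
    by (rule assemble[OF _ _ n U]) (use y(1) in auto)
  have "(\<lambda>b. z b - mat_app fun_scale (D i) ?y b) \<in> tensor i ?V j"
  proof (rule assemble[OF _ _ n V])
    fix \<tau> assume "\<tau> \<in> T"
    then show "(\<lambda>b. (z b - mat_app fun_scale (D i) ?y b) \<tau>) \<in> tensor i V (j - n)"
      using y(2) by (simp add: mat_app_fun_scale[OF chains_fin[OF yU]])
  next
    fix b \<tau> assume \<tau>: "\<tau> \<notin> T"
    have "z b \<tau> = 0"
    proof (cases "z b = 0")
      case False
      from chains_support(3)[OF zU this] show ?thesis using chains_out \<tau> by metis
    qed simp
    then show "(z b - mat_app fun_scale (D i) ?y b) \<tau> = 0"
      using \<tau> by (simp add: mat_app_def fun_sum_apply fun_scale_def)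
  qed
  with yU show "\<exists>y\<in>tensor (Suc i) ?U j.
      (\<lambda>b. z b - mat_app fun_scale (D i) y b) \<in> tensor i ?V j" by blast
qed

end

section \<open>Linear resolutions over a quotient of regularity one\<close>

text \<open>
  A quotient \<open>H / J\<close> of the Koszul algebra \<open>H / I\<close> that has regularity at most one as a module over
  \<open>H / I\<close>.  It is Koszul as well.  For let \<open>M\<close> be a module over \<open>H / J\<close> with generators of degree \<open>n\<close>
  and of regularity at most \<open>n\<close> over \<open>H / I\<close>, and cover it by a free module over \<open>H / J\<close> with
  generators of degree \<open>n\<close>.  The cover has regularity at most \<open>n + 1\<close>, so by \<open>reg_le_kernel\<close> the same
  holds for its kernel.  The kernel of a minimal cover has no elements of degree \<open>n\<close>, and a bound
  \<open>n + 1\<close> on the regularity forces its generators into degree \<open>n + 1\<close>.  So the argument can be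
  repeated; starting with \<open>M = k\<close> it yields a linear resolution over \<open>H / J\<close>.  The constants \<open>const\<close>
  and the finiteness of \<open>H 1\<close> serve to choose minimal covers with finitely many generators.
\<close>

locale regularity_one_quotient = lifted_resolution H I G w D eps e0
  for H :: "nat \<Rightarrow> 'p::comm_ring_1 set" and I :: "nat \<Rightarrow> 'p set"
    and G :: "nat \<Rightarrow> 'b set" and w :: "nat \<Rightarrow> 'b \<Rightarrow> nat"
    and D :: "nat \<Rightarrow> 'b \<Rightarrow> 'b \<Rightarrow> 'p" and eps e0 :: "'b \<Rightarrow> 'p" +
  fixes const :: "'k::field \<Rightarrow> 'p" and J :: "nat \<Rightarrow> 'p set"
  assumes const_add: "const (a + b) = const a + const b"
    and const_mult: "const (a * b) = const a * const b"
    and const_one: "const 1 = 1"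
    and H_0: "H 0 = range const"
    and H_1: "\<exists>Q. finite Q \<and> (\<forall>f\<in>H 1. \<exists>c. f = (\<Sum>q\<in>Q. const (c q) * q))"
    and J_submodule: "graded_submodule (*) J"
    and J_positive: "J d \<subseteq> positive_part d"
    and I_J: "I d \<subseteq> J d"
    and reg_J: "reg_le (*) H J 1"
begin

abbreviation free :: "'c set \<Rightarrow> nat \<Rightarrow> (nat \<Rightarrow> 'p set) \<Rightarrow> nat \<Rightarrow> ('c \<Rightarrow> 'p) set" where
  "free T n \<equiv> chains T (\<lambda>_. n)"

lemma J_pieces: "additive_pieces J"
  using J_submodule by (rule graded_submodule_pieces)

lemma J_subset: "J d \<subseteq> H d"
  using J_positive positive_part_subset by blast

lemma free_J_subset: "free T n J j \<subseteq> free T n H j"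
  by (rule subsetI, erule chains_mono, rule J_subset)

lemma const_zero: "const 0 = 0"
  using const_add[of 0 0] by simp

lemma J_mult: "a \<in> H d \<Longrightarrow> x \<in> J e \<Longrightarrow> a * x \<in> J (d + e)"
  using J_submodule by (rule graded_submodule_scale)

lemma I_free: "a \<in> I d \<Longrightarrow> x \<in> free T n H j \<Longrightarrow> fun_scale a x \<in> free T n J (d + j)"
proof (rule chainsI_support[OF J_pieces])
  assume a: "a \<in> I d" and x: "x \<in> free T n H j"
  show "finite {b. fun_scale a x b \<noteq> 0}"
    by (rule finite_subset[OF _ chains_fin[OF x]]) (auto simp: fun_scale_def)
  fix b assume "fun_scale a x b \<noteq> 0"
  then have "x b \<noteq> 0" by (auto simp: fun_scale_def)
  note b = chains_support[OF x this]
  have "a * x b \<in> J (d + (j - n))" using I_mult'[OF a b(3)] I_J by blast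
  then show "b \<in> T \<and> n \<le> d + j \<and> fun_scale a x b \<in> J (d + j - n)"
    using b by (simp add: fun_scale_def)
qed

lemma lincomb_free:
  assumes E: "\<And>b. b \<in> T' \<Longrightarrow> E b \<in> U (Suc n)" and U: "graded_submodule fun_scale U"
    and x: "x \<in> free T' (Suc n) H j"
  shows "lincomb T' E x \<in> U j"
  unfolding lincomb_def
proof (rule additive_pieces_sum[OF graded_submodule_pieces[OF U]])
  fix b assume b: "b \<in> T'"
  show "fun_scale (x b) (E b) \<in> U j"
  proof (cases "x b = 0")
    case True
    then have "fun_scale (x b) (E b) = 0" by (auto simp: fun_scale_def)
    then show ?thesis using additive_pieces_zero[OF graded_submodule_pieces[OF U]] by simp
  next
    case False
    note xb = chains_support[OF x False]
    have "fun_scale (x b) (E b) \<in> U (j - Suc n + Suc n)"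
      by (rule graded_submodule_scale[OF U xb(3) E[OF b]])
    then show ?thesis using xb(2) by simp
  qed
qed

lemma lincomb_free_J:
  assumes E: "\<And>b. b \<in> T' \<Longrightarrow> E b \<in> free T n H (Suc n)" and x: "x \<in> free T' (Suc n) J j"
  shows "lincomb T' E x \<in> free T n J j"
  unfolding lincomb_def
proof (rule additive_pieces_sum[OF additive_pieces_chains[OF J_pieces]])
  fix b assume b: "b \<in> T'"
  show "fun_scale (x b) (E b) \<in> free T n J j"
  proof (rule chainsI_support[OF J_pieces])
    show "finite {c. fun_scale (x b) (E b) c \<noteq> 0}"
      by (rule finite_subset[OF _ chains_fin[OF E[OF b]]]) (auto simp: fun_scale_def)
    fix c assume "fun_scale (x b) (E b) c \<noteq> 0"
    then have nz: "x b \<noteq> 0" "E b c \<noteq> 0" by (auto simp: fun_scale_def)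
    note xb = chains_support[OF x nz(1)] and Eb = chains_support[OF E[OF b] nz(2)]
    have "E b c * x b \<in> J (Suc n - n + (j - Suc n))" by (rule J_mult[OF Eb(3) xb(3)])
    moreover have "Suc n - n + (j - Suc n) = j - n" using xb(2) by simp
    ultimately show "c \<in> T \<and> n \<le> j \<and> fun_scale (x b) (E b) c \<in> J (j - n)"
      using Eb xb by (simp add: fun_scale_def mult.commute)
  qed
qed

text \<open>
  A syzygy module in the free module with basis \<open>T\<close> in degree \<open>n\<close>, with the properties that the
  construction preserves: it vanishes in degrees up to \<open>n\<close> and has regularity at most \<open>n + 1\<close>.
\<close>

definition linear_module :: "nat \<Rightarrow> 'c set \<Rightarrow> (nat \<Rightarrow> ('c \<Rightarrow> 'p) set) \<Rightarrow> bool" where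
  "linear_module n T N \<longleftrightarrow> finite T \<and> graded_quotient fun_scale N (free T n J) \<and>
     (\<forall>j. N j \<subseteq> free T n H j) \<and> (\<forall>j\<le>n. N j \<subseteq> free T n J j) \<and>
     reg_le fun_scale N (free T n J) (Suc n)"

text \<open>
  One step of the construction.  By \<open>generated_in_lower_degrees\<close> the module \<open>N\<close> is generated by its
  piece of degree \<open>n + 1\<close>.  A basis of this piece gives a minimal cover, and minimality makes its
  kernel vanish in degree \<open>n + 1\<close>.  Elements of the infinite type \<open>'c\<close> serve as indices for the
  basis.
\<close>

lemma linear_cover:
  fixes T :: "'c set"
  assumes inf: "infinite (UNIV :: 'c set)" and lin: "linear_module n T N"
  obtains T' :: "'c set" and E where
    "\<And>b. b \<in> T' \<Longrightarrow> E b \<in> N (Suc n)"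
    "\<And>j x. x \<in> N j \<Longrightarrow> \<exists>y\<in>free T' (Suc n) H j. x - lincomb T' E y \<in> free T n J j"
    "linear_module (Suc n) T' (\<lambda>j. {x \<in> free T' (Suc n) H j. lincomb T' E x \<in> free T n J j})"
proof -
  interpret F: lifted_resolution_module H I G w D eps e0 "fun_scale :: 'p \<Rightarrow> ('c \<Rightarrow> 'p) \<Rightarrow> _"
    by (intro lifted_resolution_module.intro lifted_resolution_axioms module_fun_scale)
  from lin have T: "finite T" and NJ: "graded_quotient fun_scale N (free T n J)"
    and N_free: "\<And>j. N j \<subseteq> free T n H j" and N_low: "\<And>j. j \<le> n \<Longrightarrow> N j \<subseteq> free T n J j"
    and N_reg: "reg_le fun_scale N (free T n J) (Suc n)" by (auto simp: linear_module_def)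
  note NJ' = graded_quotientD[OF NJ]
  define sc where "sc = (\<lambda>a (x::'c \<Rightarrow> 'p). fun_scale (const a) x)"
  interpret V: vector_space sc
  proof (unfold_locales, goal_cases)
    case (1 a x y)
    show ?case by (simp add: sc_def F.scale_right_distrib)
  next
    case (2 a b x)
    show ?case by (simp add: sc_def const_add F.scale_left_distrib)
  next
    case (3 a b x)
    show ?case by (simp add: sc_def const_mult)
  next
    case (4 x)
    show ?case by (simp add: sc_def const_one)
  qed
  have const_H: "const a \<in> H 0" for a by (simp add: H_0)
  have sub: "V.subspace (U j)" if "graded_submodule fun_scale U" for U j
  proof (rule V.subspaceI)
    show "0 \<in> U j" "\<And>x y. x \<in> U j \<Longrightarrow> y \<in> U j \<Longrightarrow> x + y \<in> U j"
      using graded_submodule_pieces[OF that] additive_pieces_zero additive_pieces_add by blast+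
    show "sc c x \<in> U j" if "x \<in> U j" for c x
      using graded_submodule_scale[OF \<open>graded_submodule fun_scale U\<close> const_H that] by (simp add: sc_def)
  qed
  obtain Q where Q: "finite Q" "\<And>f. f \<in> H 1 \<Longrightarrow> \<exists>c. f = (\<Sum>q\<in>Q. const (c q) * q)"
    using H_1 by blast
  define F where "F = (\<lambda>(\<tau>, q) (c::'c). if c = \<tau> then q else 0) ` (T \<times> Q)"
  have "x \<in> V.span F" if x: "x \<in> N (Suc n)" for x
  proof -
    have xH: "x \<in> free T n H (Suc n)" using x N_free by blast
    have "x \<tau> \<in> H 1" if "\<tau> \<in> T" for \<tau> using chains_in[OF xH that] by simp
    then have "\<forall>\<tau>\<in>T. \<exists>c. x \<tau> = (\<Sum>q\<in>Q. const (c q) * q)" using Q(2) by blast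
    from bchoice[OF this] obtain c where c: "\<forall>\<tau>\<in>T. x \<tau> = (\<Sum>q\<in>Q. const (c \<tau> q) * q)" ..
    have "x = (\<Sum>\<tau>\<in>T. \<Sum>q\<in>Q. sc (c \<tau> q) (\<lambda>e. if e = \<tau> then q else 0))"
    proof
      fix e
      have "(\<Sum>\<tau>\<in>T. \<Sum>q\<in>Q. sc (c \<tau> q) (\<lambda>e. if e = \<tau> then q else 0)) e
          = (\<Sum>\<tau>\<in>T. if e = \<tau> then \<Sum>q\<in>Q. const (c \<tau> q) * q else 0)"
        unfolding fun_sum_apply by (rule sum.cong) (auto simp: sc_def fun_scale_def fun_sum_apply)
      also have "\<dots> = x e" using T c chains_out[OF xH, of e] by (auto simp: sum.delta)
      finally show "x e = (\<Sum>\<tau>\<in>T. \<Sum>q\<in>Q. sc (c \<tau> q) (\<lambda>e. if e = \<tau> then q else 0)) e" by simp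
    qed
    also have "\<dots> \<in> V.span F"
      by (intro V.span_sum V.span_scale V.span_base) (auto simp: F_def)
    finally show ?thesis .
  qed
  then have span: "N (Suc n) \<subseteq> V.span F" ..
  have F_fin: "finite F" using T Q(1) by (simp add: F_def)
  obtain B where B: "finite B" "B \<subseteq> N (Suc n)"
      "\<And>a. a \<in> N (Suc n) \<Longrightarrow> \<exists>c. a - (\<Sum>x\<in>B. sc (c x) x) \<in> free T n J (Suc n)"
      "\<And>c x. (\<Sum>x\<in>B. sc (c x) x) \<in> free T n J (Suc n) \<Longrightarrow> x \<in> B \<Longrightarrow> c x = 0"
    by (rule V.basis_modulo_subspace[OF sub[OF NJ'(1)] sub[OF NJ'(2)] NJ'(3) F_fin span]) blast
  obtain T' :: "'c set" where T': "finite T'" "card T' = card B"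
    using infinite_arbitrarily_large[OF inf] by blast
  then obtain E where E: "bij_betw E T' B" using finite_same_card_bij B(1) by blast
  have EN: "E b \<in> N (Suc n)" if "b \<in> T'" for b using E B(2) that by (auto simp: bij_betw_def)
  have EH: "E b \<in> free T n H (Suc n)" if "b \<in> T'" for b using EN[OF that] N_free by blast
  have gen_1: "\<exists>y\<in>free T' (Suc n) H (Suc n). x - lincomb T' E y \<in> free T n J (Suc n)"
    if x: "x \<in> N (Suc n)" for x
  proof -
    obtain c where c: "x - (\<Sum>x\<in>B. sc (c x) x) \<in> free T n J (Suc n)" using B(3)[OF x] by blast
    let ?y = "\<lambda>b. if b \<in> T' then const (c (E b)) else 0"
    have y: "?y \<in> free T' (Suc n) H (Suc n)"
      by (rule chainsI) (use T'(1) const_H in auto)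
    have "lincomb T' E ?y = (\<Sum>b\<in>T'. sc (c (E b)) (E b))"
      unfolding lincomb_def by (rule sum.cong) (auto simp: sc_def)
    also have "\<dots> = (\<Sum>x\<in>B. sc (c x) x)" by (rule sum.reindex_bij_betw[OF E])
    finally have eq: "lincomb T' E ?y = \<dots>" .
    show ?thesis by (rule bexI[of _ ?y, OF _ y]) (unfold eq, rule c)
  qed
  \<comment> \<open>\<open>?W\<close> is the submodule generated by the chosen elements.\<close>
  let ?W = "\<lambda>j. {x \<in> free T n H j. \<exists>y\<in>free T' (Suc n) H j. x - lincomb T' E y \<in> free T n J j}"
  have FH: "graded_submodule fun_scale (free T'' m H)" for T'' :: "'c set" and m
    by (rule graded_submodule_chains[OF graded_submodule_H])
  have FJ: "graded_submodule fun_scale (free T'' m J)" for T'' :: "'c set" and m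
    by (rule graded_submodule_chains[OF J_submodule])
  note FH' = graded_submodule_pieces[OF FH] and FJ' = graded_submodule_pieces[OF FJ]
  have W: "graded_submodule fun_scale ?W"
    unfolding graded_submodule_def additive_pieces_def
  proof (intro conjI allI ballI CollectI)
    fix j x y assume x: "x \<in> ?W j" and y: "y \<in> ?W j"
    then show "x + y \<in> free T n H j" using additive_pieces_add[OF FH'] by blast
    from x y obtain x' y' where x': "x' \<in> free T' (Suc n) H j" "x - lincomb T' E x' \<in> free T n J j"
      and y': "y' \<in> free T' (Suc n) H j" "y - lincomb T' E y' \<in> free T n J j" by blast
    have eq: "x + y - lincomb T' E (x' + y') = (x - lincomb T' E x') + (y - lincomb T' E y')"
      by (simp add: lincomb_add)
    show "\<exists>z\<in>free T' (Suc n) H j. x + y - lincomb T' E z \<in> free T n J j"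
      by (rule bexI[OF _ additive_pieces_add[OF FH' x'(1) y'(1)]])
        (unfold eq, rule additive_pieces_add[OF FJ' x'(2) y'(2)])
  next
    fix j x assume x: "x \<in> ?W j"
    then show "- x \<in> free T n H j" using additive_pieces_uminus[OF FH'] by blast
    from x obtain x' where x': "x' \<in> free T' (Suc n) H j" "x - lincomb T' E x' \<in> free T n J j" by blast
    have eq: "- x - lincomb T' E (- x') = - (x - lincomb T' E x')" by (simp add: lincomb_uminus)
    show "\<exists>z\<in>free T' (Suc n) H j. - x - lincomb T' E z \<in> free T n J j"
      by (rule bexI[OF _ additive_pieces_uminus[OF FH' x'(1)]])
        (unfold eq, rule additive_pieces_uminus[OF FJ' x'(2)])
  next
    fix j
    show "0 \<in> free T n H j" using additive_pieces_zero[OF FH'] .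
    show "\<exists>z\<in>free T' (Suc n) H j. 0 - lincomb T' E z \<in> free T n J j"
      using additive_pieces_zero[OF FH'] additive_pieces_zero[OF FJ'] by (intro bexI[of _ 0]) (simp_all add: lincomb_zero)
  next
    fix d j a x assume a: "a \<in> H d" and x: "x \<in> ?W j"
    then show "fun_scale a x \<in> free T n H (d + j)" using graded_submodule_scale[OF FH] by blast
    from x obtain x' where x': "x' \<in> free T' (Suc n) H j" "x - lincomb T' E x' \<in> free T n J j" by blast
    have eq: "fun_scale a x - lincomb T' E (fun_scale a x') = fun_scale a (x - lincomb T' E x')"
      by (simp add: lincomb_scale F.scale_right_diff_distrib)
    show "\<exists>z\<in>free T' (Suc n) H (d + j). fun_scale a x - lincomb T' E z \<in> free T n J (d + j)"
      by (rule bexI[OF _ graded_submodule_scale[OF FH a x'(1)]])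
        (unfold eq, rule graded_submodule_scale[OF FJ a x'(2)])
  qed
  have JW: "free T n J j \<subseteq> ?W j" for j
  proof
    fix x assume x: "x \<in> free T n J j"
    show "x \<in> ?W j"
      using x subsetD[OF free_J_subset x] additive_pieces_zero[OF FH']
      by (intro CollectI conjI bexI[of _ 0]) (simp_all add: lincomb_zero)
  qed
  have gen: "N j \<subseteq> ?W j" for j
  proof (induction j rule: less_induct)
    case (less j)
    consider "j \<le> n" | "j = Suc n" | "Suc n < j" by linarith
    then show ?case
    proof cases
      case 1
      then show ?thesis using N_low JW by blast
    next
      case 2
      then show ?thesis using gen_1 N_free by blast
    next
      case 3
      then have "acyclic fun_scale N (free T n J) 0 j" using N_reg by (simp add: reg_le_def)
      then show ?thesis by (rule F.generated_in_lower_degrees[OF NJ _ W JW less.IH])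
    qed
  qed
  \<comment> \<open>The kernel of the cover.\<close>
  let ?K = "\<lambda>j. {x \<in> free T' (Suc n) H j. lincomb T' E x \<in> free T n J j}"
  have K: "graded_submodule fun_scale ?K"
    unfolding graded_submodule_def additive_pieces_def
  proof (intro conjI allI ballI CollectI)
    fix j x y assume "x \<in> ?K j" "y \<in> ?K j"
    then show "x + y \<in> free T' (Suc n) H j" "lincomb T' E (x + y) \<in> free T n J j"
      using additive_pieces_add[OF FH'] additive_pieces_add[OF FJ'] by (simp_all add: lincomb_add)
  next
    fix j x assume x: "x \<in> ?K j"
    then show "- x \<in> free T' (Suc n) H j" "lincomb T' E (- x) \<in> free T n J j"
      using additive_pieces_uminus[OF FH'] additive_pieces_uminus[OF FJ'] by (simp_all add: lincomb_uminus)
  next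
    fix j
    show "0 \<in> free T' (Suc n) H j" using additive_pieces_zero[OF FH'] .
    show "lincomb T' E 0 \<in> free T n J j" using additive_pieces_zero[OF FJ'] by (simp add: lincomb_zero)
  next
    fix d j a x assume a: "a \<in> H d" and "x \<in> ?K j"
    then show "fun_scale a x \<in> free T' (Suc n) H (d + j)" "lincomb T' E (fun_scale a x) \<in> free T n J (d + j)"
      using graded_submodule_scale[OF FH a] graded_submodule_scale[OF FJ a] by (simp_all add: lincomb_scale)
  qed
  have FHJ: "graded_quotient fun_scale (free T' (Suc n) H) (free T' (Suc n) J)"
    unfolding graded_quotient_def
  proof (intro conjI allI ballI FH FJ)
    show "free T' (Suc n) J j \<subseteq> free T' (Suc n) H j" for j
      using free_J_subset by blast
  qed (rule I_free)
  have KJ: "graded_quotient fun_scale ?K (free T' (Suc n) J)"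
    unfolding graded_quotient_def
  proof (intro conjI allI ballI K FJ)
    show "free T' (Suc n) J j \<subseteq> ?K j" for j
      by (intro subsetI CollectI conjI subsetD[OF free_J_subset] lincomb_free_J[OF EH])
    show "fun_scale a x \<in> free T' (Suc n) J (d + j)" if "a \<in> I d" "x \<in> ?K j" for d j a x
      by (rule I_free[OF that(1)]) (use that(2) in simp)
  qed
  \<comment> \<open>In degree \<open>n + 1\<close> the coefficients are constants, and the generators are linearly independent.\<close>
  have K_low: "?K j \<subseteq> free T' (Suc n) J j" if "j \<le> Suc n" for j
  proof
    fix x assume x: "x \<in> ?K j"
    have "x b = 0" if b: "b \<in> T'" for b
    proof (cases "j = Suc n")
      case False
      then show ?thesis using x \<open>j \<le> Suc n\<close> chains_out'[of x T' "\<lambda>_. Suc n" H j b] by simp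
    next
      case True
      have "\<forall>b\<in>T'. \<exists>c. x b = const c"
      proof
        fix b assume "b \<in> T'"
        then have "x b \<in> H (j - Suc n)" using chains_in[of x T' "\<lambda>_. Suc n" H j b] x True by simp
        then show "\<exists>c. x b = const c" using True H_0 by auto
      qed
      from bchoice[OF this] obtain c where c: "\<forall>b\<in>T'. x b = const (c b)" ..
      let ?d = "\<lambda>y. c (inv_into T' E y)"
      have inv: "inv_into T' E (E b) = b" if "b \<in> T'" for b
        using E that by (simp add: bij_betw_def)
      have "lincomb T' E x = (\<Sum>b\<in>T'. sc (?d (E b)) (E b))"
        unfolding lincomb_def by (rule sum.cong) (auto simp: sc_def c inv)
      also have "\<dots> = (\<Sum>y\<in>B. sc (?d y) y)" by (rule sum.reindex_bij_betw[OF E])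
      finally have "(\<Sum>y\<in>B. sc (?d y) y) \<in> free T n J (Suc n)" using x True by simp
      from B(4)[OF this, of "E b"] have "c b = 0" using b E inv by (auto simp: bij_betw_def)
      then show ?thesis using c b const_zero by simp
    qed
    moreover have "x b = 0" if "b \<notin> T'" for b using x chains_out[of x T' "\<lambda>_. Suc n" H j b] that by simp
    ultimately have "x = (\<lambda>b. 0)" by blast
    then show "x \<in> free T' (Suc n) J j" using chains_zero[OF J_pieces] by simp
  qed
  have "reg_le fun_scale ?K (free T' (Suc n) J) (Suc (Suc n))"
  proof (rule reg_le_kernel[where \<delta> = "lincomb T' E" and ?s2.0 = fun_scale and U = N])
    show "reg_le fun_scale (free T' (Suc n) H) (free T' (Suc n) J) (Suc (Suc n))"
      using reg_le_free[OF T'(1) H_pieces J_pieces reg_J, of "Suc n"] by simp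
    show "\<exists>y\<in>free T' (Suc n) H j. x - lincomb T' E y \<in> free T n J j" if "x \<in> N j" for j x
      using gen that by blast
  qed (use FHJ NJ N_reg lincomb_free[of T' E N n] EN NJ' lincomb_free_J[OF EH]
      in \<open>auto simp: lincomb_add lincomb_scale module_fun_scale\<close>)
  then have "linear_module (Suc n) T' ?K"
    using T'(1) KJ K_low by (auto simp: linear_module_def)
  with EN gen show thesis by (intro that[of T' E]) auto
qed

text \<open>
  The construction starts with the kernel of the augmentation \<open>H / J \<rightarrow> k\<close>.
\<close>

lemma linear_module_irrelevant:
  fixes b0 :: 'c
  shows "linear_module 0 {b0} (free {b0} 0 positive_part)"
proof -
  interpret F: lifted_resolution_module H I G w D eps e0 "fun_scale :: 'p \<Rightarrow> ('c \<Rightarrow> 'p) \<Rightarrow> _"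
    by (intro lifted_resolution_module.intro lifted_resolution_axioms module_fun_scale)
  let ?H = "free {b0} 0 H" and ?P = "free {b0} 0 positive_part" and ?J = "free {b0} 0 J"
  have gH: "graded_submodule fun_scale ?H" and gP: "graded_submodule fun_scale ?P"
    and gJ: "graded_submodule fun_scale ?J"
    by (rule graded_submodule_chains, rule graded_submodule_H graded_submodule_positive_part J_submodule)+
  have JP: "?J j \<subseteq> ?P j" for j by (rule subsetI, erule chains_mono, rule J_positive)
  have PH: "?P j \<subseteq> ?H j" for j by (rule subsetI, erule chains_mono, rule positive_part_subset)
  have HP: "graded_quotient fun_scale ?H ?P"
    unfolding graded_quotient_def
    by (intro conjI allI ballI gH gP PH subsetD[OF JP] I_free)
  have HJ: "graded_quotient fun_scale ?H ?J"
    unfolding graded_quotient_def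
    by (intro conjI allI ballI gH gJ free_J_subset I_free)
  have PJ: "graded_quotient fun_scale ?P ?J"
    unfolding graded_quotient_def
    by (intro conjI allI ballI gP gJ JP I_free) (auto dest: subsetD[OF PH])
  let ?u = "\<lambda>c. if c = b0 then 1 else 0"
  have "reg_le fun_scale ?H ?P 0"
  proof (rule F.reg_le_simple[OF HP, of 0 ?u])
    show "?u \<in> ?H 0" using chains_single[OF H_pieces, of b0 "{b0}" 1 0 "\<lambda>_. 0"] H_one by simp
    show "?H j \<subseteq> ?P j" if "j \<noteq> 0" for j
      using that by (auto simp: chains_def positive_part_def)
    show "c = 0" if "fun_scale c ?u \<in> ?P 0" for c
      using chains_in[OF that, of b0] by (simp add: positive_part_def fun_scale_def)
    show "\<exists>c\<in>H 0. x - fun_scale c ?u \<in> ?P 0" if x: "x \<in> ?H 0" for x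
    proof -
      have "x - fun_scale (x b0) ?u = (\<lambda>c. 0)"
        using chains_out[OF x] by (auto simp: fun_eq_iff fun_scale_def)
      then have "x - fun_scale (x b0) ?u \<in> ?P 0" using chains_zero[OF positive_part_pieces] by simp
      then show ?thesis using chains_in[OF x, of b0] by (intro bexI[of _ "x b0"]) simp_all
    qed
  qed
  moreover have "reg_le fun_scale ?H ?J (Suc 0)"
    using reg_le_free[OF _ H_pieces J_pieces reg_J, of "{b0}" 0] by simp
  ultimately have "reg_le fun_scale (\<lambda>j. {x \<in> ?H j. id x \<in> ?P j}) ?J (Suc 0)"
    using HJ HP JP additive_pieces_zero[OF graded_submodule_pieces[OF gP]]
    by (intro reg_le_kernel[where ?s2.0 = fun_scale and U = ?H])
      (auto simp: module_fun_scale intro!: bexI[of _ "_::'c \<Rightarrow> 'p"])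
  moreover have "(\<lambda>j. {x \<in> ?H j. id x \<in> ?P j}) = ?P" using PH by auto
  ultimately have "reg_le fun_scale ?P ?J (Suc 0)" by simp
  moreover have "?P j \<subseteq> ?J j" if "j \<le> 0" for j
    using that additive_pieces_zero[OF J_pieces] by (auto simp: chains_def positive_part_def split: if_splits)
  ultimately show ?thesis using PJ PH by (simp add: linear_module_def)
qed

text \<open>
  The minimal linear resolution of \<open>k\<close> over \<open>H / J\<close>, as matrices over \<open>H\<close>.  The module in homological
  degree \<open>n\<close> has the basis \<open>T n\<close> in internal degree \<open>n\<close>; the last two properties are exactness.
\<close>

lemma linear_resolution:
  fixes b0 :: 'c
  assumes inf: "infinite (UNIV :: 'c set)"
  obtains T :: "nat \<Rightarrow> 'c set" and E :: "nat \<Rightarrow> 'c \<Rightarrow> 'c \<Rightarrow> 'p" where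
    "T 0 = {b0}" "\<And>n. finite (T n)"
    "\<And>n b. b \<in> T (Suc n) \<Longrightarrow> E n b \<in> free (T n) n H (Suc n)"
    "\<And>n b. b \<in> T (Suc (Suc n)) \<Longrightarrow> lincomb (T (Suc n)) (E n) (E (Suc n) b) \<in> free (T n) n J (Suc (Suc n))"
    "\<And>j x. x \<in> free (T 0) 0 positive_part j \<Longrightarrow>
      \<exists>y\<in>free (T 1) 1 H j. x - lincomb (T 1) (E 0) y \<in> free (T 0) 0 J j"
    "\<And>n j x. x \<in> free (T (Suc n)) (Suc n) H j \<Longrightarrow> lincomb (T (Suc n)) (E n) x \<in> free (T n) n J j \<Longrightarrow>
      \<exists>y\<in>free (T (Suc (Suc n))) (Suc (Suc n)) H j.
        x - lincomb (T (Suc (Suc n))) (E (Suc n)) y \<in> free (T (Suc n)) (Suc n) J j"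
proof -
  let ?start = "free {b0} 0 positive_part"
  let ?P = "\<lambda>n (s :: 'c set \<times> (nat \<Rightarrow> ('c \<Rightarrow> 'p) set)). linear_module n (fst s) (snd s) \<and>
    (n = 0 \<longrightarrow> s = ({b0}, ?start))"
  let ?R = "\<lambda>n s s' E. (\<forall>b\<in>fst s'. E b \<in> snd s (Suc n)) \<and>
    (\<forall>j. \<forall>x\<in>snd s j. \<exists>y\<in>free (fst s') (Suc n) H j. x - lincomb (fst s') E y \<in> free (fst s) n J j) \<and>
    snd s' = (\<lambda>j. {x \<in> free (fst s') (Suc n) H j. lincomb (fst s') E x \<in> free (fst s) n J j})"
  have "\<exists>s. \<forall>n. ?P n (s n) \<and> (\<exists>E. ?R n (s n) (s (Suc n)) E)"
  proof (rule dependent_nat_choice)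
    have "?P 0 ({b0}, ?start)" using linear_module_irrelevant[of b0] by simp
    then show "\<exists>s. ?P 0 s" by (rule exI)
  next
    fix s n assume P: "?P n s"
    then have "linear_module n (fst s) (snd s)" by simp
    then show "\<exists>s'. ?P (Suc n) s' \<and> (\<exists>E. ?R n s s' E)"
    proof (rule linear_cover[OF inf], goal_cases)
      case (1 T' E)
      show ?case
        by (rule exI[of _ "(T', \<lambda>j. {x \<in> free T' (Suc n) H j. lincomb T' E x \<in> free (fst s) n J j})"])
          (use 1 in \<open>auto intro!: exI[of _ E]\<close>)
    qed
  qed
  then obtain s where s: "\<forall>n. ?P n (s n) \<and> (\<exists>E. ?R n (s n) (s (Suc n)) E)" ..
  have P: "?P n (s n)" for n by (rule conjunct1[OF spec[OF s]])
  have "\<forall>n. \<exists>E. ?R n (s n) (s (Suc n)) E" by (intro allI conjunct2[OF spec[OF s]])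
  from choice[OF this] obtain E where R: "\<forall>n. ?R n (s n) (s (Suc n)) (E n)" ..
  define T where "T = (\<lambda>n. fst (s n))"
  define N where "N = (\<lambda>n. snd (s n))"
  have lin: "linear_module n (T n) (N n)" for n using P[of n] by (simp add: T_def N_def)
  have s0: "T 0 = {b0}" "N 0 = ?start" using P[of 0] by (simp_all add: T_def N_def)
  have E: "E n b \<in> N n (Suc n)" if "b \<in> T (Suc n)" for n b
    using R that by (simp add: T_def N_def)
  have gen: "\<exists>y\<in>free (T (Suc n)) (Suc n) H j. x - lincomb (T (Suc n)) (E n) y \<in> free (T n) n J j"
    if "x \<in> N n j" for n j x
    using R that by (simp add: T_def N_def)
  have N_Suc: "N (Suc n) j = {x \<in> free (T (Suc n)) (Suc n) H j. lincomb (T (Suc n)) (E n) x \<in> free (T n) n J j}" for n j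
    using R by (simp add: T_def N_def)
  show thesis
  proof (rule that[of T E])
    show "E n b \<in> free (T n) n H (Suc n)" if "b \<in> T (Suc n)" for n b
      using E[OF that] lin[of n] unfolding linear_module_def by blast
    show "finite (T n)" for n using lin[of n] by (simp add: linear_module_def)
    show "lincomb (T (Suc n)) (E n) (E (Suc n) b) \<in> free (T n) n J (Suc (Suc n))" if "b \<in> T (Suc (Suc n))" for n b
      using E[OF that] unfolding N_Suc by simp
    show "\<exists>y\<in>free (T 1) 1 H j. x - lincomb (T 1) (E 0) y \<in> free (T 0) 0 J j"
      if "x \<in> free (T 0) 0 positive_part j" for j x
      using gen[of x 0 j] that s0 by simp
    show "\<exists>y\<in>free (T (Suc (Suc n))) (Suc (Suc n)) H j.
        x - lincomb (T (Suc (Suc n))) (E (Suc n)) y \<in> free (T (Suc n)) (Suc n) J j"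
      if "x \<in> free (T (Suc n)) (Suc n) H j" "lincomb (T (Suc n)) (E n) x \<in> free (T n) n J j" for n j x
      using gen[of x "Suc n" j] that by (simp add: N_Suc)
  qed (rule s0)
qed

end

section \<open>Homogeneous ideals and their quotient rings\<close>

lemma (in ideal) coset_eq_iff:
  assumes "x \<in> carrier R" "y \<in> carrier R"
  shows "I +> x = I +> y \<longleftrightarrow> x \<ominus> y \<in> I"
proof
  assume "I +> x = I +> y"
  then have "x \<in> I +> y" using a_rcos_self[OF assms(1)] by simp
  then show "x \<ominus> y \<in> I" using a_rcos_module[OF assms(2,1)] by (simp add: a_minus_def)
next
  assume "x \<ominus> y \<in> I"
  then have "x \<in> I +> y" using a_rcos_module[OF assms(2,1)] by (simp add: a_minus_def)
  then show "I +> x = I +> y" using a_repr_independence[OF _ assms(2)] a_subgroup by metis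
qed

lemma (in ideal) carrier_Quot: "carrier (R Quot I) = (+>) I ` carrier R"
  by (auto simp: FactRing_def A_RCOSETS_def')

abbreviation type_ring :: "'p::comm_ring_1 ring" where
  "type_ring \<equiv> ring_of_type_algebra"

lemma type_ring_simps [simp]:
  "carrier type_ring = UNIV" "x \<otimes>\<^bsub>type_ring\<^esub> y = x * y" "x \<oplus>\<^bsub>type_ring\<^esub> y = x + y"
  "\<one>\<^bsub>type_ring\<^esub> = 1" "\<zero>\<^bsub>type_ring\<^esub> = 0"
  by (simp_all add: ring_of_type_algebra_def)

lemma type_ring_uminus [simp]: "\<ominus>\<^bsub>type_ring\<^esub> x = - (x :: 'p::comm_ring_1)"
proof -
  interpret cring "type_ring :: 'p ring" by (rule cring_from_type_algebra)
  show ?thesis using minus_equality[of "- x" x] by simp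
qed

lemma type_ring_minus [simp]: "x \<ominus>\<^bsub>type_ring\<^esub> y = x - (y :: 'p::comm_ring_1)"
  by (simp add: a_minus_def)

text \<open>
  The map \<open>hc d\<close> takes the homogeneous component of degree \<open>d\<close>.
\<close>

locale graded_decomposition = graded_ring H for H :: "nat \<Rightarrow> 'p::comm_ring_1 set" +
  fixes hc :: "nat \<Rightarrow> 'p \<Rightarrow> 'p"
  assumes hc_in: "hc d f \<in> H d"
    and hc_add: "hc d (f + g) = hc d f + hc d g"
    and hc_same: "f \<in> H d \<Longrightarrow> hc d f = f"
    and hc_other: "f \<in> H d \<Longrightarrow> e \<noteq> d \<Longrightarrow> hc e f = 0"
    and hc_fin: "finite {d. hc d f \<noteq> 0}"
    and hc_sum: "(\<Sum>d | hc d f \<noteq> 0. hc d f) = f"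
begin

lemma hc_zero: "hc d 0 = 0"
  using hc_add[of d 0 0] by simp

lemma hc_uminus: "hc d (- f) = - hc d f"
  using hc_add[of d f "- f"] by (simp add: hc_zero add_eq_0_iff)

lemma hc_diff: "hc d (f - g) = hc d f - hc d g"
  using hc_add[of d f "- g"] by (simp add: hc_uminus)

lemma hc_setsum: "hc d (\<Sum>b\<in>K. f b) = (\<Sum>b\<in>K. hc d (f b))"
  by (induction K rule: infinite_finite_induct) (auto simp: hc_zero hc_add)

lemma hc_sum_atMost: "(\<And>d. N < d \<Longrightarrow> hc d f = 0) \<Longrightarrow> (\<Sum>d\<le>N. hc d f) = f"
  using sum.mono_neutral_left[of "{..N}" "{d. hc d f \<noteq> 0}" "\<lambda>d. hc d f"] hc_sum[of f]
  by (metis (mono_tags, lifting) DiffD2 atMost_iff finite_atMost linorder_not_less mem_Collect_eq subsetI)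

lemma hc_mult:
  assumes a: "a \<in> H d"
  shows "hc e (a * f) = (if d \<le> e then a * hc (e - d) f else 0)"
proof -
  have "a * f = (\<Sum>k | hc k f \<noteq> 0. a * hc k f)" by (simp add: hc_sum flip: sum_distrib_left)
  then have "hc e (a * f) = (\<Sum>k | hc k f \<noteq> 0. hc e (a * hc k f))" by (simp add: hc_setsum)
  also have "\<dots> = (\<Sum>k | hc k f \<noteq> 0. if k + d = e then a * hc k f else 0)"
  proof (rule sum.cong[OF refl])
    fix k
    have "a * hc k f \<in> H (d + k)" by (rule H_mult[OF a hc_in])
    then show "hc e (a * hc k f) = (if k + d = e then a * hc k f else 0)"
      using hc_same hc_other by (auto simp: add.commute)
  qed
  also have "\<dots> = (if d \<le> e then a * hc (e - d) f else 0)"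
  proof (cases "d \<le> e")
    case True
    then have "(\<Sum>k | hc k f \<noteq> 0. if k + d = e then a * hc k f else 0) =
        (\<Sum>k | hc k f \<noteq> 0. if k = e - d then a * hc k f else 0)"
      by (intro sum.cong) auto
    then show ?thesis using True hc_fin[of f] by (simp add: sum.delta)
  next
    case False
    then show ?thesis by (auto intro!: sum.neutral)
  qed
  finally show ?thesis .
qed

definition ideal_of :: "(nat \<Rightarrow> 'p set) \<Rightarrow> 'p set" where
  "ideal_of J = {f. \<forall>d. hc d f \<in> J d}"

lemma ideal_of_homogeneous:
  assumes "additive_pieces J" "f \<in> H d"
  shows "f \<in> ideal_of J \<longleftrightarrow> f \<in> J d"
proof -
  have "hc e f \<in> J e \<longleftrightarrow> e = d \<longrightarrow> f \<in> J d" for e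
    using hc_same[OF assms(2)] hc_other[OF assms(2), of e] additive_pieces_zero[OF assms(1)]
    by (cases "e = d") auto
  then show ?thesis by (simp add: ideal_of_def)
qed

lemma ideal_of_sum:
  "additive_pieces J \<Longrightarrow> (\<And>b. b \<in> K \<Longrightarrow> f b \<in> ideal_of J) \<Longrightarrow> sum f K \<in> ideal_of J"
  by (simp add: ideal_of_def hc_setsum additive_pieces_sum)

lemma ideal_of_mult:
  assumes J: "graded_submodule (*) J" and f: "f \<in> ideal_of J"
  shows "g * f \<in> ideal_of J"
proof -
  note Jp = graded_submodule_pieces[OF J]
  have "hc k g * f \<in> ideal_of J" for k
    unfolding ideal_of_def
  proof (intro CollectI allI)
    fix d
    have "hc k g * hc (d - k) f \<in> J (k + (d - k))"
      by (rule graded_submodule_scale[OF J hc_in]) (use f in \<open>simp add: ideal_of_def\<close>)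
    then show "hc d (hc k g * f) \<in> J d"
      using additive_pieces_zero[OF Jp] by (cases "k \<le> d") (simp_all add: hc_mult[OF hc_in])
  qed
  then have "(\<Sum>k | hc k g \<noteq> 0. hc k g * f) \<in> ideal_of J" by (intro ideal_of_sum[OF Jp])
  then show ?thesis by (simp add: hc_sum flip: sum_distrib_right)
qed

lemma ideal_ideal_of:
  assumes "graded_submodule (*) J"
  shows "ideal (ideal_of J) type_ring"
proof (rule idealI)
  note Jp = graded_submodule_pieces[OF assms]
  interpret cring "type_ring :: 'p ring" by (rule cring_from_type_algebra)
  show "ring (type_ring :: 'p ring)" by (rule ring_axioms)
  have "subgroup (ideal_of J) (add_monoid type_ring)"
  proof (rule group.subgroupI[OF a_group])
    show "ideal_of J \<noteq> {}" using additive_pieces_zero[OF Jp] hc_zero by (auto simp: ideal_of_def intro!: exI[of _ 0])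
    show "inv\<^bsub>add_monoid type_ring\<^esub> a \<in> ideal_of J" if "a \<in> ideal_of J" for a
    proof -
      have "inv\<^bsub>add_monoid type_ring\<^esub> a = - a" using type_ring_uminus[of a] by (simp add: a_inv_def)
      then show ?thesis using that additive_pieces_uminus[OF Jp] by (simp add: ideal_of_def hc_uminus)
    qed
    show "a \<otimes>\<^bsub>add_monoid type_ring\<^esub> b \<in> ideal_of J" if "a \<in> ideal_of J" "b \<in> ideal_of J" for a b
      using that additive_pieces_add[OF Jp] by (simp add: ideal_of_def hc_add)
  qed simp
  then show "subgroup (ideal_of J) (add_monoid type_ring)" .
  show "x \<otimes>\<^bsub>type_ring\<^esub> a \<in> ideal_of J" "a \<otimes>\<^bsub>type_ring\<^esub> x \<in> ideal_of J" if "a \<in> ideal_of J" for a x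
    using ideal_of_mult[OF assms that, of x] by (simp_all add: mult.commute)
qed

end

text \<open>
  The quotient \<open>R\<close> of \<open>H\<close> by the ideal with components \<open>J\<close>, with its grading \<open>A\<close> and irrelevant ideal.
  As \<open>J\<close> has no constants, the residue field of \<open>R\<close> is \<open>H 0\<close>, and the class \<open>\<kappa> f\<close> of \<open>f\<close> in it is
  determined by \<open>hc 0 f\<close>.
\<close>

locale homogeneous_ideal = graded_decomposition H hc
  for H :: "nat \<Rightarrow> 'p::comm_ring_1 set" and hc :: "nat \<Rightarrow> 'p \<Rightarrow> 'p" +
  fixes J :: "nat \<Rightarrow> 'p set"
  assumes J_sub: "graded_submodule (*) J"
    and J_pos: "J d \<subseteq> positive_part d"
begin

abbreviation R :: "'p set ring" where "R \<equiv> type_ring Quot ideal_of J"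
abbreviation q :: "'p \<Rightarrow> 'p set" where "q f \<equiv> ideal_of J +>\<^bsub>type_ring\<^esub> f"
abbreviation A :: "nat \<Rightarrow> 'p set set" where "A d \<equiv> q ` H d"
abbreviation irr :: "'p set set" where "irr \<equiv> irrelevant_ideal R A"
abbreviation \<kappa> :: "'p \<Rightarrow> 'p set set" where "\<kappa> f \<equiv> irr +>\<^bsub>R\<^esub> q f"

lemma J_p: "additive_pieces J"
  using J_sub by (rule graded_submodule_pieces)

lemma ideal_J: "ideal (ideal_of J) type_ring"
  by (rule ideal_ideal_of[OF J_sub])

lemma carrier_R: "carrier R = range q"
  using ideal.carrier_Quot[OF ideal_J] by simp

lemma q_carrier: "q f \<in> carrier R"
  by (simp add: carrier_R)

lemma q_eq: "q f = q g \<longleftrightarrow> f - g \<in> ideal_of J"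
  using ideal.coset_eq_iff[OF ideal_J, of f g] by simp

lemma cring_R: "cring R"
  by (rule ideal.quotient_is_cring[OF ideal_J cring_from_type_algebra])

lemma q_hom: "(+>\<^bsub>type_ring\<^esub>) (ideal_of J) \<in> ring_hom type_ring R"
  by (rule ideal.rcos_ring_hom[OF ideal_J])

lemma q_add: "q f \<oplus>\<^bsub>R\<^esub> q g = q (f + g)"
  using ring_hom_add[OF q_hom, of f g] by simp

lemma q_mult: "q f \<otimes>\<^bsub>R\<^esub> q g = q (f * g)"
  using ring_hom_mult[OF q_hom, of f g] by simp

lemma q_zero: "\<zero>\<^bsub>R\<^esub> = q 0"
  using ring_hom_zero[OF q_hom ring_from_type_algebra cring.axioms(1)[OF cring_R]] by simp

lemma q_eq_zero: "q f = \<zero>\<^bsub>R\<^esub> \<longleftrightarrow> f \<in> ideal_of J"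
  by (simp add: q_zero q_eq)

lemma q_minus: "q f \<ominus>\<^bsub>R\<^esub> q g = q (f - g)"
proof -
  interpret R: cring R by (rule cring_R)
  have "q f \<ominus>\<^bsub>R\<^esub> q g = (q (f - g) \<oplus>\<^bsub>R\<^esub> q g) \<ominus>\<^bsub>R\<^esub> q g" by (simp add: q_add)
  also have "\<dots> = q (f - g)" using q_carrier by (simp add: R.minus_eq R.add.m_assoc R.r_neg)
  finally show ?thesis .
qed

lemma ideal_of_hc_0: "f \<in> ideal_of J \<Longrightarrow> hc 0 f = 0"
  using J_pos[of 0] by (auto simp: ideal_of_def positive_part_def)

lemma irr_eq: "irr = q ` {f. hc 0 f = 0}"
proof
  interpret R: cring R by (rule cring_R)
  have id: "ideal (q ` {f. hc 0 f = 0}) R"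
  proof (rule idealI[OF R.ring_axioms])
    show "subgroup (q ` {f. hc 0 f = 0}) (add_monoid R)"
    proof (rule group.subgroupI[OF R.a_group])
      show "q ` {f. hc 0 f = 0} \<subseteq> carrier (add_monoid R)" by (simp add: carrier_R image_subset_iff)
      show "q ` {f. hc 0 f = 0} \<noteq> {}" using hc_zero by blast
      show "inv\<^bsub>add_monoid R\<^esub> a \<in> q ` {f. hc 0 f = 0}" if a: "a \<in> q ` {f. hc 0 f = 0}" for a
      proof -
        from a obtain f where f: "a = q f" "hc 0 f = 0" by blast
        have "q (- f) \<oplus>\<^bsub>R\<^esub> q f = \<zero>\<^bsub>R\<^esub>" by (simp add: q_add q_zero)
        then have "\<ominus>\<^bsub>R\<^esub> q f = q (- f)" using R.minus_equality q_carrier by blast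
        then have "inv\<^bsub>add_monoid R\<^esub> a = q (- f)" unfolding f(1) a_inv_def .
        then show ?thesis using f(2) by (simp only: image_eqI mem_Collect_eq hc_uminus neg_equal_0_iff_equal)
      qed
      show "a \<otimes>\<^bsub>add_monoid R\<^esub> b \<in> q ` {f. hc 0 f = 0}"
        if "a \<in> q ` {f. hc 0 f = 0}" "b \<in> q ` {f. hc 0 f = 0}" for a b
        using that by (auto simp: q_add hc_add)
    qed
    have mult: "hc 0 (f * g) = 0" if "hc 0 f = 0" for f g
    proof -
      have "hc 0 (f * g) = hc 0 ((\<Sum>k | hc k f \<noteq> 0. hc k f) * g)" by (simp add: hc_sum)
      also have "\<dots> = (\<Sum>k | hc k f \<noteq> 0. hc 0 (hc k f * g))" by (simp add: sum_distrib_right hc_setsum)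
      also have "\<dots> = 0" using that by (intro sum.neutral) (auto simp: hc_mult[OF hc_in])
      finally show ?thesis .
    qed
    show "x \<otimes>\<^bsub>R\<^esub> a \<in> q ` {f. hc 0 f = 0}" if "a \<in> q ` {f. hc 0 f = 0}" "x \<in> carrier R" for a x
      using that mult by (auto simp: carrier_R q_mult mult.commute)
    show "a \<otimes>\<^bsub>R\<^esub> x \<in> q ` {f. hc 0 f = 0}" if "a \<in> q ` {f. hc 0 f = 0}" "x \<in> carrier R" for a x
      using that mult by (auto simp: carrier_R q_mult)
  qed
  show "irr \<subseteq> q ` {f. hc 0 f = 0}"
    unfolding irrelevant_ideal_def
    by (rule R.genideal_minimal[OF id]) (auto intro!: imageI hc_other)
  have sub: "(\<Union>m\<in>{0<..}. A m) \<subseteq> carrier R" by (auto simp: carrier_R)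
  interpret J: ideal irr R unfolding irrelevant_ideal_def by (rule R.genideal_ideal[OF sub])
  have gen: "q f \<in> irr" if "f \<in> H d" "0 < d" for f d
    using R.genideal_self[OF sub] that unfolding irrelevant_ideal_def by auto
  show "q ` {f. hc 0 f = 0} \<subseteq> irr"
  proof (clarify)
    fix f assume f: "hc 0 f = 0"
    have "q (\<Sum>k\<in>K. hc k f) \<in> irr" if "finite K" for K
      using that
    proof (induction K rule: finite_induct)
      case empty
      show ?case using J.zero_closed by (simp add: q_zero)
    next
      case (insert k K)
      have "q (hc k f) \<in> irr"
        using gen[OF hc_in, of k f] J.zero_closed f by (cases "k = 0") (auto simp: q_zero)
      from J.a_closed[OF this insert.IH] show ?case using insert by (simp add: q_add)
    qed
    from this[OF hc_fin[of f]] show "q f \<in> irr" by (simp add: hc_sum)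
  qed
qed

lemma q_irr: "q f \<in> irr \<longleftrightarrow> hc 0 f = 0"
proof
  assume "q f \<in> irr"
  then obtain g where g: "q f = q g" "hc 0 g = 0" by (auto simp: irr_eq)
  then show "hc 0 f = 0" using ideal_of_hc_0[of "f - g"] by (simp add: q_eq hc_diff)
qed (auto simp: irr_eq)

lemma ideal_irr: "ideal irr R"
proof -
  interpret R: cring R by (rule cring_R)
  show ?thesis unfolding irrelevant_ideal_def by (rule R.genideal_ideal) (auto simp: carrier_R)
qed

lemma \<kappa>_eq: "\<kappa> f = \<kappa> g \<longleftrightarrow> hc 0 f = hc 0 g"
  using ideal.coset_eq_iff[OF ideal_irr q_carrier q_carrier, of f g] by (simp add: q_minus q_irr hc_diff)

lemma carrier_residue: "carrier (residue_ring R A) = range \<kappa>"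
  using ideal.carrier_Quot[OF ideal_irr] by (simp add: residue_ring_def carrier_R image_image)

lemma \<kappa>_hom: "(+>\<^bsub>R\<^esub>) irr \<in> ring_hom R (residue_ring R A)"
  unfolding residue_ring_def by (rule ideal.rcos_ring_hom[OF ideal_irr])

lemma \<kappa>_add: "\<kappa> f \<oplus>\<^bsub>residue_ring R A\<^esub> \<kappa> g = \<kappa> (f + g)"
  using ring_hom_add[OF \<kappa>_hom q_carrier q_carrier, of f g] by (simp add: q_add)

lemma \<kappa>_mult: "\<kappa> f \<otimes>\<^bsub>residue_ring R A\<^esub> \<kappa> g = \<kappa> (f * g)"
  using ring_hom_mult[OF \<kappa>_hom q_carrier q_carrier, of f g] by (simp add: q_mult)

lemma \<kappa>_zero: "\<zero>\<^bsub>residue_ring R A\<^esub> = \<kappa> 0"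
  using ring_hom_zero[OF \<kappa>_hom cring.axioms(1)[OF cring_R]] ideal.quotient_is_ring[OF ideal_irr]
  by (simp add: q_zero residue_ring_def)

lemma \<kappa>_eq_zero: "\<kappa> f = \<zero>\<^bsub>residue_ring R A\<^esub> \<longleftrightarrow> hc 0 f = 0"
  by (simp add: \<kappa>_zero \<kappa>_eq hc_zero)

end

section \<open>Lifting free resolutions to the polynomial ring\<close>

context graded_decomposition
begin

definition hc_chain :: "('b \<Rightarrow> nat) \<Rightarrow> nat \<Rightarrow> ('b \<Rightarrow> 'p) \<Rightarrow> 'b \<Rightarrow> 'p" where
  "hc_chain u j z = (\<lambda>b. if u b \<le> j then hc (j - u b) (z b) else 0)"

lemma hc_chain_in:
  assumes "finite {b. z b \<noteq> 0}" "\<And>b. b \<notin> B \<Longrightarrow> z b = 0"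
  shows "hc_chain u j z \<in> chains B u H j"
proof (rule chainsI)
  show "finite {b. hc_chain u j z b \<noteq> 0}"
    by (rule finite_subset[OF _ assms(1)]) (auto simp: hc_chain_def hc_zero)
qed (use assms(2) in \<open>auto simp: hc_chain_def hc_in hc_zero\<close>)

lemma hc_chain_same:
  assumes "z \<in> chains B u H j"
  shows "hc_chain u j z = z"
proof
  fix b
  show "hc_chain u j z b = z b"
  proof (cases "z b = 0")
    case False
    from chains_support[OF assms this] show ?thesis by (simp add: hc_chain_def hc_same)
  qed (simp add: hc_chain_def hc_zero)
qed

text \<open>
  Homogeneous matrices commute with taking homogeneous components.  This is the passage from
  exactness on all vectors to exactness in each degree.
\<close>

lemma hc_chain_mat_app:
  assumes N: "\<And>b. b \<in> B \<Longrightarrow> N b \<in> chains C v H (u b)"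
    and z: "finite {b. z b \<noteq> 0}" "\<And>b. b \<notin> B \<Longrightarrow> z b = 0"
  shows "hc_chain v j (mat_app (*) N z) = mat_app (*) N (hc_chain u j z)"
proof
  fix c
  let ?K = "{b. z b \<noteq> 0}"
  have summand: "(if v c \<le> j then hc (j - v c) (N b c * z b) else 0) = N b c * hc_chain u j z b"
    if b: "b \<in> ?K" for b
  proof (cases "N b c = 0")
    case False
    have "b \<in> B" using z(2) b by blast
    note Nb = chains_support[OF N[OF this] False]
    show ?thesis
    proof (cases "u b \<le> j")
      case True
      then have "v c \<le> j" "u b - v c \<le> j - v c" "j - v c - (u b - v c) = j - u b" using Nb(2) by auto
      then show ?thesis using True by (simp add: hc_mult[OF Nb(3)] hc_chain_def)
    next
      case F: False
      then have "v c \<le> j \<Longrightarrow> \<not> u b - v c \<le> j - v c" using Nb(2) by auto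
      then show ?thesis using F by (simp add: hc_mult[OF Nb(3)] hc_chain_def)
    qed
  qed (simp add: hc_zero)
  have "hc_chain v j (mat_app (*) N z) c = (\<Sum>b\<in>?K. if v c \<le> j then hc (j - v c) (N b c * z b) else 0)"
    by (simp add: hc_chain_def mat_app_def hc_setsum)
  also have "\<dots> = (\<Sum>b\<in>?K. N b c * hc_chain u j z b)" by (rule sum.cong[OF refl summand])
  also have "\<dots> = mat_app (*) N (hc_chain u j z) c"
    by (rule self.mat_app_eq_sum[OF z(1), symmetric]) (auto simp: hc_chain_def hc_zero)
  finally show "hc_chain v j (mat_app (*) N z) c = mat_app (*) N (hc_chain u j z) c" .
qed

end

context homogeneous_ideal
begin

text \<open>
  Vectors over \<open>R\<close> are the entrywise images of vectors over \<open>H\<close>; zero entries may be lifted to zero,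
  so supports stay finite.
\<close>

lemma free_module_R:
  "free_module R B = (\<lambda>z b. q (z b)) ` {z. finite {b. z b \<noteq> 0} \<and> (\<forall>b. b \<notin> B \<longrightarrow> z b = 0)}"
proof (intro equalityI subsetI)
  fix x assume x: "x \<in> free_module R B"
  have "x b \<in> range q" for b
    using x carrier_R q_zero by (cases "b \<in> B") (auto simp: free_module_def)
  then have "\<exists>f. q f = x b \<and> (x b = \<zero>\<^bsub>R\<^esub> \<longrightarrow> f = 0)" for b
    using q_zero by (metis rangeE)
  then obtain z where z: "\<And>b. q (z b) = x b" "\<And>b. x b = \<zero>\<^bsub>R\<^esub> \<Longrightarrow> z b = 0" by metis
  have "finite {b. z b \<noteq> 0}"
    by (rule finite_subset[of _ "{b. x b \<noteq> \<zero>\<^bsub>R\<^esub>}"]) (use z(2) x in \<open>auto simp: free_module_def\<close>)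
  moreover have "z b = 0" if "b \<notin> B" for b using z(2) that x by (simp add: free_module_def)
  ultimately show "x \<in> (\<lambda>z b. q (z b)) ` {z. finite {b. z b \<noteq> 0} \<and> (\<forall>b. b \<notin> B \<longrightarrow> z b = 0)}"
    using z(1) by (intro image_eqI[of _ _ z]) auto
next
  fix x assume "x \<in> (\<lambda>z b. q (z b)) ` {z. finite {b. z b \<noteq> 0} \<and> (\<forall>b. b \<notin> B \<longrightarrow> z b = 0)}"
  then obtain z where z: "x = (\<lambda>b. q (z b))" "finite {b. z b \<noteq> 0}" "\<And>b. b \<notin> B \<Longrightarrow> z b = 0" by auto
  have "finite {b. q (z b) \<noteq> \<zero>\<^bsub>R\<^esub>}"
    by (rule finite_subset[OF _ z(2)]) (auto simp: q_zero)
  then show "x \<in> free_module R B" using z(1,3) by (simp add: free_module_def q_carrier q_zero)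
qed

lemma free_component_R: "free_component R A B u j = (\<lambda>z b. q (z b)) ` chains B u H j"
proof (intro equalityI subsetI)
  fix x assume x: "x \<in> free_component R A B u j"
  then have xm: "x \<in> free_module R B" by (simp add: free_component_def)
  have "\<exists>f. q f = x b \<and> (x b = \<zero>\<^bsub>R\<^esub> \<longrightarrow> f = 0) \<and> (b \<in> B \<and> u b \<le> j \<longrightarrow> f \<in> H (j - u b))" for b
  proof (cases "x b = \<zero>\<^bsub>R\<^esub>")
    case True
    then show ?thesis using q_zero additive_pieces_zero[OF H_pieces] by (intro exI[of _ 0]) auto
  next
    case False
    then have b: "b \<in> B" using xm by (auto simp: free_module_def)
    then have "u b \<le> j" "x b \<in> A (j - u b)"
      using x False by (auto simp: free_component_def split: if_splits)
    then show ?thesis using False by (auto simp: image_iff)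
  qed
  then obtain z where z: "\<And>b. q (z b) = x b" "\<And>b. x b = \<zero>\<^bsub>R\<^esub> \<Longrightarrow> z b = 0"
    "\<And>b. b \<in> B \<Longrightarrow> u b \<le> j \<Longrightarrow> z b \<in> H (j - u b)" by metis
  have fin: "finite {b. z b \<noteq> 0}"
    by (rule finite_subset[of _ "{b. x b \<noteq> \<zero>\<^bsub>R\<^esub>}"]) (use z(2) xm in \<open>auto simp: free_module_def\<close>)
  have "z \<in> chains B u H j"
  proof (rule chainsI[OF fin])
    show "z b = 0" if "\<not> (b \<in> B \<and> u b \<le> j)" for b
      by (rule z(2)) (use that x in \<open>auto simp: free_component_def free_module_def split: if_splits\<close>)
  qed (rule z(3))
  then show "x \<in> (\<lambda>z b. q (z b)) ` chains B u H j" using z(1) by (intro image_eqI[of _ _ z]) auto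
next
  fix x assume "x \<in> (\<lambda>z b. q (z b)) ` chains B u H j"
  then obtain z where z: "x = (\<lambda>b. q (z b))" "z \<in> chains B u H j" by auto
  have "x \<in> free_module R B"
    unfolding free_module_R z(1) using chains_fin[OF z(2)] chains_out[OF z(2)] by (intro imageI) simp
  moreover have "if u b \<le> j then x b \<in> A (j - u b) else x b = \<zero>\<^bsub>R\<^esub>" if "b \<in> B" for b
    using chains_in[OF z(2) that] chains_out'[OF z(2), of b] by (auto simp: z(1) q_zero)
  ultimately show "x \<in> free_component R A B u j" by (simp add: free_component_def)
qed

lemma chains_ideal:
  assumes "z \<in> chains B u H j" "\<And>b. q (z b) = \<zero>\<^bsub>R\<^esub>"
  shows "z \<in> chains B u J j"
proof (rule chainsI[OF chains_fin[OF assms(1)]])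
  fix b assume b: "b \<in> B" "u b \<le> j"
  show "z b \<in> J (j - u b)"
    using assms(2)[of b] ideal_of_homogeneous[OF J_p chains_in[OF assms(1) b]] by (simp add: q_eq_zero)
qed (use assms(1) in \<open>auto simp: chains_def\<close>)

lemma chains_ideal_zero:
  assumes "z \<in> chains B u J j"
  shows "q (z b) = \<zero>\<^bsub>R\<^esub>"
proof (cases "z b = 0")
  case False
  note b = chains_support[OF assms this]
  then have "z b \<in> H (j - u b)" using J_pos positive_part_subset by blast
  then show ?thesis using ideal_of_homogeneous[OF J_p] b(3) by (simp add: q_eq_zero)
qed (simp add: q_zero)

lemma hc_chain_ideal:
  assumes "finite {b. z b \<noteq> 0}" "\<And>b. b \<notin> B \<Longrightarrow> z b = 0" "\<And>b. q (z b) = \<zero>\<^bsub>R\<^esub>"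
  shows "hc_chain u j z \<in> chains B u J j"
proof (rule chainsI)
  show "finite {b. hc_chain u j z b \<noteq> 0}"
    using chains_fin[OF hc_chain_in[OF assms(1,2)]] .
  fix b assume b: "b \<in> B" "u b \<le> j"
  have "z b \<in> ideal_of J" using assms(3)[of b] by (simp only: q_eq_zero)
  then show "hc_chain u j z b \<in> J (j - u b)" using b by (simp add: hc_chain_def ideal_of_def)
qed (use assms(2) in \<open>auto simp: hc_chain_def hc_zero\<close>)

end

locale residue_field_resolution = homogeneous_ideal H hc J
  for H :: "nat \<Rightarrow> 'p::comm_ring_1 set" and hc :: "nat \<Rightarrow> 'p \<Rightarrow> 'p" and J :: "nat \<Rightarrow> 'p set" +
  fixes F :: "('p set, 'b) free_complex"
  assumes res: "graded_free_resolution R A F"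
begin

abbreviation "G \<equiv> gens F"
abbreviation "w \<equiv> gdeg F"
abbreviation tensor :: "nat \<Rightarrow> (nat \<Rightarrow> 'p set) \<Rightarrow> nat \<Rightarrow> ('b \<Rightarrow> 'p) set" where
  "tensor i \<equiv> chains (G i) (w i)"

lemmas res_conj = res[unfolded graded_free_resolution_def]

lemma bd_mem: "x \<in> chain_module R F (Suc i) \<Longrightarrow> bd F i x \<in> chain_module R F i"
  using res_conj[THEN conjunct1] by blast

lemma bd_vadd: "x \<in> chain_module R F (Suc i) \<Longrightarrow> y \<in> chain_module R F (Suc i) \<Longrightarrow>
    bd F i (vadd R x y) = vadd R (bd F i x) (bd F i y)"
  using res_conj[THEN conjunct2, THEN conjunct1] by blast

lemma bd_vscale: "r \<in> carrier R \<Longrightarrow> x \<in> chain_module R F (Suc i) \<Longrightarrow>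
    bd F i (vscale R r x) = vscale R r (bd F i x)"
  using res_conj[THEN conjunct2, THEN conjunct2, THEN conjunct1] by blast

lemma bd_component: "x \<in> chain_component R A F (Suc i) j \<Longrightarrow> bd F i x \<in> chain_component R A F i j"
  using res_conj[THEN conjunct2, THEN conjunct2, THEN conjunct2, THEN conjunct1] by blast

lemma aug_vadd: "x \<in> chain_module R F 0 \<Longrightarrow> y \<in> chain_module R F 0 \<Longrightarrow>
    aug F (vadd R x y) = aug F x \<oplus>\<^bsub>residue_ring R A\<^esub> aug F y"
  using res_conj[THEN conjunct2, THEN conjunct2, THEN conjunct2, THEN conjunct2, THEN conjunct1] by blast

lemma aug_vscale: "r \<in> carrier R \<Longrightarrow> x \<in> chain_module R F 0 \<Longrightarrow>
    aug F (vscale R r x) = (irr +>\<^bsub>R\<^esub> r) \<otimes>\<^bsub>residue_ring R A\<^esub> aug F x"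
  using res_conj[THEN conjunct2, THEN conjunct2, THEN conjunct2, THEN conjunct2, THEN conjunct2, THEN conjunct1] by blast

lemma aug_component: "0 < j \<Longrightarrow> x \<in> chain_component R A F 0 j \<Longrightarrow> aug F x = \<zero>\<^bsub>residue_ring R A\<^esub>"
  using res_conj[THEN conjunct2, THEN conjunct2, THEN conjunct2, THEN conjunct2, THEN conjunct2, THEN conjunct2, THEN conjunct1] by blast

lemma aug_image: "aug F ` chain_module R F 0 = carrier (residue_ring R A)"
  using res_conj[THEN conjunct2, THEN conjunct2, THEN conjunct2, THEN conjunct2, THEN conjunct2, THEN conjunct2, THEN conjunct2, THEN conjunct1] by assumption

lemma aug_kernel: "{x \<in> chain_module R F 0. aug F x = \<zero>\<^bsub>residue_ring R A\<^esub>} = bd F 0 ` chain_module R F 1"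
  using res_conj[THEN conjunct2, THEN conjunct2, THEN conjunct2, THEN conjunct2, THEN conjunct2, THEN conjunct2, THEN conjunct2, THEN conjunct2, THEN conjunct1] by assumption

lemma bd_kernel: "{x \<in> chain_module R F (Suc i). bd F i x = vzero R} =
          bd F (Suc i) ` chain_module R F (Suc (Suc i))"
  using res_conj[THEN conjunct2, THEN conjunct2, THEN conjunct2, THEN conjunct2, THEN conjunct2, THEN conjunct2, THEN conjunct2, THEN conjunct2, THEN conjunct2] by (rule spec)

definition unit :: "'b \<Rightarrow> 'b \<Rightarrow> 'p set" where
  "unit b = (\<lambda>c. q (if c = b then 1 else 0))"

lemma unit_component: "b \<in> G i \<Longrightarrow> unit b \<in> chain_component R A F i (w i b)"
  unfolding free_component_R unit_def
  using chains_single[OF H_pieces, of b "G i" 1 0 "w i"] H_one by (intro imageI) simp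

lemma unit_module: "b \<in> G i \<Longrightarrow> unit b \<in> chain_module R F i"
  using unit_component by (fastforce simp: free_component_def)

text \<open>
  The rows of the lifted matrices: homogeneous lifts of the images of the basis elements.
\<close>

definition D :: "nat \<Rightarrow> 'b \<Rightarrow> 'b \<Rightarrow> 'p" where
  "D i b = (if b \<in> G (Suc i)
     then SOME z. z \<in> tensor i H (w (Suc i) b) \<and> bd F i (unit b) = (\<lambda>c. q (z c)) else (\<lambda>c. 0))"

lemma D_lift:
  assumes "b \<in> G (Suc i)"
  shows "D i b \<in> tensor i H (w (Suc i) b)" "bd F i (unit b) = (\<lambda>c. q (D i b c))"
proof -
  have "bd F i (unit b) \<in> (\<lambda>z b. q (z b)) ` tensor i H (w (Suc i) b)"
    using bd_component[OF unit_component[OF assms]] by (simp only: free_component_R)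
  then have "\<exists>z. z \<in> tensor i H (w (Suc i) b) \<and> bd F i (unit b) = (\<lambda>c. q (z c))" by blast
  from someI_ex[OF this] show "D i b \<in> tensor i H (w (Suc i) b)" "bd F i (unit b) = (\<lambda>c. q (D i b c))"
    using assms by (simp_all add: D_def)
qed

lemma chain_moduleI: "finite {b. z b \<noteq> 0} \<Longrightarrow> (\<And>b. b \<notin> B \<Longrightarrow> z b = 0) \<Longrightarrow> (\<lambda>b. q (z b)) \<in> free_module R B"
  unfolding free_module_R by (intro imageI) simp

lemma vadd_q: "vadd R (\<lambda>b. q (x b)) (\<lambda>b. q (y b)) = (\<lambda>b. q (x b + y b))"
  by (simp add: vadd_def q_add)

lemma vscale_q: "vscale R (q a) (\<lambda>b. q (x b)) = (\<lambda>b. q (a * x b))"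
  by (simp add: vscale_def q_mult)

text \<open>
  A linear map on a free module over \<open>R\<close> is computed by lifted values \<open>N\<close> on the basis.  Both the
  differentials and the augmentation are instances, with \<open>\<psi>\<close> the passage to classes in the target
  and \<open>add'\<close> the addition there.
\<close>

lemma linear_on_lifts:
  assumes z: "finite {b. z b \<noteq> 0}" "\<And>b. b \<notin> B \<Longrightarrow> z b = 0"
    and add: "\<And>x y. x \<in> free_module R B \<Longrightarrow> y \<in> free_module R B \<Longrightarrow> \<phi> (vadd R x y) = add' (\<phi> x) (\<phi> y)"
    and zero: "\<phi> (vzero R) = \<psi> 0"
    and step: "\<And>a x b. b \<in> B \<Longrightarrow> add' (\<phi> (vscale R (q a) (unit b))) (\<psi> x) = \<psi> (fun_scale a (N b) + x)"
  shows "\<phi> (\<lambda>b. q (z b)) = \<psi> (mat_app (*) N z)"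
proof -
  have *: "\<phi> (\<lambda>b. q (if b \<in> K then z b else 0)) = \<psi> (\<Sum>b\<in>K. fun_scale (z b) (N b))"
    if "finite K" "K \<subseteq> {b. z b \<noteq> 0}" for K
    using that
  proof (induction K rule: finite_induct)
    case empty
    then show ?case using zero by (simp add: vzero_def q_zero zero_fun_def)
  next
    case (insert k K)
    have k: "k \<in> B" using insert.prems z(2) by auto
    have mem: "(\<lambda>b. q (if b \<in> K then z b else 0)) \<in> free_module R B"
      by (rule chain_moduleI) (use z insert.prems in \<open>auto intro: finite_subset[OF _ z(1)]\<close>)
    have mem': "vscale R (q (z k)) (unit k) \<in> free_module R B"
      unfolding unit_def vscale_q by (rule chain_moduleI) (use k in auto)
    have "(\<lambda>b. q (if b \<in> insert k K then z b else 0)) =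
        vadd R (vscale R (q (z k)) (unit k)) (\<lambda>b. q (if b \<in> K then z b else 0))"
      unfolding unit_def vscale_q vadd_q using insert.hyps by (intro ext) auto
    then have "\<phi> (\<lambda>b. q (if b \<in> insert k K then z b else 0)) =
        add' (\<phi> (vscale R (q (z k)) (unit k))) (\<psi> (\<Sum>b\<in>K. fun_scale (z b) (N b)))"
      using add[OF mem' mem] insert by simp
    then show ?case using step[OF k] insert.hyps by (simp add: plus_fun_def)
  qed
  have "(\<lambda>b. q (if b \<in> {b. z b \<noteq> 0} then z b else 0)) = (\<lambda>b. q (z b))"
  proof
    fix b
    show "q (if b \<in> {b. z b \<noteq> 0} then z b else 0) = q (z b)" by (cases "z b = 0") simp_all
  qed
  moreover have "(\<Sum>b | z b \<noteq> 0. fun_scale (z b) (N b)) = mat_app (*) N z"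
    by (intro ext) (simp add: mat_app_def fun_sum_apply fun_scale_def mult.commute)
  ultimately show ?thesis using *[OF z(1) subset_refl] by simp
qed

lemma vzero_module: "vzero R \<in> free_module R B"
  using chain_moduleI[of "\<lambda>_. 0" B] by (simp add: vzero_def q_zero)

lemma vscale_zero: "x \<in> free_module R B \<Longrightarrow> vscale R \<zero>\<^bsub>R\<^esub> x = vzero R"
  unfolding free_module_R by (auto simp: q_zero vscale_q vzero_def)

lemma bd_lift:
  assumes z: "finite {b. z b \<noteq> 0}" "\<And>b. b \<notin> G (Suc i) \<Longrightarrow> z b = 0"
  shows "bd F i (\<lambda>b. q (z b)) = (\<lambda>c. q (mat_app (*) (D i) z c))"
proof (rule linear_on_lifts[OF z, where \<phi> = "bd F i" and \<psi> = "\<lambda>x c. q (x c)" and add' = "vadd R"])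
  show "bd F i (vzero R) = (\<lambda>c. q ((0 :: 'b \<Rightarrow> 'p) c))"
  proof -
    have "bd F i (vzero R) = bd F i (vscale R \<zero>\<^bsub>R\<^esub> (vzero R))" by (simp add: vscale_zero[OF vzero_module])
    also have "\<dots> = vscale R \<zero>\<^bsub>R\<^esub> (bd F i (vzero R))"
      by (rule bd_vscale) (simp_all add: vzero_module q_zero q_carrier)
    also have "\<dots> = vzero R" by (rule vscale_zero[OF bd_mem[OF vzero_module]])
    finally show ?thesis by (simp add: vzero_def q_zero)
  qed
  show "vadd R (bd F i (vscale R (q a) (unit b))) (\<lambda>c. q (x c)) = (\<lambda>c. q ((fun_scale a (D i b) + x) c))"
    if "b \<in> G (Suc i)" for a x b
    using bd_vscale[OF q_carrier unit_module[OF that]] D_lift(2)[OF that]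
    by (simp add: vscale_q vadd_q fun_scale_def)
qed (assumption | rule bd_vadd)+

text \<open>
  Basis elements of positive degree are mapped to zero by the augmentation, and their lift has to be
  zero as well.
\<close>

definition eps :: "'b \<Rightarrow> 'p" where
  "eps b = (if b \<in> G 0 \<and> w 0 b = 0 then SOME f. f \<in> H 0 \<and> aug F (unit b) = \<kappa> f else 0)"

lemma eps_degree: "0 < w 0 b \<Longrightarrow> eps b = 0"
  by (simp add: eps_def)

lemma eps_H: "eps b \<in> H 0" and eps_aug: "b \<in> G 0 \<Longrightarrow> aug F (unit b) = \<kappa> (eps b)"
proof -
  have *: "\<exists>f. f \<in> H 0 \<and> aug F (unit b) = \<kappa> f" if "b \<in> G 0"
  proof -
    have "aug F (unit b) \<in> carrier (residue_ring R A)" using aug_image unit_module[OF that] by blast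
    then obtain f where "aug F (unit b) = \<kappa> f" by (auto simp: carrier_residue)
    also have "\<kappa> f = \<kappa> (hc 0 f)" by (simp add: \<kappa>_eq hc_same[OF hc_in])
    finally show ?thesis using hc_in by blast
  qed
  show "eps b \<in> H 0"
    using someI_ex[OF *] additive_pieces_zero[OF H_pieces] by (auto simp: eps_def)
  show "aug F (unit b) = \<kappa> (eps b)" if b: "b \<in> G 0"
  proof (cases "w 0 b = 0")
    case True
    then show ?thesis using someI_ex[OF *[OF b]] b by (simp add: eps_def)
  next
    case False
    then have "aug F (unit b) = \<zero>\<^bsub>residue_ring R A\<^esub>" using aug_component unit_component[OF b] by blast
    then show ?thesis using False by (simp add: eps_def \<kappa>_zero)
  qed
qed

abbreviation eps_mat :: "'b \<Rightarrow> unit \<Rightarrow> 'p" where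
  "eps_mat \<equiv> \<lambda>b _. eps b"

lemma aug_lift:
  assumes z: "finite {b. z b \<noteq> 0}" "\<And>b. b \<notin> G 0 \<Longrightarrow> z b = 0"
  shows "aug F (\<lambda>b. q (z b)) = \<kappa> (mat_app (*) eps_mat z ())"
proof (rule linear_on_lifts[OF z, where \<phi> = "aug F" and \<psi> = "\<lambda>x. \<kappa> (x ())"
      and add' = "\<lambda>x y. x \<oplus>\<^bsub>residue_ring R A\<^esub> y"])
  show "aug F (vzero R) = \<kappa> ((0 :: unit \<Rightarrow> 'p) ())"
  proof -
    have "aug F (vzero R) \<in> carrier (residue_ring R A)" using aug_image vzero_module by blast
    then obtain f where f: "aug F (vzero R) = \<kappa> f" by (auto simp: carrier_residue)
    have "aug F (vzero R) = aug F (vscale R (q 0) (vzero R))"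
      using vscale_zero[OF vzero_module[of "G 0"]] by (simp only: q_zero)
    also have "\<dots> = \<kappa> 0 \<otimes>\<^bsub>residue_ring R A\<^esub> aug F (vzero R)"
      by (rule aug_vscale) (simp_all add: vzero_module q_carrier)
    also have "\<dots> = \<kappa> 0" by (simp add: f \<kappa>_mult)
    finally show ?thesis by simp
  qed
  show "aug F (vscale R (q a) (unit b)) \<oplus>\<^bsub>residue_ring R A\<^esub> \<kappa> (x ()) = \<kappa> ((fun_scale a (\<lambda>_. eps b) + x) ())"
    if "b \<in> G 0" for a x b
    using aug_vscale[OF q_carrier unit_module[OF that]] eps_aug[OF that]
    by (simp add: \<kappa>_mult \<kappa>_add fun_scale_def)
qed (assumption | rule aug_vadd)+

lemma eps_chains: "b \<in> G 0 \<Longrightarrow> (\<lambda>_::unit. eps b) \<in> chains UNIV (\<lambda>_. 0) H (w 0 b)"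
  using eps_H[of b] eps_degree[of b] additive_pieces_zero[OF H_pieces]
  by (intro chainsI) (cases "w 0 b = 0"; simp)+

end

context residue_field_resolution
begin

lemma D_boundary_zero:
  assumes z: "finite {b. z b \<noteq> 0}" "\<And>b. b \<notin> G (Suc (Suc i)) \<Longrightarrow> z b = 0"
  shows "q (mat_app (*) (D i) (mat_app (*) (D (Suc i)) z) c) = \<zero>\<^bsub>R\<^esub>"
proof -
  let ?y = "mat_app (*) (D (Suc i)) z"
  have sup: "b \<in> G (Suc (Suc i))" if "z b \<noteq> 0" for b using z(2) that by blast
  have y: "finite {b. ?y b \<noteq> 0}"
    by (rule self.finite_support_mat_app[OF z(1)]) (rule chains_fin[OF D_lift(1)[OF sup]])
  have yG: "?y b = 0" if "b \<notin> G (Suc i)" for b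
  proof -
    have "D (Suc i) e b = 0" if "z e \<noteq> 0" for e
      using chains_out[OF D_lift(1)[OF sup[OF that]] \<open>b \<notin> G (Suc i)\<close>] .
    then show ?thesis by (simp add: mat_app_def)
  qed
  have "bd F (Suc i) (\<lambda>b. q (z b)) \<in> {x \<in> chain_module R F (Suc i). bd F i x = vzero R}"
    using bd_kernel[of i] chain_moduleI[OF z] by blast
  then have "bd F i (\<lambda>b. q (?y b)) = vzero R" by (simp add: bd_lift[OF z])
  then show ?thesis using bd_lift[OF y yG] by (simp add: vzero_def fun_eq_iff)
qed

text \<open>
  A preimage of \<open>z\<close> under the differential need not be homogeneous, but its component of degree \<open>j\<close> is
  again a preimage.
\<close>

lemma lift_boundary:
  assumes z: "z \<in> tensor i H j" and im: "(\<lambda>b. q (z b)) \<in> bd F i ` chain_module R F (Suc i)"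
  shows "\<exists>y\<in>tensor (Suc i) H j. (\<lambda>b. z b - mat_app (*) (D i) y b) \<in> tensor i J j"
proof -
  from im obtain y where y: "finite {b. y b \<noteq> 0}" "\<And>b. b \<notin> G (Suc i) \<Longrightarrow> y b = 0"
      and eq: "(\<lambda>b. q (z b)) = bd F i (\<lambda>b. q (y b))"
    unfolding free_module_R by auto
  let ?dy = "mat_app (*) (D i) y" and ?y = "hc_chain (w (Suc i)) j y"
  have sup: "b \<in> G (Suc i)" if "y b \<noteq> 0" for b using y(2) that by blast
  have dy: "finite {b. ?dy b \<noteq> 0}"
    by (rule self.finite_support_mat_app[OF y(1)]) (rule chains_fin[OF D_lift(1)[OF sup]])
  have dyG: "?dy b = 0" if "b \<notin> G i" for b
  proof -
    have "D i e b = 0" if "y e \<noteq> 0" for e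
      using chains_out[OF D_lift(1)[OF sup[OF that]] \<open>b \<notin> G i\<close>] .
    then show ?thesis by (simp add: mat_app_def)
  qed
  have "q (z b - ?dy b) = \<zero>\<^bsub>R\<^esub>" for b
    using fun_cong[OF eq, of b] by (simp add: bd_lift[OF y] q_eq q_eq_zero)
  then have "hc_chain (w i) j (\<lambda>b. z b - ?dy b) \<in> tensor i J j"
    using dyG chains_out[OF z]
    by (intro hc_chain_ideal finite_support_diff[OF chains_fin[OF z] dy]) auto
  moreover have "hc_chain (w i) j (\<lambda>b. z b - ?dy b) = (\<lambda>b. hc_chain (w i) j z b - hc_chain (w i) j ?dy b)"
    by (auto simp: hc_chain_def hc_diff)
  moreover have "hc_chain (w i) j ?dy = mat_app (*) (D i) ?y"
    by (rule hc_chain_mat_app[OF D_lift(1) y])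
  ultimately have "(\<lambda>b. z b - mat_app (*) (D i) ?y b) \<in> tensor i J j"
    by (simp add: hc_chain_same[OF z])
  then show ?thesis using hc_chain_in[OF y] by blast
qed

lemma vadd_vzero: "x \<in> free_module R B \<Longrightarrow> vadd R (vzero R) x = x"
  unfolding free_module_R by (auto simp: vzero_def q_zero vadd_q)

lemma trivial_TorD:
  assumes "trivial_group (Tor R A F i j)"
  shows "tor_cycles R A F i j \<subseteq> tor_boundaries R A F i j"
proof
  let ?C = "\<lparr>carrier = tor_cycles R A F i j, monoid.mult = vadd R, one = vzero R\<rparr>"
  let ?B = "tor_boundaries R A F i j"
  fix x assume x: "x \<in> tor_cycles R A F i j"
  then have xm: "x \<in> chain_module R F i" by (simp add: tor_cycles_def free_component_def)
  have "carrier (?C Mod ?B) = {\<one>\<^bsub>?C Mod ?B\<^esub>}" using assms by (simp add: trivial_group_def Tor_def)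
  then have "?B #>\<^bsub>?C\<^esub> x = ?B" using x by (auto simp: FactGroup_def RCOSETS_def)
  moreover have "vzero R \<in> ?B"
  proof -
    have z: "(\<lambda>b. q ((\<lambda>_. 0) b)) \<in> chain_component R A F k j" for k
      unfolding free_component_R by (intro imageI chains_zero H_pieces)
    have "bd F i (vzero R) = vzero R"
      using bd_lift[of "\<lambda>_. 0" i] by (simp add: vzero_def q_zero self.mat_app_zero)
    then have "vzero R = vadd R (bd F i (vzero R)) (vzero R)"
      using vadd_vzero[OF vzero_module[of "G i"]] by simp
    moreover have "vzero R \<in> chain_component R A F k j" for k using z[of k] by (simp add: vzero_def q_zero)
    moreover have "reduces_to_zero R A (vzero R :: 'b \<Rightarrow> _)"
      by (simp add: reduces_to_zero_def vzero_def q_zero q_irr hc_zero)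
    ultimately show ?thesis unfolding tor_boundaries_def by blast
  qed
  then have "vadd R (vzero R) x \<in> ?B #>\<^bsub>?C\<^esub> x" by (auto simp: r_coset_def)
  ultimately show "x \<in> ?B" using vadd_vzero[OF xm] by simp
qed

text \<open>
  Exactness and the vanishing of \<open>Tor\<close> carry over to the lifts degree by degree.  A homogeneous entry
  is in the irrelevant ideal exactly if its component of degree \<open>0\<close> vanishes, which is how
  \<open>positive_part\<close> enters.
\<close>

lemma lifts_to_resolution:
  assumes tor: "\<And>i j. i \<noteq> j \<Longrightarrow> trivial_group (Tor R A F i j)"
  shows "\<exists>e0. lifted_resolution H J G w D eps e0"
proof -
  have lc: "lifted_complex H J G w D"
  proof (intro lifted_complex.intro lifted_complex_axioms.intro graded_ring_axioms J_sub)
    show "J d \<subseteq> H d" for d using J_pos positive_part_subset by blast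
    show "D i b \<in> tensor i H (w (Suc i) b)" if "b \<in> G (Suc i)" for b i
      using D_lift(1)[OF that] .
    show "mat_app (*) (D i) (D (Suc i) b) \<in> tensor i J (w (Suc (Suc i)) b)"
      if b: "b \<in> G (Suc (Suc i))" for b i
    proof (rule chains_ideal)
      note Db = D_lift(1)[OF b]
      show "mat_app (*) (D i) (D (Suc i) b) \<in> tensor i H (w (Suc (Suc i)) b)"
        using self.mat_app_chains[of "G (Suc i)" "D i" "G i" "w i" H "w (Suc i)" 0 "D (Suc i) b" H _ H]
          D_lift(1) Db H_pieces H_mult by auto
      let ?u = "\<lambda>c. if c = b then 1 else (0::'p)"
      have "mat_app (*) (D (Suc i)) ?u = D (Suc i) b"
      proof
        fix c
        have "mat_app (*) (D (Suc i)) ?u c = (\<Sum>e\<in>{b}. D (Suc i) e c * (if e = b then 1 else 0))"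
          by (rule self.mat_app_eq_sum) auto
        then show "mat_app (*) (D (Suc i)) ?u c = D (Suc i) b c" by simp
      qed
      moreover have "q (mat_app (*) (D i) (mat_app (*) (D (Suc i)) ?u) c) = \<zero>\<^bsub>R\<^esub>" for c
        by (rule D_boundary_zero) (use b in auto)
      ultimately show "q (mat_app (*) (D i) (D (Suc i) b) c) = \<zero>\<^bsub>R\<^esub>" for c
        by (simp only:)
    qed
  qed
  then interpret L: lifted_complex H J G w D .
  interpret M: lifted_complex_module H J G w D "(*)"
    by (intro lifted_complex_module.intro lc module_mult)
  have exact: "L.acyclic (*) H J i j" if ij: "0 < i \<or> 0 < j" for i j
    unfolding L.acyclic_def
  proof
    fix z assume z: "z \<in> L.cycles (*) H J i j"
    note zH = L.cycles_chains[OF z]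
    note z_fin = chains_fin[OF zH] and z_out = chains_out[OF zH]
    have zm: "(\<lambda>b. q (z b)) \<in> chain_module R F i" by (rule chain_moduleI[OF z_fin z_out])
    have "(\<lambda>b. q (z b)) \<in> bd F i ` chain_module R F (Suc i)"
    proof (cases i)
      case 0
      then have "(\<lambda>b. q (z b)) \<in> chain_component R A F 0 j" using zH by (simp add: free_component_R)
      then have "aug F (\<lambda>b. q (z b)) = \<zero>\<^bsub>residue_ring R A\<^esub>" using aug_component ij 0 by blast
      then show ?thesis using aug_kernel zm unfolding 0 by auto
    next
      case (Suc k)
      have "mat_app (*) (D k) z \<in> tensor k J j" using z unfolding Suc L.cycles_Suc by simp
      from chains_ideal_zero[OF this] have "bd F k (\<lambda>b. q (z b)) = vzero R"
        using bd_lift[OF z_fin, of k] z_out Suc by (simp add: vzero_def)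
      then show ?thesis using bd_kernel[of k] zm unfolding Suc by blast
    qed
    from lift_boundary[OF zH this] show "\<exists>y\<in>tensor (Suc i) H j.
        (\<lambda>b. z b - mat_app (*) (D i) y b) \<in> tensor i J j" .
  qed
  have tor_acyclic: "L.acyclic (*) H positive_part i j" if ij: "i \<noteq> j" for i j
    unfolding L.acyclic_def
  proof
    fix z assume z: "z \<in> L.cycles (*) H positive_part i j"
    note zH = L.cycles_chains[OF z]
    have red: "reduces_to_zero R A (\<lambda>b. q (y b))" if y: "y \<in> chains B u positive_part k" for y B u k
      unfolding reduces_to_zero_def
    proof
      fix b
      show "q (y b) \<in> irr"
      proof (cases "y b = 0")
        case False
        have "y b \<in> positive_part (k - u b)" using chains_support(3)[OF y False] .
        then have "hc 0 (y b) = 0" using False hc_other by (auto simp: positive_part_def split: if_splits)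
        then show ?thesis by (simp add: q_irr)
      qed (simp add: q_irr hc_zero)
    qed
    have "(\<lambda>b. q (z b)) \<in> tor_cycles R A F i j"
      unfolding tor_cycles_def
    proof (intro CollectI conjI)
      show "(\<lambda>b. q (z b)) \<in> chain_component R A F i j" using zH by (simp add: free_component_R)
      show "case i of 0 \<Rightarrow> True | Suc i' \<Rightarrow> reduces_to_zero R A (bd F i' (\<lambda>b. q (z b)))"
      proof (cases i)
        case (Suc k)
        have "mat_app (*) (D k) z \<in> tensor k positive_part j"
          using z unfolding Suc L.cycles_Suc by simp
        from red[OF this] show ?thesis
          using bd_lift[OF chains_fin[OF zH], of k] chains_out[OF zH] Suc by simp
      qed simp
    qed
    then have "(\<lambda>b. q (z b)) \<in> tor_boundaries R A F i j" using trivial_TorD[OF tor[OF ij]] by blast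
    then obtain y' v where y': "y' \<in> chain_component R A F (Suc i) j"
        and v: "(\<lambda>b. q (z b)) = vadd R (bd F i y') v" "v \<in> chain_component R A F i j" "reduces_to_zero R A v"
      unfolding tor_boundaries_def by blast
    from y' obtain y where y: "y' = (\<lambda>b. q (y b))" "y \<in> tensor (Suc i) H j"
      by (auto simp: free_component_R)
    from v(2) obtain x where x: "v = (\<lambda>b. q (x b))" by (auto simp: free_component_R)
    let ?dy = "mat_app (*) (D i) y"
    have "q (z b) = q (?dy b + x b)" for b
      using fun_cong[OF v(1), of b]
      by (simp add: y(1) x bd_lift[OF chains_fin[OF y(2)] chains_out[OF y(2)]] vadd_q)
    then have "hc 0 (z b - ?dy b) = hc 0 (x b)" for b
      using ideal_of_hc_0[of "z b - (?dy b + x b)"] by (simp add: q_eq hc_diff hc_add algebra_simps)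
    moreover have "hc 0 (x b) = 0" for b using v(3) by (simp add: reduces_to_zero_def x q_irr)
    ultimately have zdy: "hc 0 (z b - ?dy b) = 0" for b by simp
    have zdyH: "(\<lambda>b. z b - ?dy b) \<in> tensor i H j"
      by (rule chains_diff[OF H_pieces zH M.boundary_chains[OF graded_submodule_H y(2)]])
    have "(\<lambda>b. z b - ?dy b) \<in> tensor i positive_part j"
    proof (rule chainsI[OF chains_fin[OF zdyH]])
      fix b assume b: "b \<in> G i" "w i b \<le> j"
      then show "z b - ?dy b \<in> positive_part (j - w i b)"
        using chains_in[OF zdyH b] zdy[of b] hc_same[of "z b - ?dy b" 0]
        by (cases "w i b = j") (auto simp: positive_part_def)
    qed (use chains_support[OF zdyH] in blast)
    with y(2) show "\<exists>y\<in>tensor (Suc i) H j.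
        (\<lambda>b. z b - mat_app (*) (D i) y b) \<in> tensor i positive_part j" by blast
  qed
  have eps_D: "mat_app (*) eps_mat (D 0 b) () = 0" if b: "b \<in> G 1" "w 1 b = 0" for b
  proof -
    have b': "b \<in> G (Suc 0)" using b by simp
    have "bd F 0 (unit b) \<in> {x \<in> chain_module R F 0. aug F x = \<zero>\<^bsub>residue_ring R A\<^esub>}"
      using aug_kernel unit_module[OF b(1)] by simp
    then have "aug F (\<lambda>c. q (D 0 b c)) = \<zero>\<^bsub>residue_ring R A\<^esub>" using D_lift(2)[OF b'] by simp
    then have "hc 0 (mat_app (*) eps_mat (D 0 b) ()) = 0"
      using aug_lift[OF chains_fin[OF D_lift(1)[OF b']] chains_out[OF D_lift(1)[OF b']]]
      by (simp add: \<kappa>_eq_zero)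
    moreover have "mat_app (*) eps_mat (D 0 b) () \<in> H 0"
      unfolding mat_app_def
    proof (rule additive_pieces_sum[OF H_pieces])
      fix c assume "c \<in> {c. D 0 b c \<noteq> 0}"
      then have "D 0 b c \<noteq> 0" by simp
      from chains_support[OF D_lift(1)[OF b'] this] have "D 0 b c \<in> H 0" using b by simp
      then show "eps c * D 0 b c \<in> H 0" using H_mult[OF eps_H] by fastforce
    qed
    ultimately show ?thesis using hc_same by metis
  qed
  have "\<kappa> 1 \<in> aug F ` chain_module R F 0" using aug_image carrier_residue by blast
  then obtain y where y: "finite {b. y b \<noteq> 0}" "\<And>b. b \<notin> G 0 \<Longrightarrow> y b = 0"
      and eq: "\<kappa> 1 = aug F (\<lambda>b. q (y b))"
    unfolding free_module_R by auto
  have "hc 0 (mat_app (*) eps_mat y ()) = 1"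
    using eq aug_lift[OF y] by (simp add: \<kappa>_eq hc_same[OF H_one])
  moreover have "hc_chain (\<lambda>_. 0) 0 (mat_app (*) eps_mat y) = mat_app (*) eps_mat (hc_chain (w 0) 0 y)"
    by (rule hc_chain_mat_app[OF eps_chains y])
  ultimately have e0: "mat_app (*) eps_mat (hc_chain (w 0) 0 y) () = 1"
    by (metis (no_types, lifting) hc_chain_def diff_zero le_refl)
  have "lifted_resolution H J G w D eps (hc_chain (w 0) 0 y)"
    by (intro lifted_resolution.intro lifted_resolution_axioms.intro lc exact tor_acyclic eps_H eps_degree
        eps_D hc_chain_in y e0)
  then show ?thesis by (rule exI[of "lifted_resolution H J G w D eps"])
qed

end

lemma (in homogeneous_ideal) koszul_algebra_lifts:
  assumes "koszul_algebra R A"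
  obtains G w D eps e0 where
    "lifted_resolution H J (G :: nat \<Rightarrow> 'p set list set) w D eps e0"
proof -
  from assms obtain F :: "('p set, 'p set list) free_complex" where
    res: "graded_free_resolution R A F" and tor: "\<And>i j. i \<noteq> j \<Longrightarrow> trivial_group (Tor R A F i j)"
    unfolding koszul_algebra_def by blast
  interpret residue_field_resolution H hc J F by unfold_locales (rule res)
  from lifts_to_resolution[OF tor] that show thesis by blast
qed

section \<open>Free resolutions from lifted data\<close>

lemma (in comm_group) trivial_group_Mod_carrier: "trivial_group (G Mod carrier G)"
proof -
  have norm: "carrier G \<lhd> G" using normal_iff_subgroup subgroup_self by blast
  have "carrier G #> x = carrier G" if "x \<in> carrier G" for x
    using coset_join2[OF that subgroup_self that] .
  then have "carrier (G Mod carrier G) = {\<one>\<^bsub>G Mod carrier G\<^esub>}"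
    using one_closed by (force simp: FactGroup_def RCOSETS_def)
  then show ?thesis using normal.factorgroup_is_group[OF norm] by (simp add: trivial_group_def)
qed

lemma lincomb_eq_mat_app:
  assumes "finite T" "\<And>b. b \<notin> T \<Longrightarrow> z b = 0"
  shows "lincomb T E z = mat_app (*) E z"
proof
  fix c
  have "mat_app (*) E z c = (\<Sum>b\<in>T. E b c * z b)"
    by (rule self.mat_app_eq_sum[OF assms(1)]) (use assms(2) in blast)
  then show "lincomb T E z c = mat_app (*) E z c" by (simp add: lincomb_apply mult.commute)
qed

lemma lincomb_lincomb:
  "lincomb T E (lincomb T' E' z) = (\<Sum>e\<in>T'. fun_scale (z e) (lincomb T E (E' e)))"
proof
  fix c
  have "lincomb T E (lincomb T' E' z) c = (\<Sum>b\<in>T. \<Sum>e\<in>T'. z e * (E' e b * E b c))"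
    by (simp add: lincomb_apply sum_distrib_right mult.assoc)
  also have "\<dots> = (\<Sum>e\<in>T'. \<Sum>b\<in>T. z e * (E' e b * E b c))" by (rule sum.swap)
  also have "\<dots> = (\<Sum>e\<in>T'. fun_scale (z e) (lincomb T E (E' e))) c"
    by (simp add: fun_sum_apply fun_scale_def lincomb_apply sum_distrib_left)
  finally show "lincomb T E (lincomb T' E' z) c = \<dots>" .
qed

lemma lincomb_sum: "lincomb T E (\<Sum>j\<in>K. f j) = (\<Sum>j\<in>K. lincomb T E (f j))"
  by (induction K rule: infinite_finite_induct) 
    (simp_all only: sum.infinite sum.empty sum.insert lincomb_zero lincomb_add not_False_eq_True)

context graded_decomposition
begin

lemma hc_chain_sum:
  assumes "finite {b. z b \<noteq> 0}"
  obtains M where "(\<Sum>j\<le>M. hc_chain (\<lambda>_. m) j z) = z"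
proof -
  have "finite (\<Union>b\<in>{b. z b \<noteq> 0}. {d. hc d (z b) \<noteq> 0})" using assms hc_fin by blast
  then obtain N where N: "\<forall>d\<in>(\<Union>b\<in>{b. z b \<noteq> 0}. {d. hc d (z b) \<noteq> 0}). d \<le> N"
    unfolding finite_nat_set_iff_bounded_le by blast
  have hc0: "hc d (z b) = 0" if "N < d" for d b
    using N that hc_zero by (cases "z b = 0") (auto simp: not_le[symmetric])
  have "(\<Sum>j\<le>N + m. hc_chain (\<lambda>_. m) j z) b = z b" for b
  proof -
    have "(\<Sum>j\<le>N + m. hc_chain (\<lambda>_. m) j z) b = (\<Sum>j\<le>N + m. if m \<le> j then hc (j - m) (z b) else 0)"
      by (simp add: fun_sum_apply hc_chain_def)
    also have "\<dots> = (\<Sum>j\<in>{m..N + m}. hc (j - m) (z b))"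
      by (rule sum.mono_neutral_cong_right) auto
    also have "\<dots> = (\<Sum>d\<le>N. hc d (z b))"
      by (rule sum.reindex_bij_witness[of _ "\<lambda>d. d + m" "\<lambda>j. j - m"]) auto
    also have "\<dots> = z b" by (rule hc_sum_atMost) (rule hc0)
    finally show ?thesis .
  qed
  then show thesis by (intro that[of "N + m"] ext)
qed

end

context homogeneous_ideal
begin

lemma ideal_of_sum_mult:
  assumes "\<And>b. b \<in> K \<Longrightarrow> f b \<in> ideal_of J"
  shows "(\<Sum>b\<in>K. f b * g b) \<in> ideal_of J"
  by (rule ideal_of_sum[OF J_p]) (use assms ideal_of_mult[OF J_sub] in \<open>simp add: mult.commute\<close>)

text \<open>
  Exactness in each degree implies exactness: a vector is the sum of its homogeneous components, and
  only finitely many of them are nonzero.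
\<close>

lemma assemble_preimage:
  assumes z: "finite {b. z b \<noteq> 0}" and T: "finite T"
    and pieces: "\<And>j. \<exists>y\<in>chains T u H j. hc_chain (\<lambda>_. m) j z - lincomb T E y \<in> chains B (\<lambda>_. m) J j"
  shows "\<exists>y. finite {b. y b \<noteq> 0} \<and> (\<forall>b. b \<notin> T \<longrightarrow> y b = 0) \<and> (\<forall>b. q (z b) = q (lincomb T E y b))"
proof -
  from pieces have "\<forall>j. \<exists>y. y \<in> chains T u H j \<and> hc_chain (\<lambda>_. m) j z - lincomb T E y \<in> chains B (\<lambda>_. m) J j" by blast
  from choice[OF this] obtain y where y: "\<And>j. y j \<in> chains T u H j"
    "\<And>j. hc_chain (\<lambda>_. m) j z - lincomb T E (y j) \<in> chains B (\<lambda>_. m) J j" by blast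
  obtain M where M: "(\<Sum>j\<le>M. hc_chain (\<lambda>_. m) j z) = z" by (rule hc_chain_sum[OF z])
  let ?y = "\<Sum>j\<le>M. y j"
  have out: "?y b = 0" if "b \<notin> T" for b
    using chains_out[OF y(1) that] by (simp add: fun_sum_apply)
  have "z - lincomb T E ?y = (\<Sum>j\<le>M. hc_chain (\<lambda>_. m) j z - lincomb T E (y j))"
    by (simp add: lincomb_sum sum_subtractf M)
  from fun_cong[OF this]
  have "z b - lincomb T E ?y b = (\<Sum>j\<le>M. (hc_chain (\<lambda>_. m) j z - lincomb T E (y j)) b)" for b
    by (simp only: minus_apply fun_sum_apply)
  moreover have "(hc_chain (\<lambda>_. m) j z - lincomb T E (y j)) b \<in> ideal_of J" for j b
    using chains_ideal_zero[OF y(2)] by (simp only: q_eq_zero)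
  ultimately have "z b - lincomb T E ?y b \<in> ideal_of J" for b
    by (simp only: ideal_of_sum[OF J_p])
  then have "q (z b) = q (lincomb T E ?y b)" for b by (simp only: q_eq)
  moreover have "finite {b. ?y b \<noteq> 0}" by (rule finite_subset[OF _ T]) (use out in blast)
  ultimately show ?thesis using out by (intro exI[of _ ?y]) simp
qed

text \<open>
  The matrices \<open>E\<close> define a resolution whose \<open>n\<close>-th module has all its generators in degree \<open>n\<close>.  So an
  element of internal degree \<open>j\<close> in homological degree \<open>i \<noteq> j\<close> has entries of degree \<open>j - i > 0\<close>, or it
  is zero.  In both cases it vanishes after tensoring with \<open>k\<close>, and \<open>Tor\<close> is trivial off the diagonal.
\<close>

lemma koszul_algebra_from_lifts:
  fixes T :: "nat \<Rightarrow> 'p set list set" and E :: "nat \<Rightarrow> 'p set list \<Rightarrow> 'p set list \<Rightarrow> 'p"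
  assumes T0: "T 0 = {b0}" and T_fin: "\<And>n. finite (T n)"
    and E: "\<And>n b. b \<in> T (Suc n) \<Longrightarrow> E n b \<in> chains (T n) (\<lambda>_. n) H (Suc n)"
    and EE: "\<And>n b. b \<in> T (Suc (Suc n)) \<Longrightarrow>
      lincomb (T (Suc n)) (E n) (E (Suc n) b) \<in> chains (T n) (\<lambda>_. n) J (Suc (Suc n))"
    and exact_0: "\<And>j x. x \<in> chains (T 0) (\<lambda>_. 0) positive_part j \<Longrightarrow>
      \<exists>y\<in>chains (T 1) (\<lambda>_. 1) H j. x - lincomb (T 1) (E 0) y \<in> chains (T 0) (\<lambda>_. 0) J j"
    and exact_Suc: "\<And>n j x. x \<in> chains (T (Suc n)) (\<lambda>_. Suc n) H j \<Longrightarrow>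
      lincomb (T (Suc n)) (E n) x \<in> chains (T n) (\<lambda>_. n) J j \<Longrightarrow>
      \<exists>y\<in>chains (T (Suc (Suc n))) (\<lambda>_. Suc (Suc n)) H j.
        x - lincomb (T (Suc (Suc n))) (E (Suc n)) y \<in> chains (T (Suc n)) (\<lambda>_. Suc n) J j"
  shows "koszul_algebra R A"
proof -
  define rp where "rp x = (SOME f. q f = x)" for x
  have q_rp: "q (rp (q f)) = q f" for f
    unfolding rp_def by (rule someI[of "\<lambda>g. q g = q f"]) simp
  define L where "L n = lincomb (T (Suc n)) (E n)" for n
  define F :: "('p set, 'p set list) free_complex" where
    "F = \<lparr>gens = T, gdeg = (\<lambda>n _. n), bd = (\<lambda>n x c. q (L n (\<lambda>b. rp (x b)) c)), aug = (\<lambda>x. \<kappa> (rp (x b0)))\<rparr>"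
  have F [simp]: "gens F = T" "gdeg F = (\<lambda>n _. n)" by (simp_all add: F_def)
  have mod: "x \<in> free_module R (T n) \<longleftrightarrow> (\<exists>z. (\<forall>b. b \<notin> T n \<longrightarrow> z b = 0) \<and> x = (\<lambda>b. q (z b)))" for x n
  proof -
    have "finite {b. z b \<noteq> 0}" if "\<forall>b. b \<notin> T n \<longrightarrow> z b = 0" for z :: "'p set list \<Rightarrow> 'p"
      by (rule finite_subset[OF _ T_fin[of n]]) (use that in blast)
    then show ?thesis unfolding free_module_R by blast
  qed
  \<comment> \<open>The representatives chosen by \<open>rp\<close> do not matter, because the ideal absorbs their differences.\<close>
  have bd_q: "bd F n (\<lambda>b. q (z b)) = (\<lambda>c. q (L n z c))" for n z
  proof
    fix c
    have "rp (q (z b)) - z b \<in> ideal_of J" for b using q_rp[of "z b"] by (simp only: q_eq)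
    then have "(\<Sum>b\<in>T (Suc n). (rp (q (z b)) - z b) * E n b c) \<in> ideal_of J" by (rule ideal_of_sum_mult)
    then have "L n (\<lambda>b. rp (q (z b))) c - L n z c \<in> ideal_of J"
      by (simp add: L_def lincomb_apply left_diff_distrib sum_subtractf)
    then show "bd F n (\<lambda>b. q (z b)) c = q (L n z c)" by (simp add: F_def q_eq)
  qed
  have aug_q: "aug F (\<lambda>b. q (z b)) = \<kappa> (z b0)" for z
  proof -
    have "rp (q (z b0)) - z b0 \<in> ideal_of J" using q_rp[of "z b0"] by (simp only: q_eq)
    from ideal_of_hc_0[OF this] show ?thesis by (simp add: F_def \<kappa>_eq hc_diff)
  qed
  have vadd_q: "vadd R (\<lambda>b. q (x b)) (\<lambda>b. q (y b)) = (\<lambda>b. q (x b + y b))" for x y :: "'p set list \<Rightarrow> 'p"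
    by (simp add: vadd_def q_add)
  have vscale_q: "vscale R (q a) (\<lambda>b. q (x b)) = (\<lambda>b. q (a * x b))" for a and x :: "'p set list \<Rightarrow> 'p"
    by (simp add: vscale_def q_mult)
  have vzero_q: "vzero R = (\<lambda>b. q ((0 :: 'p set list \<Rightarrow> 'p) b))" by (simp add: vzero_def q_zero)
  have zero_component: "(\<lambda>b. q ((0 :: 'p set list \<Rightarrow> 'p) b)) \<in> (\<lambda>z b. q (z b)) ` chains B u H j" for B u j
    by (rule imageI) (simp add: zero_fun_def chains_zero[OF H_pieces])
  have L_out: "L n z c = 0" if "c \<notin> T n" for n z c
    using chains_out[OF E that] by (simp add: L_def lincomb_apply)
  have L_add: "L n (\<lambda>b. x b + y b) = (\<lambda>c. L n x c + L n y c)" for n x y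
    using lincomb_add[of "T (Suc n)" "E n" x y] by (simp add: L_def plus_fun_def)
  have L_scale: "L n (\<lambda>b. a * x b) = (\<lambda>c. a * L n x c)" for n a x
    using lincomb_scale[of "T (Suc n)" "E n" a x] by (simp add: L_def fun_scale_def)
  have L_zero: "L n 0 = 0" for n by (simp add: L_def lincomb_zero)
  have L_mat: "L n z = mat_app (*) (E n) z" if "\<And>b. b \<notin> T (Suc n) \<Longrightarrow> z b = 0" for n z
    unfolding L_def by (rule lincomb_eq_mat_app[OF T_fin that])
  have L_chains: "L n z \<in> chains (T n) (\<lambda>_. n) H j" if z: "z \<in> chains (T (Suc n)) (\<lambda>_. Suc n) H j" for n z j
    using self.mat_app_chains[of "T (Suc n)" "E n" "T n" "\<lambda>_. n" H "\<lambda>_. Suc n" 0 z H j H]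
      E z H_pieces H_mult L_mat[OF chains_out[OF z]] by auto
  have L_L: "L n (L (Suc n) z) c \<in> ideal_of J" for n z c
  proof -
    have "lincomb (T (Suc n)) (E n) (E (Suc n) e) c \<in> ideal_of J" if "e \<in> T (Suc (Suc n))" for e
      using chains_ideal_zero[OF EE[OF that], of c] by (simp only: q_eq_zero)
    then have "(\<Sum>e\<in>T (Suc (Suc n)). lincomb (T (Suc n)) (E n) (E (Suc n) e) c * z e) \<in> ideal_of J"
      by (rule ideal_of_sum_mult)
    then show ?thesis by (simp add: L_def lincomb_lincomb fun_sum_apply fun_scale_def mult.commute)
  qed
  have L_0: "hc 0 (L 0 z b0) = 0" for z
  proof -
    have "E 0 b b0 \<in> H 1" if "b \<in> T (Suc 0)" for b
      using chains_in[OF E[OF that], of b0] T0 by simp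
    then have "hc 0 (E 0 b b0 * z b) = 0" if "b \<in> T (Suc 0)" for b using hc_mult[of _ 1 0] that by simp
    then show ?thesis by (simp add: L_def lincomb_apply hc_setsum mult.commute)
  qed
  have L_mod: "(\<lambda>c. q (L n z c)) \<in> free_module R (T n)" for n z
    unfolding mod using L_out by (intro exI[of _ "L n z"]) simp
  have res: "graded_free_resolution R A F"
    unfolding graded_free_resolution_def
  proof (intro conjI allI ballI impI funcsetI)
    fix i x assume "x \<in> chain_module R F (Suc i)"
    then show "bd F i x \<in> chain_module R F i"
      using mod[of x "Suc i"] L_mod bd_q by auto
  next
    fix i x y assume "x \<in> chain_module R F (Suc i)" "y \<in> chain_module R F (Suc i)"
    then show "bd F i (vadd R x y) = vadd R (bd F i x) (bd F i y)"
      by (auto simp: mod bd_q vadd_q L_add)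
  next
    fix i r x assume "r \<in> carrier R" "x \<in> chain_module R F (Suc i)"
    then show "bd F i (vscale R r x) = vscale R r (bd F i x)"
      by (auto simp: mod bd_q vscale_q L_scale carrier_R)
  next
    fix i j x assume "x \<in> chain_component R A F (Suc i) j"
    then obtain z where "x = (\<lambda>b. q (z b))" "z \<in> chains (T (Suc i)) (\<lambda>_. Suc i) H j"
      by (auto simp: free_component_R)
    then show "bd F i x \<in> chain_component R A F i j"
      using L_chains by (auto simp: free_component_R bd_q)
  next
    fix x y assume "x \<in> chain_module R F 0" "y \<in> chain_module R F 0"
    then show "aug F (vadd R x y) = aug F x \<oplus>\<^bsub>residue_ring R A\<^esub> aug F y"
      by (auto simp: mod aug_q vadd_q \<kappa>_add)
  next
    fix r x assume "r \<in> carrier R" "x \<in> chain_module R F 0"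
    then show "aug F (vscale R r x) = (irr +>\<^bsub>R\<^esub> r) \<otimes>\<^bsub>residue_ring R A\<^esub> aug F x"
      by (auto simp: mod aug_q vscale_q \<kappa>_mult carrier_R)
  next
    fix j x assume "0 < (j::nat)" and "x \<in> chain_component R A F 0 j"
    then obtain z where "x = (\<lambda>b. q (z b))" and z: "z \<in> chains (T 0) (\<lambda>_. 0) H j"
      by (auto simp: free_component_R)
    moreover have "hc 0 (z b0) = 0"
      using chains_in[OF z, of b0] hc_other[of "z b0" j 0] T0 \<open>0 < j\<close> by simp
    ultimately show "aug F x = \<zero>\<^bsub>residue_ring R A\<^esub>" by (simp add: aug_q \<kappa>_eq_zero)
  next
    show "aug F ` chain_module R F 0 = carrier (residue_ring R A)"
    proof
      show "aug F ` chain_module R F 0 \<subseteq> carrier (residue_ring R A)"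
        by (auto simp: mod aug_q carrier_residue)
      show "carrier (residue_ring R A) \<subseteq> aug F ` chain_module R F 0"
      proof
        fix k assume "k \<in> carrier (residue_ring R A)"
        then obtain f where "k = \<kappa> f" by (auto simp: carrier_residue)
        then have "k = aug F (\<lambda>b. q ((\<lambda>b. if b = b0 then f else 0) b))" by (subst aug_q) simp
        moreover have "(\<lambda>b. q ((\<lambda>b. if b = b0 then f else 0) b)) \<in> chain_module R F 0"
          unfolding F mod using T0 by (intro exI[of _ "\<lambda>b. if b = b0 then f else 0"]) simp
        ultimately show "k \<in> aug F ` chain_module R F 0" by blast
      qed
    qed
  next
    show "{x \<in> chain_module R F 0. aug F x = \<zero>\<^bsub>residue_ring R A\<^esub>} = bd F 0 ` chain_module R F 1"
    proof (intro equalityI subsetI)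
      fix x assume "x \<in> bd F 0 ` chain_module R F 1"
      then obtain z where "x = (\<lambda>c. q (L 0 z c))" using mod[of _ "Suc 0"] by (auto simp: bd_q)
      then show "x \<in> {x \<in> chain_module R F 0. aug F x = \<zero>\<^bsub>residue_ring R A\<^esub>}"
        using L_mod[of 0] L_0 by (simp add: aug_q \<kappa>_eq_zero)
    next
      fix x assume "x \<in> {x \<in> chain_module R F 0. aug F x = \<zero>\<^bsub>residue_ring R A\<^esub>}"
      then have xm: "x \<in> free_module R (T 0)" and ax: "aug F x = \<zero>\<^bsub>residue_ring R A\<^esub>" by auto
      from xm obtain z where z: "\<And>b. b \<notin> T 0 \<Longrightarrow> z b = 0" and x: "x = (\<lambda>b. q (z b))"
        unfolding mod by blast
      have z0: "hc 0 (z b0) = 0" using ax unfolding x aug_q by (simp only: \<kappa>_eq_zero)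
      have fin: "finite {b. z b \<noteq> 0}" by (rule finite_subset[OF _ T_fin[of 0]]) (use z in blast)
      have "\<exists>y\<in>chains (T 1) (\<lambda>_. 1) H j. hc_chain (\<lambda>_. 0) j z - lincomb (T 1) (E 0) y \<in> chains (T 0) (\<lambda>_. 0) J j" for j
      proof (rule exact_0)
        have zj: "hc_chain (\<lambda>_. 0) j z \<in> chains (T 0) (\<lambda>_. 0) H j" by (rule hc_chain_in[OF fin z])
        show "hc_chain (\<lambda>_. 0) j z \<in> chains (T 0) (\<lambda>_. 0) positive_part j"
          by (rule chainsI[OF chains_fin[OF zj]])
            (use z0 T0 z in \<open>auto simp: hc_chain_def positive_part_def hc_in hc_zero\<close>)
      qed
      from assemble_preimage[OF fin T_fin this] obtain y where y: "\<And>b. b \<notin> T 1 \<Longrightarrow> y b = 0"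
        "\<And>b. q (z b) = q (lincomb (T 1) (E 0) y b)" by blast
      have "x = bd F 0 (\<lambda>b. q (y b))" by (simp add: x bd_q y(2) L_def)
      moreover have "(\<lambda>b. q (y b)) \<in> chain_module R F 1" unfolding F mod using y(1) by blast
      ultimately show "x \<in> bd F 0 ` chain_module R F 1" by blast
    qed
  next
    fix i
    show "{x \<in> chain_module R F (Suc i). bd F i x = vzero R} = bd F (Suc i) ` chain_module R F (Suc (Suc i))"
    proof (intro equalityI subsetI)
      fix x assume "x \<in> bd F (Suc i) ` chain_module R F (Suc (Suc i))"
      then obtain z where "x = (\<lambda>c. q (L (Suc i) z c))" by (auto simp: mod bd_q)
      moreover have "q (L i (L (Suc i) z) c) = \<zero>\<^bsub>R\<^esub>" for c using L_L by (simp only: q_eq_zero)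
      ultimately show "x \<in> {x \<in> chain_module R F (Suc i). bd F i x = vzero R}"
        using L_mod[of "Suc i" z] by (simp add: bd_q vzero_def)
    next
      fix x assume "x \<in> {x \<in> chain_module R F (Suc i). bd F i x = vzero R}"
      then have xm: "x \<in> free_module R (T (Suc i))" and bx: "bd F i x = vzero R" by auto
      from xm obtain z where z: "\<And>b. b \<notin> T (Suc i) \<Longrightarrow> z b = 0" and x: "x = (\<lambda>b. q (z b))"
        unfolding mod by blast
      have dz: "q (L i z c) = \<zero>\<^bsub>R\<^esub>" for c
        using fun_cong[OF bx, of c] unfolding x bd_q vzero_def .
      have fin: "finite {b. z b \<noteq> 0}" by (rule finite_subset[OF _ T_fin[of "Suc i"]]) (use z in blast)
      have "\<exists>y\<in>chains (T (Suc (Suc i))) (\<lambda>_. Suc (Suc i)) H j.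
          hc_chain (\<lambda>_. Suc i) j z - lincomb (T (Suc (Suc i))) (E (Suc i)) y \<in> chains (T (Suc i)) (\<lambda>_. Suc i) J j" for j
      proof (rule exact_Suc)
        show zj: "hc_chain (\<lambda>_. Suc i) j z \<in> chains (T (Suc i)) (\<lambda>_. Suc i) H j" by (rule hc_chain_in[OF fin z])
        have "finite {c. L i z c \<noteq> 0}" by (rule finite_subset[OF _ T_fin[of i]]) (use L_out in blast)
        from hc_chain_ideal[OF this L_out dz]
        have "hc_chain (\<lambda>_. i) j (L i z) \<in> chains (T i) (\<lambda>_. i) J j" .
        also have "hc_chain (\<lambda>_. i) j (L i z) = mat_app (*) (E i) (hc_chain (\<lambda>_. Suc i) j z)"
        proof -
          have "L i z = mat_app (*) (E i) z" by (rule L_mat) (rule z)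
          moreover have "hc_chain (\<lambda>_. i) j (mat_app (*) (E i) z) = mat_app (*) (E i) (hc_chain (\<lambda>_. Suc i) j z)"
            by (rule hc_chain_mat_app[of "T (Suc i)" _ "T i"]) (use E fin z in auto)
          ultimately show ?thesis by simp
        qed
        also have "mat_app (*) (E i) (hc_chain (\<lambda>_. Suc i) j z) = L i (hc_chain (\<lambda>_. Suc i) j z)"
          by (rule L_mat[symmetric]) (rule chains_out[OF zj])
        finally show "lincomb (T (Suc i)) (E i) (hc_chain (\<lambda>_. Suc i) j z) \<in> chains (T i) (\<lambda>_. i) J j"
          unfolding L_def .
      qed
      from assemble_preimage[OF fin T_fin this] obtain y where y: "\<And>b. b \<notin> T (Suc (Suc i)) \<Longrightarrow> y b = 0"
        "\<And>b. q (z b) = q (lincomb (T (Suc (Suc i))) (E (Suc i)) y b)" by blast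
      have "x = bd F (Suc i) (\<lambda>b. q (y b))" by (simp add: x bd_q y(2) L_def)
      moreover have "(\<lambda>b. q (y b)) \<in> chain_module R F (Suc (Suc i))" unfolding F mod using y(1) by blast
      ultimately show "x \<in> bd F (Suc i) ` chain_module R F (Suc (Suc i))" by blast
    qed
  qed
  have "trivial_group (Tor R A F i j)" if ij: "i \<noteq> j" for i j
  proof -
    let ?C = "chain_component R A F i j"
    have C: "?C = (\<lambda>z b. q (z b)) ` chains (T i) (\<lambda>_. i) H j" by (simp add: free_component_R)
    have zero: "z = 0" if "z \<in> chains (T k) (\<lambda>_. k) H j" "j < k" for z k
      using chains_out'[OF that(1)] that(2) by (intro ext) simp
    have red: "reduces_to_zero R A (\<lambda>b. q (z b))" if z: "z \<in> chains (T k) (\<lambda>_. k) H j" "k \<noteq> j" for z k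
      unfolding reduces_to_zero_def q_irr
    proof
      fix b
      show "hc 0 (z b) = 0"
      proof (cases "z b = 0")
        case False
        from chains_support[OF z(1) this] z(2) show ?thesis using hc_other by simp
      qed (simp add: hc_zero)
    qed
    \<comment> \<open>Off the diagonal every chain is a cycle and a boundary modulo the irrelevant ideal.\<close>
    have cyc: "tor_cycles R A F i j = ?C"
    proof -
      have "reduces_to_zero R A (bd F k x)" if x: "x \<in> ?C" and i: "i = Suc k" for x k
      proof -
        from x obtain z where z: "x = (\<lambda>b. q (z b))" "z \<in> chains (T (Suc k)) (\<lambda>_. Suc k) H j"
          unfolding C by (auto simp: i)
        show ?thesis
        proof (cases "j < Suc k")
          case True
          then have "L k z = 0" using zero[OF z(2)] L_zero by simp
          then show ?thesis by (simp add: z(1) bd_q reduces_to_zero_def q_irr hc_zero)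
        next
          case False
          then show ?thesis using red[OF L_chains[OF z(2)]] by (simp add: z(1) bd_q)
        qed
      qed
      then have "case i of 0 \<Rightarrow> True | Suc k \<Rightarrow> reduces_to_zero R A (bd F k x)" if "x \<in> ?C" for x
        using that by (cases i) simp_all
      then show ?thesis unfolding tor_cycles_def by blast
    qed
    have bnd: "tor_boundaries R A F i j = ?C"
    proof (intro equalityI subsetI)
      fix x assume "x \<in> tor_boundaries R A F i j"
      then obtain y z where x: "x = vadd R (bd F i y) z" and y: "y \<in> chain_component R A F (Suc i) j" and z: "z \<in> ?C"
        unfolding tor_boundaries_def by blast
      from y obtain y' where y': "y = (\<lambda>b. q (y' b))" "y' \<in> chains (T (Suc i)) (\<lambda>_. Suc i) H j"
        by (auto simp: free_component_R)
      from z obtain z' where z': "z = (\<lambda>b. q (z' b))" "z' \<in> chains (T i) (\<lambda>_. i) H j" unfolding C by blast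
      have "x = (\<lambda>b. q (L i y' b + z' b))" by (simp add: x y' z' bd_q vadd_q)
      then show "x \<in> ?C" unfolding C using chains_add[OF H_pieces L_chains[OF y'(2)] z'(2)] by (rule image_eqI)
    next
      fix x assume x: "x \<in> ?C"
      then obtain z where z: "x = (\<lambda>b. q (z b))" "z \<in> chains (T i) (\<lambda>_. i) H j" unfolding C by blast
      have "x = vadd R (bd F i (\<lambda>b. q ((0 :: 'p set list \<Rightarrow> 'p) b))) x"
        unfolding z(1) bd_q L_zero vadd_q by simp
      moreover have "(\<lambda>b. q ((0 :: 'p set list \<Rightarrow> 'p) b)) \<in> chain_component R A F (Suc i) j"
        unfolding free_component_R by (rule zero_component)
      moreover have "reduces_to_zero R A x" using red[OF z(2) ij] z(1) by simp
      ultimately show "x \<in> tor_boundaries R A F i j" using x unfolding tor_boundaries_def by blast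
    qed
    let ?G = "\<lparr>carrier = ?C, monoid.mult = vadd R, one = vzero R\<rparr>"
    have "comm_group ?G"
    proof (rule comm_groupI)
      show "\<one>\<^bsub>?G\<^esub> \<in> carrier ?G" using zero_component[of "T i" "\<lambda>_. i" j] by (simp only: partial_object.simps monoid.simps C vzero_q)
      show "x \<otimes>\<^bsub>?G\<^esub> y \<in> carrier ?G" if "x \<in> carrier ?G" "y \<in> carrier ?G" for x y
      proof -
        from that obtain z z' where "x = (\<lambda>b. q (z b))" "y = (\<lambda>b. q (z' b))"
          "z \<in> chains (T i) (\<lambda>_. i) H j" "z' \<in> chains (T i) (\<lambda>_. i) H j" by (auto simp: free_component_R)
        then show ?thesis
          using imageI[OF chains_add[OF H_pieces, of z "T i" "\<lambda>_. i" j z'], of "\<lambda>z b. q (z b)"]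
          by (simp add: free_component_R vadd_q)
      qed
      show "x \<otimes>\<^bsub>?G\<^esub> y \<otimes>\<^bsub>?G\<^esub> z = x \<otimes>\<^bsub>?G\<^esub> (y \<otimes>\<^bsub>?G\<^esub> z)"
        if "x \<in> carrier ?G" "y \<in> carrier ?G" "z \<in> carrier ?G" for x y z
        using that by (auto simp: free_component_R vadd_q add.assoc)
      show "x \<otimes>\<^bsub>?G\<^esub> y = y \<otimes>\<^bsub>?G\<^esub> x" if "x \<in> carrier ?G" "y \<in> carrier ?G" for x y
        using that by (auto simp: free_component_R vadd_q add.commute)
      show "\<one>\<^bsub>?G\<^esub> \<otimes>\<^bsub>?G\<^esub> x = x" if "x \<in> carrier ?G" for x
        using that by (auto simp: free_component_R vzero_q vadd_q)
      show "\<exists>y\<in>carrier ?G. y \<otimes>\<^bsub>?G\<^esub> x = \<one>\<^bsub>?G\<^esub>" if x: "x \<in> carrier ?G" for x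
      proof -
        from x obtain z where z: "x = (\<lambda>b. q (z b))" "z \<in> chains (T i) (\<lambda>_. i) H j" by (auto simp: free_component_R)
        have "(\<lambda>b. q (- z b)) \<in> carrier ?G" using chains_uminus[OF H_pieces z(2)] by (auto simp: free_component_R)
        moreover have "(\<lambda>b. q (- z b)) \<otimes>\<^bsub>?G\<^esub> x = \<one>\<^bsub>?G\<^esub>" by (simp add: z(1) vadd_q vzero_q)
        ultimately show ?thesis by blast
      qed
    qed
    from comm_group.trivial_group_Mod_carrier[OF this] show ?thesis
      by (simp add: Tor_def cyc bnd)
  qed
  with res show ?thesis unfolding koszul_algebra_def by blast
qed

end

section \<open>The graded algebra of polynomials\<close>

definition total_degree :: "('n::finite \<Rightarrow>\<^sub>0 nat) \<Rightarrow> nat" where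
  "total_degree m = (\<Sum>i\<in>UNIV. Poly_Mapping.lookup m i)"

lemma total_degree_add: "total_degree (m + m') = total_degree m + total_degree m'"
  by (simp add: total_degree_def lookup_add sum.distrib)

lemma total_degree_eq_0: "total_degree m = 0 \<longleftrightarrow> m = 0"
  by (auto simp: total_degree_def intro: poly_mapping_eqI)

lemma total_degree_single: "total_degree (Poly_Mapping.single i n) = n"
  by (simp add: total_degree_def lookup_single when_def)

lemma forms_iff: "f \<in> forms d \<longleftrightarrow> (\<forall>m. Poly_Mapping.lookup f m \<noteq> 0 \<longrightarrow> total_degree m = d)"
  by (auto simp: forms_def total_degree_def in_keys_iff)

lemma forms_mult:
  assumes "f \<in> forms d" "g \<in> forms e"
  shows "f * g \<in> forms (d + e)"
proof -
  have "total_degree m = d + e" if "m \<in> Poly_Mapping.keys (f * g)" for m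
  proof -
    from that obtain a b where "a \<in> Poly_Mapping.keys f" "b \<in> Poly_Mapping.keys g" "m = a + b"
      using keys_mult[of f g] by blast
    then show ?thesis using assms by (simp add: forms_def total_degree_add flip: total_degree_def)
  qed
  then show ?thesis by (simp add: forms_def total_degree_def)
qed

lemma poly_sum_monomials:
  "f = (\<Sum>m\<in>Poly_Mapping.keys f. Poly_Mapping.single m (Poly_Mapping.lookup f m))"
  by (rule poly_mapping_eqI)
    (auto simp: lookup_sum lookup_single when_def sum.delta in_keys_iff)

definition homogeneous_component :: "nat \<Rightarrow> ('k::field, 'n::finite) mpoly \<Rightarrow> ('k, 'n) mpoly" where
  "homogeneous_component d f =
     (\<Sum>m\<in>{m \<in> Poly_Mapping.keys f. total_degree m = d}. Poly_Mapping.single m (Poly_Mapping.lookup f m))"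

lemma lookup_homogeneous_component:
  "Poly_Mapping.lookup (homogeneous_component d f) m = (if total_degree m = d then Poly_Mapping.lookup f m else 0)"
  by (auto simp: homogeneous_component_def lookup_sum lookup_single when_def sum.delta in_keys_iff)

definition monomial_value :: "('n::finite \<Rightarrow>\<^sub>0 nat) \<Rightarrow> 'k::field ^ 'n \<Rightarrow> 'k" where
  "monomial_value m v = (\<Prod>i\<in>UNIV. (v $ i) ^ Poly_Mapping.lookup m i)"

lemma eval_poly_eq_sum:
  assumes "finite K" "Poly_Mapping.keys f \<subseteq> K"
  shows "eval_poly f v = (\<Sum>m\<in>K. Poly_Mapping.lookup f m * monomial_value m v)"
  unfolding eval_poly_def monomial_value_def
  by (rule sum.mono_neutral_left) (use assms in \<open>auto simp: in_keys_iff\<close>)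

lemma eval_poly_add: "eval_poly (f + g) v = eval_poly f v + eval_poly g v"
proof -
  let ?K = "Poly_Mapping.keys f \<union> Poly_Mapping.keys g"
  have "finite ?K" "Poly_Mapping.keys (f + g) \<subseteq> ?K" using keys_add[of f g] by simp_all
  then show ?thesis by (simp add: eval_poly_eq_sum[of ?K] lookup_add distrib_right sum.distrib)
qed

lemma eval_poly_zero: "eval_poly 0 v = 0"
  by (simp add: eval_poly_def)

lemma eval_poly_uminus: "eval_poly (- f) v = - eval_poly f v"
  using eval_poly_add[of f "- f" v] by (simp add: eval_poly_zero add_eq_0_iff)

lemma eval_poly_diff: "eval_poly (f - g) v = eval_poly f v - eval_poly g v"
  using eval_poly_add[of f "- g" v] by (simp add: eval_poly_uminus)

lemma eval_poly_sum: "eval_poly (\<Sum>b\<in>K. f b) v = (\<Sum>b\<in>K. eval_poly (f b) v)"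
  by (induction K rule: infinite_finite_induct) (simp_all add: eval_poly_zero eval_poly_add)

lemma eval_poly_single: "eval_poly (Poly_Mapping.single m c) v = c * monomial_value m v"
  by (subst eval_poly_eq_sum[of "{m}"]) auto

lemma eval_poly_mult: "eval_poly (f * g) v = eval_poly f v * eval_poly g v"
proof -
  let ?f = "\<lambda>m. Poly_Mapping.single m (Poly_Mapping.lookup f m)"
  let ?g = "\<lambda>m. Poly_Mapping.single m (Poly_Mapping.lookup g m)"
  have "f * g = (\<Sum>m\<in>Poly_Mapping.keys f. ?f m) * (\<Sum>m\<in>Poly_Mapping.keys g. ?g m)"
    using poly_sum_monomials[of f] poly_sum_monomials[of g] by simp
  also have "\<dots> = (\<Sum>a\<in>Poly_Mapping.keys f. \<Sum>b\<in>Poly_Mapping.keys g. ?f a * ?g b)"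
    by (rule sum_product)
  finally have "eval_poly (f * g) v = (\<Sum>a\<in>Poly_Mapping.keys f. \<Sum>b\<in>Poly_Mapping.keys g. eval_poly (?f a * ?g b) v)"
    by (simp only: eval_poly_sum)
  also have "\<dots> = (\<Sum>a\<in>Poly_Mapping.keys f. \<Sum>b\<in>Poly_Mapping.keys g. eval_poly (?f a) v * eval_poly (?g b) v)"
    by (intro sum.cong refl)
      (simp add: mult_single eval_poly_single monomial_value_def lookup_add power_add prod.distrib)
  also have "\<dots> = eval_poly f v * eval_poly g v"
    by (simp add: sum_product[symmetric] eval_poly_sum[symmetric] flip: poly_sum_monomials)
  finally show ?thesis .
qed

lemma eval_poly_scaled:
  assumes "f \<in> forms d"
  shows "eval_poly f (c *s v) = c ^ d * eval_poly f v"
proof -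
  have "monomial_value m (c *s v) = c ^ total_degree m * monomial_value m v" for m
    by (simp add: monomial_value_def total_degree_def power_mult_distrib prod.distrib power_sum)
  moreover have "total_degree m = d" if "m \<in> Poly_Mapping.keys f" for m
    using assms that by (simp add: forms_def total_degree_def)
  ultimately show ?thesis
    by (simp add: eval_poly_eq_sum[OF _ subset_refl] sum_distrib_left mult.left_commute)
qed

definition constant_poly :: "'k::field \<Rightarrow> ('k, 'n::finite) mpoly" where
  "constant_poly c = Poly_Mapping.single 0 c"

definition coordinate :: "'n::finite \<Rightarrow> ('k::field, 'n) mpoly" where
  "coordinate i = Poly_Mapping.single (Poly_Mapping.single i 1) 1"

lemma eval_constant_poly: "eval_poly (constant_poly c) v = c"
  by (simp add: constant_poly_def eval_poly_single monomial_value_def)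

lemma eval_coordinate: "eval_poly (coordinate i) v = v $ i"
proof -
  have "monomial_value (Poly_Mapping.single i 1) v = (\<Prod>j\<in>UNIV. if j = i then v $ i else 1)"
    unfolding monomial_value_def by (rule prod.cong) (auto simp: lookup_single when_def)
  then show ?thesis by (simp add: coordinate_def eval_poly_single)
qed

lemma forms_0: "forms 0 = range (constant_poly :: 'k \<Rightarrow> ('k::field, 'n::finite) mpoly)"
proof (intro equalityI subsetI)
  fix f :: "('k, 'n) mpoly" assume f: "f \<in> forms 0"
  have "f = constant_poly (Poly_Mapping.lookup f 0)"
  proof (rule poly_mapping_eqI)
    fix m
    show "Poly_Mapping.lookup f m = Poly_Mapping.lookup (constant_poly (Poly_Mapping.lookup f 0)) m"
      using f by (cases "m = 0") (auto simp: constant_poly_def lookup_single when_def forms_iff total_degree_eq_0)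
  qed
  then show "f \<in> range constant_poly" by blast
qed (auto simp: forms_iff constant_poly_def lookup_single when_def total_degree_eq_0 split: if_splits)

lemma coordinate_form: "coordinate i \<in> forms 1"
  by (simp add: coordinate_def forms_def flip: total_degree_def) (simp add: total_degree_single)

lemma total_degree_1:
  assumes "total_degree m = 1"
  obtains i where "m = Poly_Mapping.single i 1"
proof -
  from assms obtain i where i: "Poly_Mapping.lookup m i \<noteq> 0"
    unfolding total_degree_def by (metis sum.neutral zero_neq_one)
  have split: "total_degree m = Poly_Mapping.lookup m i + (\<Sum>j\<in>UNIV - {i}. Poly_Mapping.lookup m j)"
    unfolding total_degree_def by (rule sum.remove) auto
  with assms i have mi: "Poly_Mapping.lookup m i = 1" and "(\<Sum>j\<in>UNIV - {i}. Poly_Mapping.lookup m j) = 0" by linarith+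
  then have "Poly_Mapping.lookup m j = 0" if "j \<noteq> i" for j using that by simp
  then have "m = Poly_Mapping.single i 1"
    using mi by (intro poly_mapping_eqI) (auto simp: lookup_single when_def)
  then show thesis by (rule that)
qed

lemma linear_forms_span:
  "\<exists>Q. finite Q \<and> (\<forall>f\<in>forms 1 :: ('k::field, 'n::finite) mpoly set. \<exists>c. f = (\<Sum>q\<in>Q. constant_poly (c q) * q))"
proof (intro exI[of _ "range (coordinate :: 'n \<Rightarrow> ('k, 'n) mpoly)"] conjI ballI)
  fix f :: "('k, 'n) mpoly" assume f: "f \<in> forms 1"
  have inj: "inj (coordinate :: 'n \<Rightarrow> ('k, 'n) mpoly)"
    by (rule injI) (metis coordinate_def keys_single singleton_inject zero_neq_one)
  let ?c = "\<lambda>q :: ('k, 'n) mpoly. Poly_Mapping.lookup f (Poly_Mapping.single (inv_into UNIV coordinate q) 1)"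
  have "f = (\<Sum>i\<in>UNIV. Poly_Mapping.single (Poly_Mapping.single i 1) (Poly_Mapping.lookup f (Poly_Mapping.single i 1)))"
  proof (rule poly_mapping_eqI)
    fix m
    show "Poly_Mapping.lookup f m = Poly_Mapping.lookup (\<Sum>i\<in>UNIV. Poly_Mapping.single (Poly_Mapping.single i 1) (Poly_Mapping.lookup f (Poly_Mapping.single i 1))) m"
    proof (cases "total_degree m = 1")
      case True
      then obtain i where m: "m = Poly_Mapping.single i 1" by (rule total_degree_1)
      have "Poly_Mapping.single j (1::nat) = Poly_Mapping.single i 1 \<longleftrightarrow> j = i" for j :: 'n
        by (metis keys_single singleton_inject zero_neq_one)
      then show ?thesis by (simp add: m lookup_sum lookup_single when_def)
    next
      case False
      then have "Poly_Mapping.lookup f m = 0" using f by (auto simp: forms_iff)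
      moreover have "Poly_Mapping.single j 1 \<noteq> m" for j using False total_degree_single[of j 1] by blast
      ultimately show ?thesis by (simp add: lookup_sum lookup_single when_def)
    qed
  qed
  also have "\<dots> = (\<Sum>i\<in>UNIV. constant_poly (?c (coordinate i)) * coordinate i)"
  proof (intro sum.cong refl)
    fix i :: 'n
    have "inv_into UNIV coordinate (coordinate i :: ('k, 'n) mpoly) = i" by (rule inv_f_f[OF inj])
    then show "Poly_Mapping.single (Poly_Mapping.single i 1) (Poly_Mapping.lookup f (Poly_Mapping.single i 1)) =
        constant_poly (?c (coordinate i)) * coordinate i"
      by (simp only:) (simp add: constant_poly_def coordinate_def mult_single)
  qed
  also have "\<dots> = (\<Sum>q\<in>range coordinate. constant_poly (?c q) * q)"
    by (rule sum.reindex[OF inj, symmetric, unfolded comp_def])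
  finally show "\<exists>c. f = (\<Sum>q\<in>range coordinate. constant_poly (c q) * q)" by (intro exI[of _ ?c])
qed simp

interpretation polys: graded_decomposition "forms :: nat \<Rightarrow> ('k::field, 'n::finite) mpoly set" homogeneous_component
proof unfold_locales
  show "additive_pieces (forms :: nat \<Rightarrow> ('k, 'n) mpoly set)"
    unfolding additive_pieces_def
  proof (intro allI conjI ballI)
    fix d and f g :: "('k, 'n) mpoly" assume "f \<in> forms d" "g \<in> forms d"
    then show "f + g \<in> forms d" unfolding forms_iff lookup_add by (metis add.right_neutral)
  qed (auto simp: forms_iff)
  show "a * b \<in> forms (d + e)" if "a \<in> forms d" "b \<in> forms e" for a b :: "('k, 'n) mpoly" and d e
    using that by (rule forms_mult)
  show "(1 :: ('k, 'n) mpoly) \<in> forms 0"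
    by (auto simp: forms_def)
  fix d e and f g :: "('k, 'n) mpoly"
  show "homogeneous_component d f \<in> forms d"
    by (auto simp: forms_iff lookup_homogeneous_component split: if_splits)
  show "homogeneous_component d (f + g) = homogeneous_component d f + homogeneous_component d g"
    by (rule poly_mapping_eqI) (simp add: lookup_homogeneous_component lookup_add)
  show "homogeneous_component d f = f" if "f \<in> forms d"
    by (rule poly_mapping_eqI) (use that in \<open>auto simp: lookup_homogeneous_component forms_iff\<close>)
  show "homogeneous_component e f = 0" if "f \<in> forms d" "e \<noteq> d"
    by (rule poly_mapping_eqI) (use that in \<open>auto simp: lookup_homogeneous_component forms_iff\<close>)
  let ?D = "{d. homogeneous_component d f \<noteq> 0}"
  have D: "?D \<subseteq> total_degree ` Poly_Mapping.keys f"
  proof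
    fix d assume "d \<in> ?D"
    then have "\<exists>m. Poly_Mapping.lookup (homogeneous_component d f) m \<noteq> 0"
      by (auto intro: poly_mapping_eqI)
    then obtain m where "Poly_Mapping.lookup (homogeneous_component d f) m \<noteq> 0" ..
    then show "d \<in> total_degree ` Poly_Mapping.keys f"
      by (auto simp: lookup_homogeneous_component in_keys_iff split: if_splits)
  qed
  then show fin: "finite ?D" by (rule finite_subset) simp
  show "(\<Sum>d\<in>?D. homogeneous_component d f) = f"
  proof (rule poly_mapping_eqI)
    fix m
    have "total_degree m \<in> ?D" if "Poly_Mapping.lookup f m \<noteq> 0"
      using that lookup_homogeneous_component[of "total_degree m" f m] by auto
    then show "Poly_Mapping.lookup (\<Sum>d\<in>?D. homogeneous_component d f) m = Poly_Mapping.lookup f m"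
      using fin by (cases "Poly_Mapping.lookup f m = 0") (auto simp: lookup_sum lookup_homogeneous_component sum.delta)
  qed
qed

section \<open>Ideals of points\<close>

text \<open>
  In degree \<open>0\<close> no nonzero form vanishes at a point.  For \<open>S = {}\<close> the value \<open>{0}\<close> expresses the
  convention that the coordinate ring of the empty set is \<open>k\<close>, so that no case distinction is needed
  below.
\<close>

definition point_ideal :: "('k::field ^ 'n::finite) set set \<Rightarrow> nat \<Rightarrow> ('k, 'n) mpoly set" where
  "point_ideal S d = (if d = 0 then {0} else forms_through d S)"

lemma point_ideal_mono: "S \<subseteq> T \<Longrightarrow> point_ideal T d \<subseteq> point_ideal S d"
  by (auto simp: point_ideal_def forms_through_def vanishes_on_def)

lemma vanishes_on_span:
  assumes "f \<in> forms d"
  shows "(\<forall>u\<in>vec.span {v}. eval_poly f u = 0) \<longleftrightarrow> eval_poly f v = 0"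
proof
  show "eval_poly f v = 0" if "\<forall>u\<in>vec.span {v}. eval_poly f u = 0"
    using that vec.span_base[of v "{v}"] by simp
  show "\<forall>u\<in>vec.span {v}. eval_poly f u = 0" if "eval_poly f v = 0"
    using that assms by (auto simp: vec.span_singleton eval_poly_scaled)
qed

interpretation point_ideals: homogeneous_ideal forms homogeneous_component "point_ideal S"
  for S :: "('k::field ^ 'n::finite) set set"
proof unfold_locales
  show "point_ideal S d \<subseteq> polys.positive_part d" for d
    by (auto simp: point_ideal_def polys.positive_part_def forms_through_def)
  show "polys.graded_submodule (*) (point_ideal S)"
    unfolding polys.graded_submodule_def additive_pieces_def
  proof (intro conjI allI ballI)
    fix j and x y :: "('k, 'n) mpoly" assume "x \<in> point_ideal S j" "y \<in> point_ideal S j"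
    then show "x + y \<in> point_ideal S j"
      using additive_pieces_add[OF polys.H_pieces, of x j y]
      by (auto simp: point_ideal_def forms_through_def vanishes_on_def eval_poly_add)
  next
    fix j and x :: "('k, 'n) mpoly" assume "x \<in> point_ideal S j"
    then show "- x \<in> point_ideal S j"
      using additive_pieces_uminus[OF polys.H_pieces, of x j]
      by (auto simp: point_ideal_def forms_through_def vanishes_on_def eval_poly_uminus)
  next
    fix j show "0 \<in> point_ideal S j"
      using additive_pieces_zero[OF polys.H_pieces, of j]
      by (auto simp: point_ideal_def forms_through_def vanishes_on_def eval_poly_zero)
  next
    fix d j and a x :: "('k, 'n) mpoly" assume "a \<in> forms d" "x \<in> point_ideal S j"
    then show "a * x \<in> point_ideal S (d + j)"
      using forms_mult[of a d x j]
      by (cases "j = 0") (auto simp: point_ideal_def forms_through_def vanishes_on_def eval_poly_mult eval_poly_zero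
          additive_pieces_zero[OF polys.H_pieces])
  qed
qed

lemma coord_ideal_eq:
  assumes "S \<subseteq> projective_points"
  shows "coord_ideal S = polys.ideal_of (point_ideal S)"
proof
  interpret P: cring "type_ring :: ('k::field, 'n::finite) mpoly ring" by (rule cring_from_type_algebra)
  let ?I = "polys.ideal_of (point_ideal S)"
  have gen: "f \<in> ?I" if "f \<in> point_ideal S d" for f d
    using polys.ideal_of_homogeneous[OF point_ideals.J_p] that
      point_ideals.J_pos polys.positive_part_subset by blast
  have sub: "A \<subseteq> ?I \<Longrightarrow> Idl\<^bsub>type_ring\<^esub> A \<subseteq> ?I" for A
    by (rule P.genideal_minimal[OF point_ideals.ideal_J])
  show "coord_ideal S \<subseteq> ?I"
  proof (cases "S = {}")
    case True
    then have "forms d \<subseteq> point_ideal S d" if "0 < d" for d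
      using that by (auto simp: point_ideal_def forms_through_def vanishes_on_def)
    then have "Idl\<^bsub>type_ring\<^esub> (\<Union>d\<in>{0<..}. forms d) \<subseteq> ?I" using gen by (intro sub) blast
    then show ?thesis using True by (simp add: coord_ideal_def)
  next
    case False
    have "forms_through d S \<subseteq> point_ideal S d" for d
    proof (cases "d = 0")
      case True
      have "f = 0" if f: "f \<in> forms_through 0 S" for f
      proof -
        obtain L where L: "L \<in> S" using False by blast
        then obtain v where "L = vec.span {v}" using assms by (auto simp: projective_points_def)
        then have "eval_poly f v = 0"
          using f L vec.span_base[of v "{v}"] by (auto simp: forms_through_def vanishes_on_def)
        moreover obtain c where "f = constant_poly c" using f forms_0 by (auto simp: forms_through_def)
        ultimately show "f = 0" by (simp add: eval_constant_poly) (simp add: constant_poly_def)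
      qed
      then show ?thesis using True by (auto simp: point_ideal_def)
    qed (simp add: point_ideal_def)
    then have "Idl\<^bsub>type_ring\<^esub> (\<Union>d. forms_through d S) \<subseteq> ?I" using gen by (intro sub) blast
    then show ?thesis using False by (simp add: coord_ideal_def)
  qed
  interpret C: ideal "coord_ideal S" type_ring
    unfolding coord_ideal_def by (simp add: P.genideal_ideal)
  have "point_ideal S d \<subseteq> coord_ideal S" for d
  proof (cases "d = 0")
    case True
    then show ?thesis using C.zero_closed by (simp add: point_ideal_def)
  next
    case False
    then have "point_ideal S d \<subseteq> (if S = {} then \<Union>d\<in>{0<..}. forms d else \<Union>d. forms_through d S)"
      by (auto simp: point_ideal_def forms_through_def)
    also have "\<dots> \<subseteq> coord_ideal S"
      unfolding coord_ideal_def by (cases "S = {}") (simp_all add: P.genideal_self)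
    finally show ?thesis .
  qed
  then have comp: "homogeneous_component d f \<in> coord_ideal S" if "f \<in> ?I" for f d
    using that by (auto simp: polys.ideal_of_def)
  show "?I \<subseteq> coord_ideal S"
  proof
    fix f assume f: "f \<in> ?I"
    have "(\<Sum>d\<in>K. homogeneous_component d f) \<in> coord_ideal S" if "finite K" for K
      using that
    proof (induction K rule: finite_induct)
      case empty
      then show ?case using C.zero_closed by simp
    next
      case (insert d K)
      then show ?case using C.a_closed[OF comp[OF f, of d] insert.IH] by simp
    qed
    from this[OF polys.hc_fin[of f]] show "f \<in> coord_ideal S" by (simp add: polys.hc_sum)
  qed
qed

lemma koszul_set_iff:
  assumes "S \<subseteq> projective_points"
  shows "koszul_set S \<longleftrightarrow> koszul_algebra (type_ring Quot polys.ideal_of (point_ideal S))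
    (\<lambda>d. (\<lambda>f. polys.ideal_of (point_ideal S) +>\<^bsub>type_ring\<^esub> f) ` forms d)"
  unfolding koszul_set_def coord_ring_def coord_grading_def[abs_def] coord_ideal_eq[OF assms] ..

section \<open>Removing points\<close>

locale point_resolution =
  lifted_resolution "forms :: nat \<Rightarrow> ('k::field, 'n::finite) mpoly set" "point_ideal S" G w D eps e0
  for S :: "('k::field ^ 'n::finite) set set" and G :: "nat \<Rightarrow> 'b set" and w D eps e0
begin

sublocale lifted_resolution_module forms "point_ideal S" G w D eps e0 "(*)"
  by unfold_locales

lemma point_ideal_quotient:
  assumes "T \<subseteq> S" "T' \<subseteq> S" "T \<subseteq> T'"
  shows "graded_quotient (*) (point_ideal T) (point_ideal T')"
  unfolding graded_quotient_def
proof (intro conjI allI ballI point_ideals.J_sub point_ideal_mono[OF assms(3)])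
  fix d j a x assume "a \<in> point_ideal S d" and x: "x \<in> point_ideal T j"
  then have a: "a \<in> point_ideal T' d" using point_ideal_mono[OF assms(2)] by blast
  have "x \<in> forms j" using x point_ideals.J_pos polys.positive_part_subset by blast
  from graded_submodule_scale[OF point_ideals.J_sub this a]
  show "a * x \<in> point_ideal T' (d + j)" by (simp add: ac_simps)
qed

lemma forms_quotient:
  assumes "T \<subseteq> S"
  shows "graded_quotient (*) forms (point_ideal T)"
  unfolding graded_quotient_def
proof (intro conjI allI ballI point_ideals.J_sub graded_submodule_H)
  show "point_ideal T d \<subseteq> forms d" for d
    using point_ideals.J_pos polys.positive_part_subset by blast
  fix d j and a x :: "('k, 'n) mpoly" assume "a \<in> point_ideal S d" and x: "x \<in> forms j"
  then have "a \<in> point_ideal T d" using point_ideal_mono[OF assms] by blast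
  from graded_submodule_scale[OF point_ideals.J_sub x this]
  show "a * x \<in> point_ideal T (d + j)" by (simp add: ac_simps)
qed

text \<open>
  Evaluation at the point \<open>p\<close> spanned by \<open>v\<close> embeds \<open>I\<^sub>T / I\<^sub>T\<^sub>+\<^sub>p\<close> into the coordinate ring
  \<open>k[t]\<close> of \<open>p\<close> as a nonzero ideal.  Such an ideal is generated by \<open>t ^ a\<close>, where \<open>a\<close> is the least degree of a
  form through \<open>T\<close> that does not vanish at \<open>p\<close>, and so it is \<open>k[t](-a)\<close>.  For \<open>t\<close> one may take a
  coordinate that does not vanish at \<open>p\<close>.
\<close>

lemma reg_le_one_point:
  assumes v: "v \<noteq> 0" and S: "insert (vec.span {v}) T \<subseteq> S"
    and g: "g \<in> point_ideal T d" "eval_poly g v \<noteq> 0"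
  shows "reg_le (*) (point_ideal T) (point_ideal (insert (vec.span {v}) T)) d"
proof -
  let ?T' = "insert (vec.span {v}) T"
  have H: "f \<in> forms j" if "f \<in> point_ideal T j" for f j
    using that point_ideals.J_pos polys.positive_part_subset by blast
  have iff: "f \<in> point_ideal ?T' j \<longleftrightarrow> f \<in> point_ideal T j \<and> eval_poly f v = 0" for f j
    using vanishes_on_span[of f j v] eval_poly_zero[of v]
    by (auto simp: point_ideal_def forms_through_def vanishes_on_def)
  define a where "a = (LEAST j. \<exists>f\<in>point_ideal T j. eval_poly f v \<noteq> 0)"
  have "\<exists>f\<in>point_ideal T a. eval_poly f v \<noteq> 0"
    unfolding a_def by (rule LeastI[of _ d]) (use g in blast)
  then obtain u where u: "u \<in> point_ideal T a" "eval_poly u v \<noteq> 0" by blast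
  have "a \<le> d" unfolding a_def by (rule Least_le) (use g in blast)
  have low: "point_ideal T j \<subseteq> point_ideal ?T' j" if "j < a" for j
    using not_less_Least[of j "\<lambda>j. \<exists>f\<in>point_ideal T j. eval_poly f v \<noteq> 0"] that iff
    unfolding a_def by blast
  obtain i where i: "v $ i \<noteq> 0" using v by (auto simp: vec_eq_iff)
  let ?t = "coordinate i :: ('k, 'n) mpoly"
  have scale: "c * f \<in> point_ideal T (e + j)" if "c \<in> forms e" "f \<in> point_ideal T j" for c f e j
    using graded_submodule_scale[OF point_ideals.J_sub that] .
  have const: "constant_poly c \<in> (forms 0 :: ('k, 'n) mpoly set)" for c by (simp add: forms_0)
  have diff: "f - f' \<in> point_ideal ?T' j"
    if "f \<in> point_ideal T j" "f' \<in> point_ideal T j" "eval_poly f v = eval_poly f' v" for f f' j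
    using that additive_pieces_diff[OF point_ideals.J_p, of f T j f'] by (simp add: iff eval_poly_diff)
  have pow: "\<exists>f\<in>point_ideal T (a + k). eval_poly f v \<noteq> 0" for k
  proof (induction k)
    case 0
    then show ?case using u by auto
  next
    case (Suc k)
    then obtain f where f: "f \<in> point_ideal T (a + k)" "eval_poly f v \<noteq> 0" by blast
    show ?case using scale[OF coordinate_form f(1)] f(2) i
      by (intro bexI[of _ "?t * f"]) (simp_all add: eval_poly_mult eval_coordinate)
  qed
  have "reg_le (*) (point_ideal T) (point_ideal ?T') a"
  proof (rule reg_le_point[OF point_ideal_quotient coordinate_form low u(1)])
    show "c = 0" if c: "c \<in> forms 0" "c * u \<in> point_ideal ?T' a" for c
    proof -
      from c(1) obtain k where k: "c = constant_poly k" using forms_0 by blast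
      then have "k = 0" using c(2) u(2) by (simp add: iff eval_poly_mult eval_constant_poly)
      then show "c = 0" by (simp add: k constant_poly_def)
    qed
    show "\<exists>c\<in>forms 0. x - c * u \<in> point_ideal ?T' a" if x: "x \<in> point_ideal T a" for x
    proof (rule bexI[OF _ const])
      show "x - constant_poly (eval_poly x v / eval_poly u v) * u \<in> point_ideal ?T' a"
        by (rule diff[OF x]) (use scale[OF const u(1)] u(2) in \<open>simp_all add: eval_poly_mult eval_constant_poly\<close>)
    qed
    show "\<exists>x'\<in>point_ideal T j. x - ?t * x' \<in> point_ideal ?T' (Suc j)"
      if j: "a \<le> j" and x: "x \<in> point_ideal T (Suc j)" for j x
    proof -
      obtain f where f: "f \<in> point_ideal T j" "eval_poly f v \<noteq> 0" using pow[of "j - a"] j by auto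
      let ?x' = "constant_poly (eval_poly x v / (v $ i * eval_poly f v)) * f"
      have x': "?x' \<in> point_ideal T j" using scale[OF const f(1)] by simp
      have "x - ?t * ?x' \<in> point_ideal ?T' (Suc j)"
        by (rule diff[OF x]) (use scale[OF coordinate_form x'] f(2) i in
            \<open>simp_all add: eval_poly_mult eval_constant_poly eval_coordinate\<close>)
      with x' show ?thesis by blast
    qed
    show "x \<in> point_ideal ?T' j" if "x \<in> point_ideal T j" "?t * x \<in> point_ideal ?T' (Suc j)" for j x
      using that i by (simp add: iff eval_poly_mult eval_coordinate)
  qed (use S in auto)
  then show ?thesis using \<open>a \<le> d\<close> by (rule reg_le_mono)
qed

text \<open>
  The points of \<open>S - S'\<close> are removed one at a time.  Let \<open>T\<close> be what is left after removing \<open>p\<close>.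
  Independence provides a quadric through \<open>T\<close> that does not contain \<open>p\<close>, so the kernel of
  \<open>P / I\<^sub>T\<^sub>+\<^sub>p \<rightarrow> P / I\<^sub>T\<close> has regularity at most two, and \<open>reg_le_quotient\<close> preserves the bound one for
  the quotients.
\<close>

lemma reg_le_subset:
  assumes S: "finite S" "S \<subseteq> projective_points" and S': "S' \<subseteq> S"
    and ind: "imposes_independent_conditions 2 (S - S') (forms_through 2 S')"
  shows "reg_le (*) forms (point_ideal S') 1"
proof -
  have "reg_le (*) forms (point_ideal (S - U)) 1" if "finite U" "U \<subseteq> S - S'" for U
    using that
  proof (induction U rule: finite_induct)
    case empty
    show ?case using reg_le_mono[OF reg_le_H, of 1] by simp
  next
    case (insert p U)
    let ?T = "S - insert p U"
    have p: "p \<in> S" "p \<notin> S'" "p \<notin> U" using insert by auto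
    then obtain v where v: "p = vec.span {v}" "v \<noteq> 0" using S(2) by (auto simp: projective_points_def)
    obtain i where i: "v $ i \<noteq> 0" using v(2) by (auto simp: vec_eq_iff)
    \<comment> \<open>A section of degree two that is nonzero at \<open>p\<close> and zero at all other points.\<close>
    define \<sigma> :: "('k ^ 'n) set \<Rightarrow> 'k ^ 'n \<Rightarrow> 'k" where
      "\<sigma> = (\<lambda>L x. if L = p then (x $ i) ^ 2 else 0)"
    have "\<sigma> \<in> sections 2 (S - S')" by (simp add: sections_def \<sigma>_def power_mult_distrib)
    then obtain g where g: "g \<in> forms_through 2 S'" "\<forall>L\<in>S - S'. \<forall>x\<in>L. eval_poly g x = \<sigma> L x"
      using ind unfolding imposes_independent_conditions_def by blast
    have "eval_poly g v = (v $ i) ^ 2"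
      using g(2) p v(1) vec.span_base[of v "{v}"] by (simp add: \<sigma>_def)
    then have gv: "eval_poly g v \<noteq> 0" using i by simp
    have "eval_poly g x = 0" if L: "L \<in> ?T" and x: "x \<in> L" for L x
    proof (cases "L \<in> S'")
      case True
      then show ?thesis using g(1) x by (auto simp: forms_through_def vanishes_on_def)
    next
      case False
      then have "eval_poly g x = \<sigma> L x" using g(2) L x by blast
      moreover have "L \<noteq> p" using L by blast
      ultimately show ?thesis by (simp add: \<sigma>_def)
    qed
    then have gT: "g \<in> point_ideal ?T 2"
      using g(1) by (auto simp: point_ideal_def forms_through_def vanishes_on_def)
    have T: "insert p ?T = S - U" using p by blast
    show ?case
    proof (rule reg_le_quotient[OF point_ideal_quotient forms_quotient])
      show "reg_le (*) (point_ideal ?T) (point_ideal (S - U)) (Suc 1)"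
        using reg_le_one_point[OF v(2) _ gT gv] T v(1) p(1) by (simp add: numeral_2_eq_2)
      show "reg_le (*) forms (point_ideal (S - U)) 1" using insert by simp
      show "point_ideal ?T j \<subseteq> forms j" for j
        using point_ideals.J_pos polys.positive_part_subset by blast
    qed auto
  qed
  from this[of "S - S'"] show ?thesis using S(1) S' by (simp add: double_diff)
qed

end

theorem theorem0p3:
  fixes S S' :: "('k::field ^ 'n::finite) set set"
  assumes "finite S" and "S \<subseteq> projective_points"
    and "koszul_set S"
    and "S' \<subseteq> S"
    and "imposes_independent_conditions 2 (S - S') (forms_through 2 S')"
  shows "koszul_set S'"
proof -
  have S': "S' \<subseteq> projective_points" using assms(2,4) by blast
  have "koszul_algebra (type_ring Quot polys.ideal_of (point_ideal S))
      (\<lambda>d. (\<lambda>f. polys.ideal_of (point_ideal S) +>\<^bsub>type_ring\<^esub> f) ` forms d)"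
    using assms(3) unfolding koszul_set_iff[OF assms(2)] .
  then obtain G :: "nat \<Rightarrow> ('k, 'n) mpoly set list set" and w D eps e0
    where res: "lifted_resolution forms (point_ideal S) G w D eps e0"
    by (rule point_ideals.koszul_algebra_lifts)
  interpret point_resolution S G w D eps e0
    by (rule point_resolution.intro) (rule res)
  interpret regularity_one_quotient forms "point_ideal S" G w D eps e0 constant_poly "point_ideal S'"
  proof unfold_locales
    show "constant_poly (a + b) = (constant_poly a + constant_poly b :: ('k, 'n) mpoly)" for a b
      by (simp add: constant_poly_def single_add)
    show "constant_poly (a * b) = (constant_poly a * constant_poly b :: ('k, 'n) mpoly)" for a b
      by (simp add: constant_poly_def mult_single)
    show "constant_poly 1 = (1 :: ('k, 'n) mpoly)" by (simp add: constant_poly_def)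
    show "(forms 0 :: ('k, 'n) mpoly set) = range constant_poly" by (rule forms_0)
    show "\<exists>Q. finite Q \<and> (\<forall>f\<in>forms 1 :: ('k, 'n) mpoly set. \<exists>c. f = (\<Sum>q\<in>Q. constant_poly (c q) * q))"
      by (rule linear_forms_span)
    show "polys.graded_submodule (*) (point_ideal S')" by (rule point_ideals.J_sub)
    show "point_ideal S' d \<subseteq> polys.positive_part d" for d by (rule point_ideals.J_pos)
    show "point_ideal S d \<subseteq> point_ideal S' d" for d by (rule point_ideal_mono[OF assms(4)])
    show "reg_le (*) forms (point_ideal S') 1" by (rule reg_le_subset[OF assms(1,2,4,5)])
  qed
  have "infinite (UNIV :: ('k, 'n) mpoly set list set)" by (rule infinite_UNIV_listI)
  then obtain T :: "nat \<Rightarrow> ('k, 'n) mpoly set list set" and E where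
    "T 0 = {[]}" "\<And>n. finite (T n)"
    "\<And>n b. b \<in> T (Suc n) \<Longrightarrow> E n b \<in> chains (T n) (\<lambda>_. n) forms (Suc n)"
    "\<And>n b. b \<in> T (Suc (Suc n)) \<Longrightarrow>
      lincomb (T (Suc n)) (E n) (E (Suc n) b) \<in> chains (T n) (\<lambda>_. n) (point_ideal S') (Suc (Suc n))"
    "\<And>j x. x \<in> chains (T 0) (\<lambda>_. 0) polys.positive_part j \<Longrightarrow>
      \<exists>y\<in>chains (T 1) (\<lambda>_. 1) forms j. x - lincomb (T 1) (E 0) y \<in> chains (T 0) (\<lambda>_. 0) (point_ideal S') j"
    "\<And>n j x. x \<in> chains (T (Suc n)) (\<lambda>_. Suc n) forms j \<Longrightarrow>
      lincomb (T (Suc n)) (E n) x \<in> chains (T n) (\<lambda>_. n) (point_ideal S') j \<Longrightarrow>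
      \<exists>y\<in>chains (T (Suc (Suc n))) (\<lambda>_. Suc (Suc n)) forms j.
        x - lincomb (T (Suc (Suc n))) (E (Suc n)) y \<in> chains (T (Suc n)) (\<lambda>_. Suc n) (point_ideal S') j"
    by (rule linear_resolution[where ?b0.0 = "[]"]) blast
  from point_ideals.koszul_algebra_from_lifts[OF this]
  show "koszul_set S'" unfolding koszul_set_iff[OF S'] .
qed

end
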